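(* Let $c,M>0$ and let $V\in\mathbb{C}\langle X_1,\ldots,X_m\rangle$ be a $(c,M)$-convex potential with $M\ge M_0$. (1) If $V$ is self-adjoint, there exists a non-commutative law (of $m$ self-adjoint variables) with conjugate variables $(D_iV)_{1\le i\le m}$, and there exists at most one such law satisfying the additional constraint of being the law of variables bounded in norm by $b$. (2) For non-self-adjoint $V$, there exists a law $\mu_V\in\mathbb{C}\langle X_1,\ldots,X_m,X_1^*,\ldots,X_m^*\rangle'$ which satisfies, for all $P\in\mathbb{C}\langle X_1,\ldots,X_m,X_1^*,\ldots,X_m^*\rangle$, $$\sum_{i=1}^m\mu_V\otimes\mu_V\big((\partial_i+\partial_{i,*})(D_i+D_{i,*})P\big)=\sum_{i=1}^m\mu_V\big(D_iV\,D_iP+(D_iV)^*D_{i,*}P\big),$$ and there exists at most one such law satisfying the additional constraint of being the law of variables bounded in norm by $b$.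
   Context: The integer $m\ge1$ is fixed. $\mathbb{C}\langle X_1,\ldots,X_m\rangle$ is the algebra of polynomials in $m$ non-commutative variables, and $\mathbb{C}\langle X_1,\ldots,X_m,X_1^*,\ldots,X_m^*\rangle$ is the $*$-algebra of polynomials in the variables and their formal adjoints. For $m$-tuples $X,Y$ in a $C^*$-algebra with norm $\|\cdot\|_\infty$: $X.Y=\frac12\sum_{i=1}^m(X_iY_i^*+Y_iX_i^* )$ and $\|X\|_\infty=\max_i\|X_i\|_\infty$. Derivatives: for a monomial $P$, $\partial_iP=\sum_{P=P_1X_iP_2}P_1\otimes P_2$ and $D_iP=\sum_{P=P_1X_iP_2}P_2P_1$, with $D=(D_1,\ldots,D_m)$. On $*$-polynomials, $\partial_i,D_i$ are derivatives with respect to $X_i$ with the $X_j^*$ treated as independent constants, and $\partial_{i,*},D_{i,*}$ are the analogous derivatives with respect to $X_i^*$ (i.e. $\partial_{i,*}P=\sum_{P=P_1X_i^*P_2}P_1\otimes P_2$, $D_{i,*}P=\sum_{P=P_1X_i^*P_2}P_2P_1$). $V\in\mathbb{C}\langle X_1,\ldots,X_m\rangle$ is $(c,M)$-convex if for all $m$-tuples $X,Y$ in any $C^*$-algebra with $\|X_i\|_\infty,\|Y_i\|_\infty\le M$ for all $i$ one has $[DV(X)-DV(Y)].(X-Y)\ge c\,(X-Y).(X-Y)$ in the sense of operators. $V$ is self-adjoint if $V(X)^*=V(X)$ for every tuple $X$ of self-adjoint variables. The law of an $m$-tuple $X$ in a $C^*$-probability space with tracial state $\phi$ is the functional $P\mapsto\phi(P(X,X^*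 ))$. A law $\mu$ of $m$ self-adjoint variables has conjugate variables $(\xi_i)_{1\le i\le m}$ if $\mu\otimes\mu(\partial_iP)=\mu(\xi_iP)$ for all $i$ and all $P\in\mathbb{C}\langle X_1,\ldots,X_m\rangle$ (in the self-adjoint case all quantities are regarded as functions of $X_1,\ldots,X_m$ alone). $S$ is an $m$-dimensional free Brownian motion (freely independent self-adjoint components with free increments, $S^i_t-S^i_s$ semicircular of variance $t-s$, $S_0=0$) in a $C^*$-probability space with faithful tracial state; $X_t^Z$ denotes the solution of $dX_t=dS_t-\frac12DV(X_t)dt$, i.e. $X_t=Z+S_t-\frac12\int_0^tDV(X_s)ds$, with initial datum $Z$ ($*$-free from $S$). Constants: $M_0=M_0(c,\|DV(0).DV(0)\|_\infty)$, $B_0=B_0(c,\|DV(0).DV(0)\|_\infty)$ and $b=b(c,\|DV(0).DV(0)\|_\infty,M)\ge B_0$ are fixed finite constants such that for every $(c,M)$-convex $V$ with $M\ge M_0$ and every $Z$ with $\|Z\|_\infty<b$: the solution $X_t^Z$ exists and is unique on $[0,\infty)$, $\|X_t^Z\|_\infty\le M$ for all $t$, and $\limsup_{t\to\infty}\|X_t^Z\|_\infty\le B_0$. *)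

theory Defs
  imports
    "HOL-Analysis.Analysis"
    "HOL-Library.Poly_Mapping"
    "HOL-Library.Equipollence"
    "HOL-Algebra.Ring"
begin

section \<open>Non-commutative polynomials\<close>

text \<open>
  The free algebra on a set of letters is the monoid algebra of the free monoid, i.e. finitely
  supported functions from words to coefficients.  Making lists a monoid under concatenation
  turns the library product on \<open>\<Rightarrow>\<^sub>0\<close> into the non-commutative product.
\<close>

instantiation list :: (type) monoid_add
begin

definition zero_list :: "'a list" where "zero_list = []"
definition plus_list :: "'a list \<Rightarrow> 'a list \<Rightarrow> 'a list" where "plus_list u v = u @ v"

instance by standard (simp_all add: zero_list_def plus_list_def)

end

type_synonym 'x ncpoly = "'x list \<Rightarrow>\<^sub>0 complex"

text \<open>The algebraic tensor square of the free algebra, with basis the pairs \<open>u \<otimes> v\<close> of words.\<close>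
type_synonym 'x nctensor = "('x list \<times> 'x list) \<Rightarrow>\<^sub>0 complex"

text \<open>Letters \<open>X\<^sub>i\<close> and their formal adjoints \<open>X\<^sub>i\<^sup>*\<close>; the *-polynomials are \<open>'m var ncpoly\<close>.\<close>
datatype 'm var = Var 'm | Adj 'm

fun flip_var :: "'m var \<Rightarrow> 'm var" where
  "flip_var (Var i) = Adj i"
| "flip_var (Adj i) = Var i"

definition star_poly :: "'m var ncpoly \<Rightarrow> 'm var ncpoly" where
  "star_poly P = (\<Sum>w\<in>Poly_Mapping.keys P.
     Poly_Mapping.single (rev (map flip_var w)) (cnj (Poly_Mapping.lookup P w)))"

definition to_star_poly :: "'m ncpoly \<Rightarrow> 'm var ncpoly" where
  "to_star_poly P = (\<Sum>w\<in>Poly_Mapping.keys P.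
     Poly_Mapping.single (map Var w) (Poly_Mapping.lookup P w))"

text \<open>
  Free difference quotient and cyclic derivative with respect to one letter.  On *-polynomials,
  taking the letter \<open>Var i\<close> gives \<open>\<partial>\<^sub>i, D\<^sub>i\<close>, and \<open>Adj i\<close> gives the derivatives with respect to
  \<open>X\<^sub>i\<^sup>*\<close>.
\<close>

definition free_diff :: "'x \<Rightarrow> 'x ncpoly \<Rightarrow> 'x nctensor" where
  "free_diff x P = (\<Sum>w\<in>Poly_Mapping.keys P. \<Sum>k | k < length w \<and> w ! k = x.
     Poly_Mapping.single (take k w, drop (Suc k) w) (Poly_Mapping.lookup P w))"

definition cyc_deriv :: "'x \<Rightarrow> 'x ncpoly \<Rightarrow> 'x ncpoly" where
  "cyc_deriv x P = (\<Sum>w\<in>Poly_Mapping.keys P. \<Sum>k | k < length w \<and> w ! k = x.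
     Poly_Mapping.single (drop (Suc k) w @ take k w) (Poly_Mapping.lookup P w))"

text \<open>\<open>\<mu> \<otimes> \<mu>\<close> for a linear functional \<open>\<mu>\<close>.\<close>
definition tensor_fun :: "('x ncpoly \<Rightarrow> complex) \<Rightarrow> 'x nctensor \<Rightarrow> complex" where
  "tensor_fun \<mu> T = (\<Sum>(u, v)\<in>Poly_Mapping.keys T. Poly_Mapping.lookup T (u, v)
     * \<mu> (Poly_Mapping.single u 1) * \<mu> (Poly_Mapping.single v 1))"

section \<open>C*-algebras\<close>

record 'u cstar = "'u ring" +
  smul :: "complex \<Rightarrow> 'u \<Rightarrow> 'u"
  adj :: "'u \<Rightarrow> 'u"
  nrm :: "'u \<Rightarrow> real"

text \<open>Unital complex C*-algebras, with an explicit carrier.\<close>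
locale cstar_algebra = ring A for A :: "'u cstar" (structure) +
  assumes smul_closed: "x \<in> carrier A \<Longrightarrow> smul A a x \<in> carrier A"
    and smul_add_right: "x \<in> carrier A \<Longrightarrow> y \<in> carrier A \<Longrightarrow>
          smul A a (x \<oplus> y) = smul A a x \<oplus> smul A a y"
    and smul_add_left: "x \<in> carrier A \<Longrightarrow> smul A (a + d) x = smul A a x \<oplus> smul A d x"
    and smul_smul: "x \<in> carrier A \<Longrightarrow> smul A a (smul A d x) = smul A (a * d) x"
    and smul_one: "x \<in> carrier A \<Longrightarrow> smul A 1 x = x"
    and smul_mult_left: "x \<in> carrier A \<Longrightarrow> y \<in> carrier A \<Longrightarrow> smul A a x \<otimes> y = smul A a (x \<otimes> y)"
    and smul_mult_right: "x \<in> carrier A \<Longrightarrow> y \<in> carrier A \<Longrightarrow> x \<otimes> smul A a y = smul A a (x \<otimes> y)"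
    and adj_closed: "x \<in> carrier A \<Longrightarrow> adj A x \<in> carrier A"
    and adj_adj: "x \<in> carrier A \<Longrightarrow> adj A (adj A x) = x"
    and adj_add: "x \<in> carrier A \<Longrightarrow> y \<in> carrier A \<Longrightarrow> adj A (x \<oplus> y) = adj A x \<oplus> adj A y"
    and adj_smul: "x \<in> carrier A \<Longrightarrow> adj A (smul A a x) = smul A (cnj a) (adj A x)"
    and adj_mult: "x \<in> carrier A \<Longrightarrow> y \<in> carrier A \<Longrightarrow> adj A (x \<otimes> y) = adj A y \<otimes> adj A x"
    and nrm_nonneg: "x \<in> carrier A \<Longrightarrow> 0 \<le> nrm A x"
    and nrm_eq_zero: "x \<in> carrier A \<Longrightarrow> nrm A x = 0 \<longleftrightarrow> x = \<zero>"
    and nrm_triangle: "x \<in> carrier A \<Longrightarrow> y \<in> carrier A \<Longrightarrow> nrm A (x \<oplus> y) \<le> nrm A x + nrm A y"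
    and nrm_smul: "x \<in> carrier A \<Longrightarrow> nrm A (smul A a x) = cmod a * nrm A x"
    and nrm_mult: "x \<in> carrier A \<Longrightarrow> y \<in> carrier A \<Longrightarrow> nrm A (x \<otimes> y) \<le> nrm A x * nrm A y"
    and cstar_identity: "x \<in> carrier A \<Longrightarrow> nrm A (adj A x \<otimes> x) = (nrm A x)\<^sup>2"
    and nrm_complete: "(\<And>n. s n \<in> carrier A) \<Longrightarrow>
          (\<forall>e>0. \<exists>N. \<forall>j\<ge>N. \<forall>k\<ge>N. nrm A (s j \<ominus> s k) < e) \<Longrightarrow>
          \<exists>x\<in>carrier A. (\<lambda>n::nat. nrm A (s n \<ominus> x)) \<longlonglongrightarrow> 0"

definition complex_cstar :: "complex cstar" where
  "complex_cstar = \<lparr>carrier = UNIV, monoid.mult = (*), one = 1, zero = 0, add = (+),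
     smul = (*), adj = cnj, nrm = cmod\<rparr>"

definition cstar_positive :: "'u cstar \<Rightarrow> 'u \<Rightarrow> bool" where
  "cstar_positive A a \<longleftrightarrow> (\<exists>y\<in>carrier A. a = adj A y \<otimes>\<^bsub>A\<^esub> y)"

definition cstar_le :: "'u cstar \<Rightarrow> 'u \<Rightarrow> 'u \<Rightarrow> bool" where
  "cstar_le A x y \<longleftrightarrow> cstar_positive A (y \<ominus>\<^bsub>A\<^esub> x)"

definition word_prod :: "'u cstar \<Rightarrow> 'u list \<Rightarrow> 'u" where
  "word_prod A xs = foldr (\<lambda>x y. x \<otimes>\<^bsub>A\<^esub> y) xs \<one>\<^bsub>A\<^esub>"

definition eval_poly :: "'u cstar \<Rightarrow> ('x \<Rightarrow> 'u) \<Rightarrow> 'x ncpoly \<Rightarrow> 'u" where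
  "eval_poly A X P = (\<Oplus>\<^bsub>A\<^esub>w\<in>Poly_Mapping.keys P.
     smul A (Poly_Mapping.lookup P w) (word_prod A (map X w)))"

fun with_adj :: "'u cstar \<Rightarrow> ('m \<Rightarrow> 'u) \<Rightarrow> 'm var \<Rightarrow> 'u" where
  "with_adj A X (Var i) = X i"
| "with_adj A X (Adj i) = adj A (X i)"

text \<open>The operation \<open>X.Y\<close> and the norm of a tuple.\<close>

definition tuple_dot :: "'u cstar \<Rightarrow> ('m::finite \<Rightarrow> 'u) \<Rightarrow> ('m \<Rightarrow> 'u) \<Rightarrow> 'u" where
  "tuple_dot A X Y = smul A (1/2)
     (\<Oplus>\<^bsub>A\<^esub>i\<in>UNIV. (X i \<otimes>\<^bsub>A\<^esub> adj A (Y i)) \<oplus>\<^bsub>A\<^esub> (Y i \<otimes>\<^bsub>A\<^esub> adj A (X i)))"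

definition tuple_norm :: "'u cstar \<Rightarrow> ('m::finite \<Rightarrow> 'u) \<Rightarrow> real" where
  "tuple_norm A X = (MAX i. nrm A (X i))"

definition tuple_diff :: "'u cstar \<Rightarrow> ('m \<Rightarrow> 'u) \<Rightarrow> ('m \<Rightarrow> 'u) \<Rightarrow> 'm \<Rightarrow> 'u" where
  "tuple_diff A X Y = (\<lambda>i. X i \<ominus>\<^bsub>A\<^esub> Y i)"

definition cyc_grad_at :: "'u cstar \<Rightarrow> 'm ncpoly \<Rightarrow> ('m \<Rightarrow> 'u) \<Rightarrow> 'm \<Rightarrow> 'u" where
  "cyc_grad_at A V X = (\<lambda>i. eval_poly A X (cyc_deriv i V))"

text \<open>
  \<open>\<parallel>DV(0).DV(0)\<parallel>\<close>; the entries of \<open>DV(0)\<close> are scalars, so this is computed in the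
  C*-algebra of complex numbers.
\<close>
definition grad_size_at_0 :: "'m::finite ncpoly \<Rightarrow> real" where
  "grad_size_at_0 V =
     (let g = cyc_grad_at complex_cstar V (\<lambda>_. 0) in nrm complex_cstar (tuple_dot complex_cstar g g))"

text \<open>
  HOL cannot quantify over types inside a formula, so ``any C*-algebra'' ranges over all
  C*-algebras whose carrier is a set of elements of a type \<open>'u\<close>, the universe, passed as
  \<open>'u itself\<close>.  If \<open>'u\<close> has at least the cardinality of the continuum, it contains an isomorphic
  copy of every separable C*-algebra.  The conditions below concern finitely many elements, or
  a norm-continuous path, at a time, and so only the separable subalgebra which these generate.
\<close>

definition self_adjoint_poly :: "'u itself \<Rightarrow> 'm ncpoly \<Rightarrow> bool" where
  "self_adjoint_poly (_ :: 'u itself) V \<longleftrightarrow>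
     (\<forall>(A :: 'u cstar) X. cstar_algebra A \<longrightarrow> (\<forall>i. X i \<in> carrier A \<and> adj A (X i) = X i) \<longrightarrow>
        adj A (eval_poly A X V) = eval_poly A X V)"

definition cM_convex :: "'u itself \<Rightarrow> real \<Rightarrow> real \<Rightarrow> 'm::finite ncpoly \<Rightarrow> bool" where
  "cM_convex (_ :: 'u itself) c M V \<longleftrightarrow>
     (\<forall>(A :: 'u cstar) X Y. cstar_algebra A \<longrightarrow>
        (\<forall>i. X i \<in> carrier A \<and> Y i \<in> carrier A \<and> nrm A (X i) \<le> M \<and> nrm A (Y i) \<le> M) \<longrightarrow>
        cstar_le A
          (smul A (of_real c) (tuple_dot A (tuple_diff A X Y) (tuple_diff A X Y)))
          (tuple_dot A (tuple_diff A (cyc_grad_at A V X) (cyc_grad_at A V Y)) (tuple_diff A X Y)))"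

section \<open>Tracial C*-probability spaces and laws\<close>

locale tracial_cstar_space = cstar_algebra A for A :: "'u cstar" (structure) +
  fixes \<phi> :: "'u \<Rightarrow> complex"
  assumes state_add: "x \<in> carrier A \<Longrightarrow> y \<in> carrier A \<Longrightarrow> \<phi> (x \<oplus> y) = \<phi> x + \<phi> y"
    and state_smul: "x \<in> carrier A \<Longrightarrow> \<phi> (smul A a x) = a * \<phi> x"
    and state_one: "\<phi> \<one> = 1"
    and state_pos: "x \<in> carrier A \<Longrightarrow> \<phi> (adj A x \<otimes> x) \<in> \<real>\<^sub>\<ge>\<^sub>0"
    and state_tracial: "x \<in> carrier A \<Longrightarrow> y \<in> carrier A \<Longrightarrow> \<phi> (x \<otimes> y) = \<phi> (y \<otimes> x)"

locale faithful_tracial_cstar_space = tracial_cstar_space +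
  assumes state_faithful: "x \<in> carrier A \<Longrightarrow> \<phi> (adj A x \<otimes> x) = 0 \<Longrightarrow> x = \<zero>"

text \<open>Laws of tuples of self-adjoint variables; the second version asks for norms at most \<open>R\<close>.\<close>

definition is_sa_law :: "'u itself \<Rightarrow> ('m ncpoly \<Rightarrow> complex) \<Rightarrow> bool" where
  "is_sa_law (_ :: 'u itself) \<mu> \<longleftrightarrow>
     (\<exists>(A :: 'u cstar) \<phi> X. tracial_cstar_space A \<phi> \<and> (\<forall>i. X i \<in> carrier A \<and> adj A (X i) = X i) \<and>
        (\<forall>P. \<mu> P = \<phi> (eval_poly A X P)))"

definition is_sa_law_bounded :: "'u itself \<Rightarrow> real \<Rightarrow> ('m::finite ncpoly \<Rightarrow> complex) \<Rightarrow> bool" where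
  "is_sa_law_bounded (_ :: 'u itself) R \<mu> \<longleftrightarrow>
     (\<exists>(A :: 'u cstar) \<phi> X. tracial_cstar_space A \<phi> \<and> (\<forall>i. X i \<in> carrier A \<and> adj A (X i) = X i) \<and>
        tuple_norm A X \<le> R \<and> (\<forall>P. \<mu> P = \<phi> (eval_poly A X P)))"

text \<open>Laws of tuples that need not be self-adjoint, as functionals on *-polynomials.\<close>

definition is_law :: "'u itself \<Rightarrow> ('m var ncpoly \<Rightarrow> complex) \<Rightarrow> bool" where
  "is_law (_ :: 'u itself) \<mu> \<longleftrightarrow>
     (\<exists>(A :: 'u cstar) \<phi> X. tracial_cstar_space A \<phi> \<and> (\<forall>i. X i \<in> carrier A) \<and>
        (\<forall>P. \<mu> P = \<phi> (eval_poly A (with_adj A X) P)))"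

definition is_law_bounded :: "'u itself \<Rightarrow> real \<Rightarrow> ('m::finite var ncpoly \<Rightarrow> complex) \<Rightarrow> bool" where
  "is_law_bounded (_ :: 'u itself) R \<mu> \<longleftrightarrow>
     (\<exists>(A :: 'u cstar) \<phi> X. tracial_cstar_space A \<phi> \<and> (\<forall>i. X i \<in> carrier A) \<and>
        tuple_norm A X \<le> R \<and> (\<forall>P. \<mu> P = \<phi> (eval_poly A (with_adj A X) P)))"

definition has_conjugate_variables :: "('m ncpoly \<Rightarrow> complex) \<Rightarrow> ('m \<Rightarrow> 'm ncpoly) \<Rightarrow> bool" where
  "has_conjugate_variables \<mu> \<xi> \<longleftrightarrow> (\<forall>i P. tensor_fun \<mu> (free_diff i P) = \<mu> (\<xi> i * P))"

text \<open>The equation of the non-self-adjoint case, with \<open>Q = (D\<^sub>i + D\<^sub>i\<^sub>,\<^sub>*) P\<close>.\<close>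
definition star_schwinger_dyson :: "'m::finite ncpoly \<Rightarrow> ('m var ncpoly \<Rightarrow> complex) \<Rightarrow> bool" where
  "star_schwinger_dyson V \<mu> \<longleftrightarrow> (\<forall>P.
     (\<Sum>i\<in>UNIV. let Q = cyc_deriv (Var i) P + cyc_deriv (Adj i) P
               in tensor_fun \<mu> (free_diff (Var i) Q + free_diff (Adj i) Q)) =
     (\<Sum>i\<in>UNIV. let DV = to_star_poly (cyc_deriv i V)
               in \<mu> (DV * cyc_deriv (Var i) P + star_poly DV * cyc_deriv (Adj i) P)))"

section \<open>Freeness and the free Brownian motion\<close>

text \<open>The unital *-subalgebra generated by a set.\<close>
inductive_set star_alg :: "'u cstar \<Rightarrow> 'u set \<Rightarrow> 'u set" for A :: "'u cstar" and G :: "'u set" where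
  gen: "x \<in> G \<Longrightarrow> x \<in> star_alg A G"
| one: "\<one>\<^bsub>A\<^esub> \<in> star_alg A G"
| add: "x \<in> star_alg A G \<Longrightarrow> y \<in> star_alg A G \<Longrightarrow> x \<oplus>\<^bsub>A\<^esub> y \<in> star_alg A G"
| mult: "x \<in> star_alg A G \<Longrightarrow> y \<in> star_alg A G \<Longrightarrow> x \<otimes>\<^bsub>A\<^esub> y \<in> star_alg A G"
| smul: "x \<in> star_alg A G \<Longrightarrow> smul A a x \<in> star_alg A G"
| adj: "x \<in> star_alg A G \<Longrightarrow> adj A x \<in> star_alg A G"

text \<open>
  *-freeness of a family of sets of elements: alternating products of centred elements of the
  generated *-subalgebras are centred.
\<close>
definition star_free :: "'u cstar \<Rightarrow> ('u \<Rightarrow> complex) \<Rightarrow> ('j \<Rightarrow> 'u set) \<Rightarrow> bool" where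
  "star_free A \<phi> G \<longleftrightarrow>
     (\<forall>ps. ps \<noteq> [] \<longrightarrow> distinct_adj (map fst ps) \<longrightarrow>
        (\<forall>(j, a)\<in>set ps. a \<in> star_alg A (G j) \<and> \<phi> a = 0) \<longrightarrow>
        \<phi> (word_prod A (map snd ps)) = 0)"

definition star_free_pair :: "'u cstar \<Rightarrow> ('u \<Rightarrow> complex) \<Rightarrow> 'u set \<Rightarrow> 'u set \<Rightarrow> bool" where
  "star_free_pair A \<phi> G H \<longleftrightarrow> star_free A \<phi> (\<lambda>j::bool. if j then G else H)"

text \<open>Centred semicircular elements of variance \<open>v > 0\<close>, through the moments of the density.\<close>
definition semicircular :: "'u cstar \<Rightarrow> ('u \<Rightarrow> complex) \<Rightarrow> real \<Rightarrow> 'u \<Rightarrow> bool" where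
  "semicircular A \<phi> v x \<longleftrightarrow> x \<in> carrier A \<and> adj A x = x \<and>
     (\<forall>n::nat. \<phi> (x [^]\<^bsub>A\<^esub> n) = of_real
        (integral {-2 * sqrt v .. 2 * sqrt v} (\<lambda>y. y ^ n * sqrt (4 * v - y\<^sup>2) / (2 * pi * v))))"

text \<open>The paths matter on \<open>{0..}\<close> only; values at negative times are junk.\<close>
definition free_brownian_motion ::
    "'u cstar \<Rightarrow> ('u \<Rightarrow> complex) \<Rightarrow> (real \<Rightarrow> 'm \<Rightarrow> 'u) \<Rightarrow> bool" where
  "free_brownian_motion A \<phi> S \<longleftrightarrow>
     (\<forall>t\<ge>0. \<forall>i. S t i \<in> carrier A \<and> adj A (S t i) = S t i) \<and>
     (\<forall>i. S 0 i = \<zero>\<^bsub>A\<^esub>) \<and>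
     star_free A \<phi> (\<lambda>i. (\<lambda>t. S t i) ` {0..}) \<and>
     (\<forall>i s t. 0 \<le> s \<longrightarrow> s < t \<longrightarrow>
        semicircular A \<phi> (t - s) (S t i \<ominus>\<^bsub>A\<^esub> S s i) \<and>
        star_free_pair A \<phi> ((\<lambda>u. S u i) ` {0..s}) {S t i \<ominus>\<^bsub>A\<^esub> S s i})"

section \<open>The free stochastic differential equation\<close>

text \<open>
  The library integral is restricted to types in \<open>real_normed_vector\<close>; this is its definition (a limit
  of Riemann sums along the gauge filter)
  on a compact interval, with values in \<open>A\<close>.
\<close>
definition cstar_has_integral ::
    "'u cstar \<Rightarrow> (real \<Rightarrow> 'u) \<Rightarrow> 'u \<Rightarrow> real \<Rightarrow> real \<Rightarrow> bool" where
  "cstar_has_integral A f I s t \<longleftrightarrow> I \<in> carrier A \<and>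
     ((\<lambda>p. nrm A ((\<Oplus>\<^bsub>A\<^esub>q\<in>p. smul A (of_real (measure lborel (snd q))) (f (fst q))) \<ominus>\<^bsub>A\<^esub> I))
        \<longlongrightarrow> 0) (division_filter (cbox s t))"

definition sde_solution ::
    "'u cstar \<Rightarrow> (real \<Rightarrow> 'm \<Rightarrow> 'u) \<Rightarrow> 'm ncpoly \<Rightarrow> ('m \<Rightarrow> 'u) \<Rightarrow> (real \<Rightarrow> 'm \<Rightarrow> 'u) \<Rightarrow> bool" where
  "sde_solution A S V Z X \<longleftrightarrow>
     (\<forall>t\<ge>0. \<forall>i. X t i \<in> carrier A) \<and>
     (\<forall>t\<ge>0. \<forall>i. ((\<lambda>s. nrm A (X s i \<ominus>\<^bsub>A\<^esub> X t i)) \<longlongrightarrow> 0) (at t within {0..})) \<and>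
     (\<forall>t\<ge>0. \<forall>i. \<exists>I. cstar_has_integral A (\<lambda>s. cyc_grad_at A V (X s) i) I 0 t \<and>
        X t i = (Z i \<oplus>\<^bsub>A\<^esub> S t i) \<ominus>\<^bsub>A\<^esub> smul A (1/2) I)"

text \<open>
  The defining property of the constants \<open>M\<^sub>0\<close>, \<open>B\<^sub>0\<close>, \<open>b\<close>; the argument \<open>K\<close> stands for
  \<open>\<parallel>DV(0).DV(0)\<parallel>\<close>.  Positivity of \<open>b\<close> makes the second part apply to some \<open>Z\<close> (e.g. to 0);
  without it \<open>b = 0\<close> would be admissible and the constants would say nothing.
\<close>
definition sde_constants :: "'u itself \<Rightarrow> 'm::finite itself \<Rightarrow>
    (real \<Rightarrow> real \<Rightarrow> real) \<Rightarrow> (real \<Rightarrow> real \<Rightarrow> real) \<Rightarrow> (real \<Rightarrow> real \<Rightarrow> real \<Rightarrow> real) \<Rightarrow> bool" where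
  "sde_constants (U :: 'u itself) (_ :: 'm itself) M0 B0 b \<longleftrightarrow>
     (\<forall>c>0. \<forall>K\<ge>0. \<forall>M>0. M0 c K \<le> M \<longrightarrow> B0 c K \<le> b c K M \<and> 0 < b c K M) \<and>
     (\<forall>c>0. \<forall>M>0. \<forall>V :: 'm ncpoly. cM_convex U c M V \<longrightarrow> M0 c (grad_size_at_0 V) \<le> M \<longrightarrow>
       (\<forall>(A :: 'u cstar) \<phi> S Z.
          faithful_tracial_cstar_space A \<phi> \<longrightarrow> free_brownian_motion A \<phi> S \<longrightarrow>
          (\<forall>i. Z i \<in> carrier A) \<longrightarrow>
          star_free_pair A \<phi> (range Z) {S t i | t i. 0 \<le> t} \<longrightarrow>
          tuple_norm A Z < b c (grad_size_at_0 V) M \<longrightarrow>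
          (\<exists>X. sde_solution A S V Z X) \<and>
          (\<forall>X Y. sde_solution A S V Z X \<longrightarrow> sde_solution A S V Z Y \<longrightarrow> (\<forall>t\<ge>0. X t = Y t)) \<and>
          (\<forall>X. sde_solution A S V Z X \<longrightarrow>
             (\<forall>t\<ge>0. tuple_norm A (X t) \<le> M) \<and>
             Limsup at_top (\<lambda>t. ereal (tuple_norm A (X t))) \<le> ereal (B0 c (grad_size_at_0 V)))))"

end

theory Submission
  imports Defs
begin

text \<open>
  The convexity condition is an operator inequality, and it is far more restrictive than its scalar form: it
  forces the gradient \<open>DV\<close> to be affine. The reason is that \<open>[DV(X) - DV(Y)].(X - Y) \<ge> c (X - Y).(X - Y)\<close>, tested on a
  vector \<open>\<xi>\<close>, involves \<open>X - Y\<close> on the right only through the vectors \<open>(X - Y)\<^sub>i\<^sup>* \<xi>\<close>. If a word \<open>u\<close> of length at least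
  two occurs in \<open>D\<^sub>i V\<close>, then matrices acting along a path labelled by \<open>u\<close> make these vectors as small as one likes, of
  size \<open>t\<close>, while a change of fixed size and arbitrary phase on the second edge of the path contributes a term
  proportional to \<open>t\<close> on the left, against \<open>c t\<^sup>2\<close> on the right (\<open>convex_gradient_affine\<close>). So
  \<open>D\<^sub>i V = b\<^sub>i + \<Sum>\<^sub>j B\<^sub>i\<^sub>j X\<^sub>j\<close>, and scalar test points show that the real part of \<open>B\<close> is at least \<open>c\<close>
  (\<open>convex_gradient_accretive\<close>).

  With an affine gradient the equations of both parts determine the moments by recursion on the length of words.
  For conjugate variables, the equation for a word \<open>w\<close> expresses \<open>\<Sum>\<^sub>j B\<^sub>i\<^sub>j \<mu>(X\<^sub>j w)\<close> by shorter words, and \<open>B\<close> is invertible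
  (\<open>conjugate_variables_unique\<close>). In the non-self-adjoint case it gives the sum over all letters of the word of the
  moments with \<open>B\<close> applied to this letter; this operator on the tensor power still has real part bounded
  below, by \<open>c\<close> times the length (\<open>weak_sd_unique\<close>).

  The laws exist as laws of semicircular families, which are constructed on the full Fock space
  (\<open>semicircular_family\<close>). For self-adjoint \<open>V\<close> the matrix \<open>B\<close> is real and symmetric, and its inverse is the
  covariance (\<open>conjugate_variables_exist\<close>). In general the covariance solves the Lyapunov equation for \<open>B\<close>, and its
  positivity follows from that of the right-hand side (\<open>lyap_psd\<close>, \<open>star_law_exist\<close>). The operators of a law are obtained by
  completing the algebra of polynomials (\<open>completion_exists\<close>), which has at most continuum many elements and so fits
  into the universe.
\<close>

section \<open>Positive semidefinite kernels\<close>

lemma cmod_square_eq: "(complex_of_real (cmod z))\<^sup>2 = z * cnj z"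
  using complex_norm_square[of z] by simp

text \<open>Lists of weighted points are formal linear combinations; a list may repeat a point, so that pulling
  a kernel back along any map of points into combinations is merely a list operation.\<close>

definition lin_ext :: "('b \<Rightarrow> complex) \<Rightarrow> (complex \<times> 'b) list \<Rightarrow> complex" where
  "lin_ext \<phi> xs = (\<Sum>(c, b)\<leftarrow>xs. c * \<phi> b)"

definition sesq :: "('b \<Rightarrow> 'b \<Rightarrow> complex) \<Rightarrow> (complex \<times> 'b) list \<Rightarrow> (complex \<times> 'b) list \<Rightarrow> complex" where
  "sesq f xs ys = (\<Sum>(c, b)\<leftarrow>xs. cnj c * lin_ext (f b) ys)"

definition psd :: "('b \<Rightarrow> 'b \<Rightarrow> complex) \<Rightarrow> bool" where
  "psd f \<longleftrightarrow> (\<forall>xs. sesq f xs xs \<in> \<real>\<^sub>\<ge>\<^sub>0)"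

definition bind_list :: "(complex \<times> 'b) list \<Rightarrow> ('b \<Rightarrow> (complex \<times> 'd) list) \<Rightarrow> (complex \<times> 'd) list" where
  "bind_list xs A = concat (map (\<lambda>(c, b). map (\<lambda>(d, b'). (c * d, b')) (A b)) xs)"

lemma lin_ext_simps [simp]:
  "lin_ext \<phi> [] = 0" "lin_ext \<phi> (p # xs) = fst p * \<phi> (snd p) + lin_ext \<phi> xs"
  "lin_ext \<phi> (xs @ ys) = lin_ext \<phi> xs + lin_ext \<phi> ys"
  by (auto simp: lin_ext_def case_prod_beta)

lemma sesq_simps [simp]:
  "sesq f [] ys = 0" "sesq f (p # xs) ys = cnj (fst p) * lin_ext (f (snd p)) ys + sesq f xs ys"
  "sesq f (xs @ xs') ys = sesq f xs ys + sesq f xs' ys"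
  by (auto simp: sesq_def case_prod_beta)

lemma bind_list_simps [simp]:
  "bind_list [] A = []" "bind_list (p # xs) A = map (\<lambda>(d, b'). (fst p * d, b')) (A (snd p)) @ bind_list xs A"
  "bind_list (xs @ ys) A = bind_list xs A @ bind_list ys A"
  by (auto simp: bind_list_def case_prod_beta)

lemma lin_ext_scale [simp]: "lin_ext \<phi> (map (\<lambda>(d, b'). (c * d, b')) xs) = c * lin_ext \<phi> xs"
  by (induction xs) (auto simp: algebra_simps)

lemma lin_ext_bind: "lin_ext \<phi> (bind_list xs A) = lin_ext (\<lambda>b. lin_ext \<phi> (A b)) xs"
  by (induction xs) auto

lemma sesq_scale [simp]: "sesq f (map (\<lambda>(d, b'). (c * d, b')) xs) ys = cnj c * sesq f xs ys"
  by (induction xs) (auto simp: algebra_simps)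

lemma lin_ext_add: "lin_ext (\<lambda>b. \<phi> b + \<psi> b) xs = lin_ext \<phi> xs + lin_ext \<psi> xs"
  and lin_ext_diff: "lin_ext (\<lambda>b. \<phi> b - \<psi> b) xs = lin_ext \<phi> xs - lin_ext \<psi> xs"
  and lin_ext_cmult: "lin_ext (\<lambda>b. c * \<phi> b) xs = c * lin_ext \<phi> xs"
  and lin_ext_zero: "lin_ext (\<lambda>b. 0) xs = 0"
  by (induction xs) (auto simp: algebra_simps)

lemma sesq_add: "sesq (\<lambda>b d. f b d + g b d) xs ys = sesq f xs ys + sesq g xs ys"
  and sesq_diff: "sesq (\<lambda>b d. f b d - g b d) xs ys = sesq f xs ys - sesq g xs ys"
  and sesq_cmult: "sesq (\<lambda>b d. c * f b d) xs ys = c * sesq f xs ys"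
  and sesq_zero: "sesq (\<lambda>b d. 0) xs ys = 0"
  by (induction xs) (auto simp: algebra_simps lin_ext_add lin_ext_diff lin_ext_cmult lin_ext_zero)

lemma sesq_right: 
  "sesq f xs (ys @ zs) = sesq f xs ys + sesq f xs zs" "sesq f xs [] = 0"
  "sesq f xs (map (\<lambda>(d, b'). (c * d, b')) ys) = c * sesq f xs ys"
  by (induction xs) (auto simp: distrib_left)

lemma sesq_Cons_right: "sesq f xs (p # ys) = fst p * (\<Sum>(c,b)\<leftarrow>xs. cnj c * f b (snd p)) + sesq f xs ys"
  by (induction xs) (auto simp: algebra_simps)

lemma sesq_bind: "sesq f (bind_list xs A) (bind_list ys B) = sesq (\<lambda>u v. sesq f (A u) (B v)) xs ys"
proof (induction xs)
  case (Cons p xs)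
  have "sesq f zs (bind_list ys B) = lin_ext (\<lambda>v. sesq f zs (B v)) ys" for zs
    by (induction ys) (auto simp: sesq_right)
  then show ?case using Cons by simp
qed simp

lemma psd_bind: "psd f \<Longrightarrow> psd (\<lambda>u v. sesq f (A u) (A v))"
  unfolding psd_def by (metis sesq_bind)

lemma psd_cong: "psd f \<Longrightarrow> (\<And>u v. f u v = g u v) \<Longrightarrow> psd g"
  by (subgoal_tac "f = g") (auto simp: fun_eq_iff)

lemma psd_pull: "psd f \<Longrightarrow> psd (\<lambda>u v. f (h u) (h v))"
  using psd_bind[of f "\<lambda>u. [(1, h u)]"] by simp

lemma psd_add: "psd f \<Longrightarrow> psd g \<Longrightarrow> psd (\<lambda>u v. f u v + g u v)"
  unfolding psd_def by (simp add: sesq_add nonneg_Reals_add_I)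

lemma psd_cmult: "psd f \<Longrightarrow> c \<in> \<real>\<^sub>\<ge>\<^sub>0 \<Longrightarrow> psd (\<lambda>u v. c * f u v)"
  unfolding psd_def by (simp add: sesq_cmult nonneg_Reals_mult_I)

lemma psd_scale: "psd f \<Longrightarrow> psd (\<lambda>u v. cnj (r u) * r v * f u v)"
  using psd_bind[of f "\<lambda>u. [(r u, u)]"] by (simp add: mult.assoc)

lemma psd_rank1: "psd (\<lambda>u v. cnj (r u) * r v)"
proof -
  have "psd (\<lambda>(u::unit) v. 1)"
  proof -
    have "sesq (\<lambda>(u::unit) v. 1) xs xs \<in> \<real>\<^sub>\<ge>\<^sub>0" for xs
    proof -
      have "sesq (\<lambda>(u::unit) v. 1) xs ys = cnj (lin_ext (\<lambda>_. 1) xs) * lin_ext (\<lambda>_. 1) ys" for ys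
        by (induction xs) (auto simp: algebra_simps)
      then have "sesq (\<lambda>(u::unit) v. 1) xs xs = of_real ((cmod (lin_ext (\<lambda>_. 1) xs))\<^sup>2)"
        using complex_norm_square[of "lin_ext (\<lambda>_. 1) xs"] by (simp add: mult.commute)
      then show ?thesis by (metis nonneg_Reals_of_real_iff zero_le_power2)
    qed
    then show ?thesis by (simp add: psd_def)
  qed
  from psd_bind[OF this, of "\<lambda>u. [(r u, ())]"] show ?thesis by simp
qed

lemma psd_diag: assumes "psd f" shows "f a a \<in> \<real>\<^sub>\<ge>\<^sub>0"
  using assms[unfolded psd_def, rule_format, of "[(1, a)]"] by simp

lemma psd_herm: assumes "psd f" shows "f b a = cnj (f a b)"
proof -
  have 1: "f a a + f a b + (f b a + f b b) \<in> \<real>\<^sub>\<ge>\<^sub>0"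
    using assms[unfolded psd_def, rule_format, of "[(1, a), (1, b)]"] by (simp add: add_ac)
  have 2: "f a a + \<i> * f a b + (-\<i> * f b a + f b b) \<in> \<real>\<^sub>\<ge>\<^sub>0"
    using assms[unfolded psd_def, rule_format, of "[(1, a), (\<i>, b)]"] by (simp add: algebra_simps)
  show ?thesis using 1 2 psd_diag[OF assms, of a] psd_diag[OF assms, of b]
    by (auto simp: complex_nonneg_Reals_iff complex_eq_iff)
qed

lemma psd_null:
  assumes f: "psd f" and 0: "f a a = 0"
  shows "f a b = 0"
proof (rule ccontr)
  assume nz: "f a b \<noteq> 0"
  define t where "t = (Re (f b b) + 1) / (2 * (cmod (f a b))\<^sup>2)"
  have "sesq f [(- of_real t * f a b, a), (1, b)] [(- of_real t * f a b, a), (1, b)]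
      = f b b - of_real (2 * t) * of_real ((cmod (f a b))\<^sup>2)"
  proof -
    have ba: "f b a = cnj (f a b)" by (rule psd_herm[OF f])
    have nn: "cnj (f a b) * f a b = (of_real (cmod (f a b)))\<^sup>2" by (simp add: cmod_square_eq)
    show ?thesis by (simp add: 0 ba algebra_simps cmod_square_eq)
  qed
  then have "Re (f b b) - 2 * t * (cmod (f a b))\<^sup>2 \<ge> 0"
    using f[unfolded psd_def, rule_format, of "[(- of_real t * f a b, a), (1, b)]"]
    by (simp add: complex_nonneg_Reals_iff del: sesq_simps lin_ext_simps)
  moreover have "2 * t * (cmod (f a b))\<^sup>2 = Re (f b b) + 1" using nz by (simp add: t_def)
  ultimately show False by simp
qed

lemma psd_schur_complement:
  assumes f: "psd f" shows "psd (\<lambda>u v. f u v - f u x * f x v / f x x)"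
  unfolding psd_def
proof
  fix xs
  show "sesq (\<lambda>u v. f u v - f u x * f x v / f x x) xs xs \<in> \<real>\<^sub>\<ge>\<^sub>0"
  proof (cases "f x x = 0")
    case True then show ?thesis using f by (simp add: psd_def)
  next
    case False
    define \<alpha> where "\<alpha> = lin_ext (f x) xs"
    have herm: "f b x = cnj (f x b)" for b by (rule psd_herm[OF f])
    have s: "(\<Sum>(c,b)\<leftarrow>zs. cnj c * f b x) = cnj (lin_ext (f x) zs)" for zs
      by (induction zs) (auto simp: herm)
    have "sesq (\<lambda>u v. f u v - f u x * f x v / f x x) zs ys
        = sesq f zs ys - cnj (lin_ext (f x) zs) * lin_ext (f x) ys / f x x" for zs ys
    proof (induction zs)
      case (Cons p zs)
      have "lin_ext (\<lambda>v. f u v - f u x * f x v / f x x) ys = lin_ext (f u) ys - f u x * lin_ext (f x) ys / f x x" for u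
        using lin_ext_diff[of "f u" "\<lambda>v. f u x / f x x * f x v" ys] lin_ext_cmult[of "f u x / f x x" "f x" ys]
        by simp
      note L = this[of "snd p"]
      show ?case unfolding sesq_simps lin_ext_simps L Cons.IH
        by (simp add: herm[of "snd p"] algebra_simps add_divide_distrib)
    qed simp
    also have "sesq f xs xs - cnj (lin_ext (f x) xs) * lin_ext (f x) xs / f x x
       = sesq f ((- \<alpha> / f x x, x) # xs) ((- \<alpha> / f x x, x) # xs)"
    proof -
      have real: "cnj (f x x) = f x x" using herm[of x] by simp
      show ?thesis using False
        by (simp add: sesq_Cons_right s real flip: \<alpha>_def)
    qed
    finally show ?thesis using f unfolding psd_def by metis
  qed
qed

text \<open>Gram decomposition on finitely many points, by successive Schur complements.\<close>
lemma psd_gram: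
  assumes "finite S" "psd f"
  shows "\<exists>rs. \<forall>u\<in>S. \<forall>v\<in>S. f u v = (\<Sum>r\<leftarrow>rs. cnj (r u) * r v)"
  using assms
proof (induction S arbitrary: f rule: finite_induct)
  case empty then show ?case by auto
next
  case (insert x S)
  define g where "g = (\<lambda>u v. f u v - f u x * f x v / f x x)"
  obtain rs where rs: "\<And>u v. u \<in> S \<Longrightarrow> v \<in> S \<Longrightarrow> g u v = (\<Sum>r\<leftarrow>rs. cnj (r u) * r v)"
    using insert.IH[OF psd_schur_complement[OF insert.prems, of x]] unfolding g_def by blast
  define r0 where "r0 = (\<lambda>v. f x v / of_real (sqrt (Re (f x x))))"
  have xx: "Re (f x x) \<ge> 0" "f x x = of_real (Re (f x x))"
    using psd_diag[OF insert.prems, of x] by (auto simp: complex_nonneg_Reals_iff complex_eq_iff)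
  have r0: "cnj (r0 u) * r0 v = f u x * f x v / f x x" for u v
  proof -
    have "of_real (sqrt (Re (f x x))) * of_real (sqrt (Re (f x x))) = f x x"
      using xx by (metis of_real_mult real_sqrt_mult_self abs_of_nonneg)
    then show ?thesis using psd_herm[OF insert.prems, of u x] by (simp add: r0_def)
  qed
  have gx: "g x v = 0" "g v x = 0" for v
    using psd_null[OF insert.prems, of x v] psd_herm[OF insert.prems, of v x]
    by (cases "f x x = 0"; simp add: g_def)+
  have sum0: "(\<Sum>r\<leftarrow>rs. cnj ((r(x := 0)) u) * (r(x := 0)) v) = g u v" if "u \<in> insert x S" "v \<in> insert x S" for u v
  proof (cases "u = x \<or> v = x")
    case True then show ?thesis using gx by (auto simp: sum_list_0)
  next
    case False
    then have "(\<Sum>r\<leftarrow>rs. cnj ((r(x := 0)) u) * (r(x := 0)) v) = (\<Sum>r\<leftarrow>rs. cnj (r u) * r v)" by simp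
    then show ?thesis using rs[of u v] that False by auto
  qed
  show ?case
    by (rule exI[of _ "r0 # map (\<lambda>r. r(x := 0)) rs"])
      (use sum0 r0 in \<open>auto simp: o_def g_def simp del: fun_upd_apply\<close>)
qed

text \<open>The Schur product theorem: a Gram decomposition of one factor turns the product into a sum of
  rescaled copies of the other.\<close>
lemma psd_mult:
  assumes f: "psd f" and g: "psd g" shows "psd (\<lambda>u v. f u v * g u v)"
  unfolding psd_def
proof
  fix xs :: "(complex \<times> 'a) list"
  obtain rs where rs: "\<And>u v. u \<in> snd ` set xs \<Longrightarrow> v \<in> snd ` set xs \<Longrightarrow> g u v = (\<Sum>r\<leftarrow>rs. cnj (r u) * r v)"
    using psd_gram[OF _ g, of "snd ` set xs"] by blast
  have cong: "sesq h zs ys = sesq h' zs ys"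
    if "\<And>u v. u \<in> snd ` set zs \<Longrightarrow> v \<in> snd ` set ys \<Longrightarrow> h u v = h' u v" for h h' :: "'a \<Rightarrow> 'a \<Rightarrow> complex" and zs ys :: "(complex \<times> 'a) list"
  proof -
    note eq = that
    have "lin_ext (h u) ys = lin_ext (h' u) ys" if "u \<in> snd ` set zs" for u
      using eq[OF that] unfolding lin_ext_def by (intro arg_cong[of _ _ sum_list] map_cong) force+
    then show ?thesis unfolding sesq_def by (intro arg_cong[of _ _ sum_list] map_cong) force+
  qed
  have "sesq (\<lambda>u v. f u v * g u v) xs xs = sesq (\<lambda>u v. f u v * (\<Sum>r\<leftarrow>rs. cnj (r u) * r v)) xs xs"
    using rs by (intro cong) auto
  also have "\<dots> \<in> \<real>\<^sub>\<ge>\<^sub>0"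
  proof (induction rs)
    case (Cons r rs)
    have "sesq (\<lambda>u v. f u v * (\<Sum>r\<leftarrow>r # rs. cnj (r u) * r v)) xs xs =
       sesq (\<lambda>u v. cnj (r u) * r v * f u v) xs xs + sesq (\<lambda>u v. f u v * (\<Sum>r\<leftarrow>rs. cnj (r u) * r v)) xs xs"
      by (simp add: sesq_add [symmetric] algebra_simps)
    then show ?case using Cons psd_scale[OF f, of r] by (simp add: psd_def nonneg_Reals_add_I)
  qed (simp add: sesq_zero)
  finally show "sesq (\<lambda>u v. f u v * g u v) xs xs \<in> \<real>\<^sub>\<ge>\<^sub>0" .
qed

lemma psd_limit:
  assumes "\<And>n. psd (f n)" "\<And>u v. (\<lambda>n. f n u v) \<longlonglongrightarrow> g u v"
  shows "psd g"
proof -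
  have "(\<lambda>n. sesq (f n) xs xs) \<longlonglongrightarrow> sesq g xs xs" for xs
    unfolding sesq_def lin_ext_def sum_list_sum_nth case_prod_beta using assms(2) by (auto intro!: tendsto_intros)
  then have "sesq g xs xs \<in> \<real>\<^sub>\<ge>\<^sub>0" for xs
    by (rule Lim_in_closed_set[OF closed_nonneg_Reals_complex, rotated 2]) (use assms(1) in \<open>auto simp: psd_def\<close>)
  then show ?thesis by (simp add: psd_def)
qed

lemma psd_indicator: "psd (\<lambda>i j. if i = j then 1 else 0)"
  unfolding psd_def
proof
  fix xs :: "(complex \<times> 'a) list"
  have "(if i = j then 1 else 0) = (\<Sum>k\<in>snd ` set xs. (if i = k then 1 else 0) * (if j = k then 1 else (0::complex)))"
    if "i \<in> snd ` set xs" for i j using that by (simp add: if_distrib[of "\<lambda>x. x * _"] sum.delta cong: if_cong)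
  define f where "f = (\<lambda>(K :: 'a set) i j. \<Sum>k\<in>K. cnj (if i = k then 1 else 0) * (if j = k then 1 else (0::complex)))"
  have "psd (f K)" if "finite K" for K
    using that
  proof (induction K rule: finite_induct)
    case (insert x K)
    have "f (insert x K) = (\<lambda>i j. cnj (if i = x then 1 else 0) * (if j = x then 1 else 0) + f K i j)"
      using insert.hyps by (simp add: f_def fun_eq_iff)
    then show ?case using psd_add[OF psd_rank1 insert.IH] by presburger
  qed (simp add: f_def psd_def sesq_zero)
  then have 1: "sesq (f (snd ` set xs)) xs xs \<in> \<real>\<^sub>\<ge>\<^sub>0" by (simp add: psd_def)
  have "sesq (f (snd ` set xs)) ys xs = sesq (\<lambda>i j. if i = j then 1 else 0) ys xs" if "set ys \<subseteq> set xs" for ys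
    using that
  proof (induction ys)
    case (Cons p ys)
    have "snd p \<in> snd ` set xs" using Cons.prems by simp
    then have "f (snd ` set xs) (snd p) = (\<lambda>j. if snd p = j then 1 else 0)"
      by (auto simp: f_def fun_eq_iff if_distrib[of cnj] if_distrib[of "\<lambda>x. x * _"] sum.delta cong: if_cong)
    then show ?case using Cons by simp
  qed simp
  then show "sesq (\<lambda>i j. if i = j then 1 else 0) xs xs \<in> \<real>\<^sub>\<ge>\<^sub>0" using 1 by simp
qed

definition wstar :: "('x \<Rightarrow> 'x) \<Rightarrow> 'x list \<Rightarrow> 'x list" where
  "wstar iv u = rev (map iv u)"

lemma wstar_simps [simp]: "wstar iv [] = []" "wstar iv (x # u) = wstar iv u @ [iv x]"
  "wstar iv (u @ v) = wstar iv v @ wstar iv u"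
  by (auto simp: wstar_def)

lemma wstar_wstar: "(\<And>x. iv (iv x) = x) \<Longrightarrow> wstar iv (wstar iv u) = u"
  by (induction u) auto

text \<open>The moments \<open>m\<close> of a tracial state on the free *-algebra, with \<open>R x\<close> a bound of the letter \<open>x\<close> in
  the operator norm of the associated representation.\<close>
definition moment_fun :: "('x \<Rightarrow> 'x) \<Rightarrow> ('x \<Rightarrow> real) \<Rightarrow> ('x list \<Rightarrow> complex) \<Rightarrow> bool" where
  "moment_fun iv R m \<longleftrightarrow> m [] = 1 \<and> (\<forall>u v. m (u @ v) = m (v @ u)) \<and> psd (\<lambda>u v. m (wstar iv u @ v)) \<and>
     (\<forall>x. 0 \<le> R x \<and> psd (\<lambda>u v. of_real ((R x)\<^sup>2) * m (wstar iv u @ v) - m (wstar iv (x # u) @ (x # v))))"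

section \<open>Polynomials and their evaluation\<close>

definition word_lin :: "('x list \<Rightarrow> complex) \<Rightarrow> 'x ncpoly \<Rightarrow> complex" where
  "word_lin m P = (\<Sum>w\<in>Poly_Mapping.keys P. Poly_Mapping.lookup P w * m w)"

lemma sum_keys_superset:
  assumes "finite S" "Poly_Mapping.keys P \<subseteq> S" "\<And>w. f w 0 = 0"
  shows "(\<Sum>w\<in>Poly_Mapping.keys P. f w (Poly_Mapping.lookup P w)) = (\<Sum>w\<in>S. f w (Poly_Mapping.lookup P w))"
  using assms by (intro sum.mono_neutral_left) (auto simp: in_keys_iff)

lemma sum_keys_add:
  fixes P Q :: "'b \<Rightarrow>\<^sub>0 complex" and f :: "'b \<Rightarrow> complex \<Rightarrow> 'v::comm_monoid_add"
  assumes f0: "\<And>w. f w 0 = 0" and fa: "\<And>w c d. f w (c + d) = f w c + f w d"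
  shows "(\<Sum>w\<in>Poly_Mapping.keys (P + Q). f w (Poly_Mapping.lookup (P + Q) w)) =
     (\<Sum>w\<in>Poly_Mapping.keys P. f w (Poly_Mapping.lookup P w)) + (\<Sum>w\<in>Poly_Mapping.keys Q. f w (Poly_Mapping.lookup Q w))"
proof -
  let ?S = "Poly_Mapping.keys P \<union> Poly_Mapping.keys Q"
  have "(\<Sum>w\<in>Poly_Mapping.keys (P + Q). f w (Poly_Mapping.lookup (P + Q) w)) = (\<Sum>w\<in>?S. f w (Poly_Mapping.lookup (P + Q) w))"
    by (rule sum_keys_superset) (auto simp: f0 dest: set_mp[OF Poly_Mapping.keys_add])
  then show ?thesis using sum_keys_superset[of ?S P f] sum_keys_superset[of ?S Q f]
    by (simp add: f0 fa lookup_add sum.distrib)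
qed

lemma sum_keys_single:
  assumes f0: "\<And>w. f w 0 = 0"
  shows "(\<Sum>w\<in>Poly_Mapping.keys (Poly_Mapping.single u c). f w (Poly_Mapping.lookup (Poly_Mapping.single u c) w)) = f u c"
  by (cases "c = 0") (auto simp: f0)

lemma ncpoly_induct [case_names zero add]:
  assumes "Q 0" "\<And>p w c. Q p \<Longrightarrow> Q (Poly_Mapping.single w c + p)"
  shows "Q (P :: 'b \<Rightarrow>\<^sub>0 complex)"
proof -
  have "Q (\<Sum>w\<in>S. Poly_Mapping.single w (f w))" if "finite S" for S f
    using that by (induction S rule: finite_induct) (auto intro: assms)
  moreover have "(\<Sum>w\<in>Poly_Mapping.keys P. Poly_Mapping.single w (Poly_Mapping.lookup P w)) = P"
    by (rule poly_mapping_eqI)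
      (auto simp: lookup_sum lookup_single when_def in_keys_iff sum.delta' cong: if_cong)
  ultimately show ?thesis by (metis finite_keys)
qed

lemma single_mult: "Poly_Mapping.single u a * Poly_Mapping.single v d = Poly_Mapping.single (u @ v) (a * d :: complex)"
  by (simp add: mult_single plus_list_def)

lemma one_ncpoly: "(1 :: 'x ncpoly) = Poly_Mapping.single [] 1"
  by (simp add: single_one[symmetric] zero_list_def)

lemma word_lin_simps [simp]: "word_lin m 0 = 0" "word_lin m (P + Q) = word_lin m P + word_lin m Q"
  "word_lin m (Poly_Mapping.single w c) = c * m w"
proof -
  show "word_lin m 0 = 0" by (simp add: word_lin_def)
  show "word_lin m (P + Q) = word_lin m P + word_lin m Q" unfolding word_lin_def
    by (rule sum_keys_add) (auto simp: algebra_simps)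
  show "word_lin m (Poly_Mapping.single w c) = c * m w" unfolding word_lin_def
    by (rule sum_keys_single) auto
qed

lemma word_lin_one: "word_lin m 1 = m []" by (simp add: one_ncpoly)

lemma word_lin_scale: "word_lin m (Poly_Mapping.single [] c * P) = c * word_lin m P"
  by (induction P rule: ncpoly_induct) (auto simp: distrib_left single_mult algebra_simps)

definition pstar :: "('x \<Rightarrow> 'x) \<Rightarrow> 'x ncpoly \<Rightarrow> 'x ncpoly" where
  "pstar iv P = (\<Sum>w\<in>Poly_Mapping.keys P. Poly_Mapping.single (wstar iv w) (cnj (Poly_Mapping.lookup P w)))"

lemma star_poly_pstar: "star_poly = pstar flip_var"
  by (simp add: star_poly_def pstar_def wstar_def fun_eq_iff)

lemma pstar_simps [simp]: "pstar iv 0 = 0" "pstar iv (P + Q) = pstar iv P + pstar iv Q"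
  "pstar iv (Poly_Mapping.single w c) = Poly_Mapping.single (wstar iv w) (cnj c)"
proof -
  show "pstar iv 0 = 0" by (simp add: pstar_def)
  show "pstar iv (P + Q) = pstar iv P + pstar iv Q" unfolding pstar_def
    by (rule sum_keys_add) (auto simp: single_add)
  show "pstar iv (Poly_Mapping.single w c) = Poly_Mapping.single (wstar iv w) (cnj c)" unfolding pstar_def
    by (rule sum_keys_single) auto
qed

lemma pstar_mult: "pstar iv (P * Q) = pstar iv Q * pstar iv P"
proof (induction P rule: ncpoly_induct)
  case (add p w c)
  have "pstar iv (Poly_Mapping.single w c * Q) = pstar iv Q * Poly_Mapping.single (wstar iv w) (cnj c)" for w c
    by (induction Q rule: ncpoly_induct) (auto simp: distrib_left distrib_right single_mult mult.commute)
  with add show ?case by (auto simp: distrib_left distrib_right)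
qed simp

locale central_scalars =
  fixes sc :: "complex \<Rightarrow> 'a::ring_1"
  assumes sc_add: "sc (a + d) = sc a + sc d" and sc_mult: "sc (a * d) = sc a * sc d" and sc_one [simp]: "sc 1 = 1"
    and sc_comm: "x * sc a = sc a * x"
begin

lemma sc_0 [simp]: "sc 0 = 0" using sc_add[of 0 0] by simp
lemma sc_minus: "sc (- a) = - sc a" using sc_add[of a "- a"] by (simp add: eq_neg_iff_add_eq_0 add.commute)
lemma sc_sum: "sc (\<Sum>i\<in>I. f i) = (\<Sum>i\<in>I. sc (f i))" by (induction I rule: infinite_finite_induct) (auto simp: sc_add)
lemma sc_left_comm: "x * (sc a * y) = sc a * (x * y)" by (metis mult.assoc sc_comm)
lemma sc_sc: "sc a * (sc d * x) = sc (a * d) * x" by (simp add: sc_mult mult.assoc)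
definition ev :: "('x \<Rightarrow> 'a) \<Rightarrow> 'x ncpoly \<Rightarrow> 'a" where
  "ev X P = (\<Sum>w\<in>Poly_Mapping.keys P. sc (Poly_Mapping.lookup P w) * prod_list (map X w))"

lemma ev_0 [simp]: "ev X 0 = 0" by (simp add: ev_def)
lemma ev_add [simp]: "ev X (P + Q) = ev X P + ev X Q" unfolding ev_def
  by (rule sum_keys_add) (auto simp: sc_add algebra_simps)
lemma ev_single [simp]: "ev X (Poly_Mapping.single w c) = sc c * prod_list (map X w)" unfolding ev_def
  by (rule sum_keys_single) auto
end

interpretation ncp: central_scalars "Poly_Mapping.single ([] :: 'x list)"
proof
  fix P :: "'x ncpoly" and a d :: complex
  show "P * Poly_Mapping.single [] a = Poly_Mapping.single [] a * P"
    by (induction P rule: ncpoly_induct) (auto simp: distrib_left distrib_right single_mult mult.commute)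
qed (auto simp: single_add single_mult one_ncpoly)

section \<open>Tracial pre-C*-algebras\<close>

text \<open>Scalars enter a unital *-algebra through a central embedding \<open>sc\<close>, so that the ring classes apply to it. The
  C*-algebras below are completions of such algebras with respect to the norm of left multiplication on the
  \<open>L\<^sup>2\<close> space of the trace.\<close>

locale pre_trace = central_scalars sc for sc :: "complex \<Rightarrow> 'a::ring_1" +
  fixes st :: "'a \<Rightarrow> 'a" and tr :: "'a \<Rightarrow> complex"
  assumes st_add [simp]: "st (x + y) = st x + st y" and st_mult [simp]: "st (x * y) = st y * st x"
    and st_st [simp]: "st (st x) = x"
    and st_sc [simp]: "st (sc a) = sc (cnj a)"
    and tr_add [simp]: "tr (x + y) = tr x + tr y" and tr_sc [simp]: "tr (sc a * x) = a * tr x" and tr_one [simp]: "tr 1 = 1"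
    and tr_comm: "tr (x * y) = tr (y * x)"
    and tr_pos: "tr (st x * x) \<in> \<real>\<^sub>\<ge>\<^sub>0"
begin

lemma st_0 [simp]: "st 0 = 0" using st_add[of 0 0] by simp
lemma st_minus [simp]: "st (- x) = - st x" using st_add[of x "- x"] by (simp add: eq_neg_iff_add_eq_0 add.commute)
lemma st_diff [simp]: "st (x - y) = st x - st y" using st_add[of x "- y"] by simp
lemma st_1 [simp]: "st 1 = 1" using st_sc[of 1] by simp
lemma tr_0 [simp]: "tr 0 = 0" using tr_add[of 0 0] by simp
lemma tr_minus [simp]: "tr (- x) = - tr x" using tr_add[of x "- x"] by (simp add: eq_neg_iff_add_eq_0 add.commute)
lemma tr_diff [simp]: "tr (x - y) = tr x - tr y" using tr_add[of x "- y"] by simp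
lemma tr_sum: "tr (\<Sum>i\<in>I. f i) = (\<Sum>i\<in>I. tr (f i))" by (induction I rule: infinite_finite_induct) auto
lemma tr_sc_mid: "tr (x * (sc a * y)) = a * tr (x * y)" by (simp add: sc_left_comm)
lemma st_sc_mult [simp]: "st (sc a * x) = sc (cnj a) * st x" by (simp add: sc_comm)

lemma psd_tr: "psd (\<lambda>x y. tr (st (f x) * g (f y)))" if g: "g = id" for f :: "'b \<Rightarrow> 'a" and g
proof -
  have "psd (\<lambda>x y. tr (st x * y))"
    unfolding psd_def
  proof
    fix xs :: "(complex \<times> 'a) list"
    have lin: "lin_ext (\<lambda>y. tr (x * y)) ys = tr (x * (\<Sum>(c, y)\<leftarrow>ys. sc c * y))" for ys x
      by (induction ys) (auto simp: distrib_left sc_left_comm)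
    have "sesq (\<lambda>x y. tr (st x * y)) zs ys = tr (st (\<Sum>(c, y)\<leftarrow>zs. sc c * y) * (\<Sum>(c, y)\<leftarrow>ys. sc c * y))" for zs ys
      by (induction zs) (auto simp: lin distrib_right mult.assoc sc_comm)
    then show "sesq (\<lambda>x y. tr (st x * y)) xs xs \<in> \<real>\<^sub>\<ge>\<^sub>0" using tr_pos by simp
  qed
  from psd_pull[OF this, of f] show ?thesis by (simp add: g)
qed

lemma psd_tr': "psd (\<lambda>x y. tr (st (f x) * f y))" using psd_tr[of id f] by simp

lemma tr_herm: "tr (st x * y) = cnj (tr (st y * x))" using psd_herm[OF psd_tr'[of id], of x y] by simp
lemma tr_st: "tr (st x) = cnj (tr x)" using tr_herm[of x 1] by simp

definition n2 :: "'a \<Rightarrow> real" where "n2 x = sqrt (Re (tr (st x * x)))"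

lemma n2_nonneg [simp]: "0 \<le> n2 x" using tr_pos[of x] by (simp add: n2_def complex_nonneg_Reals_iff)
lemma n2_square: "(n2 x)\<^sup>2 = Re (tr (st x * x))" using tr_pos[of x] by (simp add: n2_def complex_nonneg_Reals_iff)
lemma n2_square': "tr (st x * x) = of_real ((n2 x)\<^sup>2)"
  using tr_pos[of x] by (simp add: n2_square complex_nonneg_Reals_iff complex_eq_iff del: of_real_power)

lemma cauchy_schwarz: "cmod (tr (st x * y)) \<le> n2 x * n2 y"
proof -
  have k: "psd (\<lambda>x y. tr (st x * y))" using psd_tr'[of id] by simp
  show ?thesis
  proof (cases "tr (st x * x) = 0")
    case True
    then show ?thesis using psd_null[OF k, of x y] by simp
  next
    case False
    have "0 \<le> Re (tr (st y * y) - tr (st y * x) * tr (st x * y) / tr (st x * x))"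
      using psd_diag[OF psd_schur_complement[OF k, of x], of y] by (simp add: complex_nonneg_Reals_iff)
    also have "tr (st y * x) * tr (st x * y) = of_real ((cmod (tr (st x * y)))\<^sup>2)"
      by (subst tr_herm[of y x]) (simp add: cmod_square_eq mult.commute)
    also have "Re (tr (st y * y) - of_real ((cmod (tr (st x * y)))\<^sup>2) / tr (st x * x)) = (n2 y)\<^sup>2 - (cmod (tr (st x * y)))\<^sup>2 / (n2 x)\<^sup>2"
      unfolding n2_square' by (metis Re_complex_of_real of_real_diff of_real_divide)
    finally have "(cmod (tr (st x * y)))\<^sup>2 / (n2 x)\<^sup>2 \<le> (n2 y)\<^sup>2" by simp
    moreover have "(n2 x)\<^sup>2 \<noteq> 0" using False unfolding n2_square' by (metis of_real_0)
    then have "0 < (n2 x)\<^sup>2" by simp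
    ultimately have "(cmod (tr (st x * y)))\<^sup>2 \<le> (n2 x * n2 y)\<^sup>2"
      by (simp only: pos_divide_le_eq power_mult_distrib mult.commute)
    then show ?thesis by (rule power2_le_imp_le) simp
  qed
qed

lemma n2_triangle: "n2 (x + y) \<le> n2 x + n2 y"
proof -
  have "(n2 (x + y))\<^sup>2 = (n2 x)\<^sup>2 + (n2 y)\<^sup>2 + Re (tr (st x * y)) + Re (tr (st y * x))"
    by (simp add: n2_square algebra_simps)
  also have "\<dots> \<le> (n2 x)\<^sup>2 + (n2 y)\<^sup>2 + n2 x * n2 y + n2 y * n2 x"
    using cauchy_schwarz[of x y] cauchy_schwarz[of y x] complex_Re_le_cmod[of "tr (st x * y)"] complex_Re_le_cmod[of "tr (st y * x)"]
    by linarith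
  also have "\<dots> = (n2 x + n2 y)\<^sup>2" by (simp add: power2_eq_square algebra_simps)
  finally show ?thesis by (rule power2_le_imp_le) simp
qed

lemma n2_sc: "n2 (sc a * x) = cmod a * n2 x"
proof -
  have "tr (st (sc a * x) * (sc a * x)) = of_real ((cmod a)\<^sup>2) * tr (st x * x)"
    by (simp add: tr_sc_mid mult.assoc cmod_square_eq)
  then have "(n2 (sc a * x))\<^sup>2 = (cmod a * n2 x)\<^sup>2"
    by (simp add: n2_square power_mult_distrib del: st_sc_mult of_real_power)
  then show ?thesis by (simp add: power2_eq_iff_nonneg)
qed

lemma n2_0 [simp]: "n2 0 = 0" by (simp add: n2_def)
lemma n2_1 [simp]: "n2 1 = 1" by (simp add: n2_def)
lemma tr_le_n2: "cmod (tr x) \<le> n2 x" using cauchy_schwarz[of 1 x] by simp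

end

locale trace_algebra = pre_trace +
  assumes bounded: "\<exists>R\<ge>0. \<forall>y. n2 (x * y) \<le> R * n2 y"
begin

definition opn :: "'a \<Rightarrow> real" where "opn x = Inf {R. 0 \<le> R \<and> (\<forall>y. n2 (x * y) \<le> R * n2 y)}"

lemma opn_least: "0 \<le> R \<Longrightarrow> (\<And>y. n2 (x * y) \<le> R * n2 y) \<Longrightarrow> opn x \<le> R"
  unfolding opn_def by (rule cInf_lower) (auto intro!: bdd_belowI[of _ 0])

lemma opn_nonneg [simp]: "0 \<le> opn x"
  unfolding opn_def using bounded[of x] by (intro cInf_greatest) auto

lemma opn_bound: "n2 (x * y) \<le> opn x * n2 y"
proof (cases "n2 y = 0")
  case True then show ?thesis using bounded[of x] by (metis mult_zero_right)
next
  case False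
  then have y: "0 < n2 y" using n2_nonneg[of y] by linarith
  have "n2 (x * y) / n2 y \<le> opn x"
    unfolding opn_def using bounded[of x] y by (intro cInf_greatest) (auto simp: divide_le_eq)
  then show ?thesis using y by (simp add: divide_le_eq)
qed

lemma opn_triangle: "opn (x + y) \<le> opn x + opn y"
proof (rule opn_least)
  fix z have "n2 ((x + y) * z) \<le> n2 (x * z) + n2 (y * z)" using n2_triangle by (simp add: distrib_right)
  also have "\<dots> \<le> (opn x + opn y) * n2 z" using opn_bound[of x z] opn_bound[of y z] by (simp add: distrib_right)
  finally show "n2 ((x + y) * z) \<le> (opn x + opn y) * n2 z" .
qed simp

lemma opn_mult: "opn (x * y) \<le> opn x * opn y"
proof (rule opn_least)
  fix z have "n2 (x * y * z) \<le> opn x * n2 (y * z)" using opn_bound by (simp add: mult.assoc)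
  also have "\<dots> \<le> opn x * (opn y * n2 z)" by (intro mult_left_mono opn_bound) simp
  finally show "n2 (x * y * z) \<le> opn x * opn y * n2 z" by (simp add: mult.assoc)
qed simp

lemma opn_0 [simp]: "opn 0 = 0" using opn_least[of 0 0] opn_nonneg[of 0] by simp
lemma opn_sc_le: "opn (sc a * x) \<le> cmod a * opn x"
proof (rule opn_least)
  fix z show "n2 (sc a * x * z) \<le> cmod a * opn x * n2 z"
    using mult_left_mono[OF opn_bound[of x z], of "cmod a"] by (simp add: mult.assoc n2_sc)
qed simp

lemma opn_sc: "opn (sc a * x) = cmod a * opn x"
proof (cases "a = 0")
  case False
  have "cmod a * opn x = cmod a * opn (sc (inverse a) * (sc a * x))"
    using False by (simp add: sc_sc)
  also have "\<dots> \<le> opn (sc a * x)"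
    using opn_sc_le[of "inverse a" "sc a * x"] False by (simp add: field_simps norm_divide norm_inverse)
  finally show ?thesis using opn_sc_le[of a x] by simp
qed simp

lemma opn_minus [simp]: "opn (- x) = opn x" using opn_sc[of "-1" x] by (simp add: sc_minus)
lemma opn_diff_commute: "opn (x - y) = opn (y - x)" using opn_minus[of "x - y"] by simp
lemma opn_sum: "opn (\<Sum>i\<in>I. f i) \<le> (\<Sum>i\<in>I. opn (f i))"
  by (induction I rule: infinite_finite_induct) (auto intro: order_trans[OF opn_triangle])
lemma n2_le_opn: "n2 x \<le> opn x" using opn_bound[of x 1] by simp
lemma tr_le_opn: "cmod (tr x) \<le> opn x" using tr_le_n2 n2_le_opn order_trans by blast

lemma opn_star_square: "(n2 (st x * y)) \<le> opn x * n2 y"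
proof -
  have "(n2 (st x * y))\<^sup>2 = cmod (tr (st y * (x * (st x * y))))"
  proof -
    have "complex_of_real ((n2 (st x * y))\<^sup>2) = tr (st y * (x * (st x * y)))"
      using n2_square'[of "st x * y"] by (simp add: mult.assoc)
    then show ?thesis by (metis norm_of_real abs_of_nonneg zero_le_power2)
  qed
  also have "\<dots> \<le> n2 y * (opn x * n2 (st x * y))"
    by (rule order_trans[OF cauchy_schwarz]) (intro mult_left_mono opn_bound; simp)
  finally have "n2 (st x * y) * n2 (st x * y) \<le> (opn x * n2 y) * n2 (st x * y)" by (simp add: power2_eq_square mult_ac)
  then show ?thesis
    by (cases "n2 (st x * y) = 0") (auto simp: mult_le_cancel_right dest: not_less[THEN iffD1] simp: less_le)
qed

lemma opn_st [simp]: "opn (st x) = opn x"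
proof -
  have le: "opn (st x) \<le> opn x" for x by (rule opn_least) (auto simp: opn_star_square)
  show ?thesis using le[of x] le[of "st x"] by simp
qed

lemma opn_cstar: "opn (st x * x) = (opn x)\<^sup>2"
proof (rule antisym)
  show "opn (st x * x) \<le> (opn x)\<^sup>2" using opn_mult[of "st x" x] by (simp add: power2_eq_square)
  have "opn x \<le> sqrt (opn (st x * x))"
  proof (rule opn_least)
    fix y
    have "(n2 (x * y))\<^sup>2 = cmod (tr (st y * (st x * x * y)))"
      using n2_square'[of "x * y"] by (simp add: mult.assoc norm_of_real flip: of_real_power)
    also have "\<dots> \<le> n2 y * (opn (st x * x) * n2 y)"
      by (rule order_trans[OF cauchy_schwarz]) (intro mult_left_mono opn_bound; simp)
    also have "\<dots> = (sqrt (opn (st x * x)) * n2 y)\<^sup>2" by (simp add: power_mult_distrib power2_eq_square)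
    finally show "n2 (x * y) \<le> sqrt (opn (st x * x)) * n2 y" by (rule power2_le_imp_le) simp
  qed simp
  then show "(opn x)\<^sup>2 \<le> opn (st x * x)" by (metis opn_nonneg real_sqrt_le_iff real_sqrt_unique real_le_rsqrt abs_of_nonneg power_mono real_sqrt_pow2)
qed

end

text \<open>A moment function is the same as a tracial pre-C*-algebra structure on the free algebra.\<close>
theorem moment_fun_trace_algebra:
  assumes m: "moment_fun iv R m" and iv: "\<And>x. iv (iv x) = x"
  shows "trace_algebra (Poly_Mapping.single []) (pstar iv) (word_lin m)"
    and "trace_algebra.opn (pstar iv) (word_lin m) (Poly_Mapping.single [x] 1) \<le> R x"
proof -
  have m1: "m [] = 1" and mc: "\<And>u v. m (u @ v) = m (v @ u)" and mp: "psd (\<lambda>u v. m (wstar iv u @ v))"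
    and mR: "\<And>x. 0 \<le> R x" and mb: "\<And>x. psd (\<lambda>u v. of_real ((R x)\<^sup>2) * m (wstar iv u @ v) - m (wstar iv (x # u) @ (x # v)))"
    using m unfolding moment_fun_def by blast+
  define psum where "psum = (\<lambda>xs. \<Sum>(c, w)\<leftarrow>xs. Poly_Mapping.single w c :: 'a ncpoly)"
  have psum: "psum [] = 0" "psum (p # xs) = Poly_Mapping.single (snd p) (fst p) + psum xs" for p xs
    by (auto simp: psum_def case_prod_beta)
  have rep: "\<exists>xs. P = psum xs" for P :: "'a ncpoly"
  proof (induction P rule: ncpoly_induct)
    case zero show ?case by (rule exI[of _ "[]"]) (simp add: psum)
  next
    case (add p w c) then obtain xs where "p = psum xs" by auto
    then show ?case by (intro exI[of _ "(c, w) # xs"]) (simp add: psum)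
  qed
  have lin: "word_lin m (Poly_Mapping.single u a * psum ys) = a * lin_ext (\<lambda>v. m (u @ v)) ys" for u a ys
    by (induction ys) (auto simp: psum distrib_left single_mult algebra_simps)
  have ses: "word_lin m (pstar iv (psum xs) * psum ys) = sesq (\<lambda>u v. m (wstar iv u @ v)) xs ys" for xs ys
    by (induction xs) (auto simp: psum distrib_right lin)
  have pre: "pre_trace (Poly_Mapping.single []) (pstar iv) (word_lin m)"
  proof
    fix P Q :: "'a ncpoly" and a d :: complex
    show "pstar iv (pstar iv P) = P"
      by (induction P rule: ncpoly_induct) (auto simp: wstar_wstar iv)
    show "word_lin m (P * Q) = word_lin m (Q * P)"
    proof (induction P rule: ncpoly_induct)
      case (add p w c)
      have "word_lin m (Poly_Mapping.single w c * Q) = word_lin m (Q * Poly_Mapping.single w c)"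
        by (induction Q rule: ncpoly_induct) (auto simp: distrib_left distrib_right single_mult mult.commute mc)
      with add show ?case by (auto simp: distrib_left distrib_right)
    qed simp
    obtain xs where "P = psum xs" using rep by blast
    then show "word_lin m (pstar iv P * P) \<in> \<real>\<^sub>\<ge>\<^sub>0" using mp by (simp add: ses psd_def)
  qed (auto simp: single_add single_mult word_lin_scale pstar_mult word_lin_one m1)
  interpret pre_trace "Poly_Mapping.single []" "pstar iv" "word_lin m" by (rule pre)
  have letter: "n2 (Poly_Mapping.single [x] 1 * P) \<le> R x * n2 P" for x P
  proof -
    obtain xs where P: "P = psum xs" using rep by blast
    have xP: "Poly_Mapping.single [x] 1 * psum xs = psum (map (\<lambda>(c, w). (c, x # w)) xs)" for xs
      by (induction xs) (auto simp: psum distrib_left single_mult)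
    have b1: "lin_ext \<phi> (map (\<lambda>(c, w). (c, x # w)) ys) = lin_ext (\<lambda>w. \<phi> (x # w)) ys" for \<phi> :: "'a list \<Rightarrow> complex" and ys
      by (induction ys) auto
    have "sesq (\<lambda>u v. m (wstar iv u @ v)) (map (\<lambda>(c, w). (c, x # w)) xs) (map (\<lambda>(c, w). (c, x # w)) ys)
        = sesq (\<lambda>u v. m (wstar iv (x # u) @ (x # v))) xs ys" for xs ys
      by (induction xs) (auto simp: b1)
    then have "of_real ((R x)\<^sup>2) * word_lin m (pstar iv P * P)
         - word_lin m (pstar iv (Poly_Mapping.single [x] 1 * P) * (Poly_Mapping.single [x] 1 * P)) \<in> \<real>\<^sub>\<ge>\<^sub>0"
      using mb[of x, unfolded psd_def sesq_diff sesq_cmult] unfolding P xP ses by simp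
    then have "(n2 (Poly_Mapping.single [x] 1 * P))\<^sup>2 \<le> (R x * n2 P)\<^sup>2"
      by (simp add: complex_nonneg_Reals_iff n2_square power_mult_distrib del: of_real_power)
    then show ?thesis by (rule power2_le_imp_le) (simp add: mR)
  qed
  have word: "\<exists>B\<ge>0. \<forall>P. n2 (Poly_Mapping.single w 1 * P) \<le> B * n2 P" for w
  proof (induction w)
    case Nil show ?case by (intro exI[of _ 1]) (simp flip: one_ncpoly)
  next
    case (Cons x w)
    then obtain B where B: "B \<ge> 0" "\<And>P. n2 (Poly_Mapping.single w 1 * P) \<le> B * n2 P" by auto
    have "n2 (Poly_Mapping.single (x # w) 1 * P) \<le> (R x * B) * n2 P" for P
    proof -
      have "Poly_Mapping.single (x # w) 1 * P = Poly_Mapping.single [x] 1 * (Poly_Mapping.single w 1 * P)"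
        by (simp add: single_mult flip: mult.assoc)
      then show ?thesis using letter[of x "Poly_Mapping.single w 1 * P"] mult_left_mono[OF B(2)[of P] mR[of x]] by simp
    qed
    then show ?case using B mR by (intro exI[of _ "R x * B"]) auto
  qed
  show ta: "trace_algebra (Poly_Mapping.single []) (pstar iv) (word_lin m)"
  proof
    fix P
    show "\<exists>B\<ge>0. \<forall>Q. n2 (P * Q) \<le> B * n2 Q"
    proof (induction P rule: ncpoly_induct)
      case zero show ?case by (intro exI[of _ 0]) simp
    next
      case (add p w c)
      then obtain B where B: "B \<ge> 0" "\<And>Q. n2 (p * Q) \<le> B * n2 Q" by auto
      obtain C where C: "C \<ge> 0" "\<And>Q. n2 (Poly_Mapping.single w 1 * Q) \<le> C * n2 Q" using word by blast
      have "n2 ((Poly_Mapping.single w c + p) * Q) \<le> (cmod c * C + B) * n2 Q" for Q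
      proof -
        have "(Poly_Mapping.single w c + p) * Q = Poly_Mapping.single [] c * (Poly_Mapping.single w 1 * Q) + p * Q"
          by (simp add: distrib_right single_mult flip: mult.assoc)
        then have "n2 ((Poly_Mapping.single w c + p) * Q) \<le> cmod c * n2 (Poly_Mapping.single w 1 * Q) + n2 (p * Q)"
          using n2_triangle n2_sc by metis
        then show ?thesis using mult_left_mono[OF C(2)[of Q], of "cmod c"] B(2)[of Q] by (simp add: algebra_simps)
      qed
      then show ?case using B C by (intro exI[of _ "cmod c * C + B"]) auto
    qed
  qed
  show "trace_algebra.opn (pstar iv) (word_lin m) (Poly_Mapping.single [x] 1) \<le> R x"
    by (rule trace_algebra.opn_least[OF ta mR letter])
qed

lemma poly_mapping_sum_single: "P = (\<Sum>w\<in>Poly_Mapping.keys P. Poly_Mapping.single w (Poly_Mapping.lookup P w))"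
  for P :: "'b \<Rightarrow>\<^sub>0 complex"
  by (rule poly_mapping_eqI) (auto simp: lookup_sum lookup_single when_def in_keys_iff sum.delta' cong: if_cong)

section \<open>Completion to a C*-algebra\<close>

lemma squeeze_zero: "G \<longlonglongrightarrow> 0 \<Longrightarrow> (\<And>n. 0 \<le> F n) \<Longrightarrow> (\<And>n. F n \<le> G n) \<Longrightarrow> F \<longlonglongrightarrow> (0::real)"
  by (rule tendsto_sandwich[of "\<lambda>_. 0" _ _ G]) auto

context trace_algebra
begin

definition is_completion :: "'u cstar \<Rightarrow> ('u \<Rightarrow> complex) \<Rightarrow> ('a \<Rightarrow> 'u) \<Rightarrow> bool" where
  "is_completion A \<phi> \<iota> \<longleftrightarrow> tracial_cstar_space A \<phi> \<and> (\<forall>x. \<iota> x \<in> carrier A) \<and>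
     (\<forall>x y. \<iota> (x + y) = \<iota> x \<oplus>\<^bsub>A\<^esub> \<iota> y) \<and> (\<forall>x y. \<iota> (x * y) = \<iota> x \<otimes>\<^bsub>A\<^esub> \<iota> y) \<and> \<iota> 1 = \<one>\<^bsub>A\<^esub> \<and>
     (\<forall>c x. \<iota> (sc c * x) = smul A c (\<iota> x)) \<and> (\<forall>x. \<iota> (st x) = adj A (\<iota> x)) \<and> (\<forall>x. nrm A (\<iota> x) = opn x) \<and>
     (\<forall>x. \<phi> (\<iota> x) = tr x)"

definition Cs :: "(nat \<Rightarrow> 'a) set" where
  "Cs = {f. \<forall>\<epsilon>>0. \<exists>N. \<forall>j\<ge>N. \<forall>k\<ge>N. opn (f j - f k) < \<epsilon>}"
definition eqv :: "(nat \<Rightarrow> 'a) \<Rightarrow> (nat \<Rightarrow> 'a) \<Rightarrow> bool" where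
  "eqv f g \<longleftrightarrow> (\<lambda>n. opn (f n - g n)) \<longlonglongrightarrow> 0"
text \<open>A canonical representative of each class, so that the elements of the completion are sequences rather than
  sets of sequences and fit into the universe.\<close>
definition rep :: "(nat \<Rightarrow> 'a) \<Rightarrow> nat \<Rightarrow> 'a" where
  "rep f = (SOME g. g \<in> Cs \<and> eqv f g)"

lemma opn_triangle_diff: "opn (x - z) \<le> opn (x - y) + opn (y - z)"
  using opn_triangle[of "x - y" "y - z"] by simp

lemma opn_diff_abs: "\<bar>opn x - opn y\<bar> \<le> opn (x - y)"
  using opn_triangle[of "x - y" y] opn_triangle[of "y - x" x] opn_diff_commute[of x y] by simp

lemma eqv_refl: "eqv f f" by (simp add: eqv_def)
lemma eqv_sym: "eqv f g \<Longrightarrow> eqv g f" by (simp add: eqv_def opn_diff_commute)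
lemma eqv_trans: assumes "eqv f g" "eqv g h" shows "eqv f h"
proof -
  have "(\<lambda>n. opn (f n - g n) + opn (g n - h n)) \<longlonglongrightarrow> 0" using tendsto_add[OF assms[unfolded eqv_def]] by simp
  then show ?thesis unfolding eqv_def by (rule squeeze_zero) (rule opn_nonneg, rule opn_triangle_diff)
qed

lemma CsD: "f \<in> Cs \<Longrightarrow> 0 < \<epsilon> \<Longrightarrow> \<exists>N. \<forall>j\<ge>N. \<forall>k\<ge>N. opn (f j - f k) < \<epsilon>" by (simp add: Cs_def)

lemma Cs_conv: assumes f: "f \<in> Cs" and g: "\<And>x y. cmod (g x - g y) \<le> C * opn (x - y)"
  shows "convergent (\<lambda>n. g (f n))"
proof -
  have "Cauchy (\<lambda>n. g (f n))"
    unfolding Cauchy_iff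
  proof (intro allI impI)
    fix e :: real assume "0 < e"
    then have "0 < e / (\<bar>C\<bar> + 1)" by (intro divide_pos_pos) auto
    then obtain N where N0: "\<forall>j\<ge>N. \<forall>k\<ge>N. opn (f j - f k) < e / (\<bar>C\<bar> + 1)" using CsD[OF f] by blast
    then have N: "\<And>j k. j \<ge> N \<Longrightarrow> k \<ge> N \<Longrightarrow> opn (f j - f k) < e / (\<bar>C\<bar> + 1)" by blast
    have "cmod (g (f j) - g (f k)) < e" if "j \<ge> N" "k \<ge> N" for j k
    proof -
      have "cmod (g (f j) - g (f k)) \<le> (\<bar>C\<bar> + 1) * opn (f j - f k)"
        by (rule order_trans[OF g mult_right_mono]) auto
      then show ?thesis using N[OF that] by (simp add: field_simps)
    qed
    then show "\<exists>M. \<forall>m\<ge>M. \<forall>n\<ge>M. norm (g (f m) - g (f n)) < e" by blast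
  qed
  then show ?thesis by (rule Cauchy_convergent)
qed

lemma Cs_opn_conv: assumes f: "f \<in> Cs" shows "convergent (\<lambda>n. opn (f n))"
proof -
  have "convergent (\<lambda>n. complex_of_real (opn (f n)))"
    by (rule Cs_conv[OF f, where C = 1]) (simp add: opn_diff_abs flip: of_real_diff)
  then obtain l where "(\<lambda>n. complex_of_real (opn (f n))) \<longlonglongrightarrow> l" by (auto simp: convergent_def)
  from tendsto_Re[OF this] show ?thesis by (auto simp: convergent_def)
qed

lemma Cs_bounded: assumes f: "f \<in> Cs" obtains B where "0 \<le> B" "\<And>n. opn (f n) \<le> B"
proof -
  obtain B where "\<And>n. \<bar>opn (f n)\<bar> \<le> B"
    using convergent_imp_Bseq[OF Cs_opn_conv[OF f]] by (auto simp: Bseq_def)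
  then have "opn (f n) \<le> \<bar>B\<bar>" for n by (metis abs_ge_self order_trans)
  then show ?thesis using that[of "\<bar>B\<bar>"] by simp
qed

lemma Cs_const: "(\<lambda>_. x) \<in> Cs" by (simp add: Cs_def)

lemma Cs_lip1:
  assumes f: "f \<in> Cs" and h: "\<And>x y. opn (h x - h y) \<le> C * opn (x - y)" shows "(\<lambda>n. h (f n)) \<in> Cs"
  unfolding Cs_def
proof (intro CollectI allI impI)
  fix e :: real assume "0 < e"
  then have "0 < e / (\<bar>C\<bar> + 1)" by (intro divide_pos_pos) auto
  then obtain N where N0: "\<forall>j\<ge>N. \<forall>k\<ge>N. opn (f j - f k) < e / (\<bar>C\<bar> + 1)" using CsD[OF f] by blast
  then have N: "\<And>j k. j \<ge> N \<Longrightarrow> k \<ge> N \<Longrightarrow> opn (f j - f k) < e / (\<bar>C\<bar> + 1)" by blast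
  have "opn (h (f j) - h (f k)) < e" if "j \<ge> N" "k \<ge> N" for j k
  proof -
    have "opn (h (f j) - h (f k)) \<le> (\<bar>C\<bar> + 1) * opn (f j - f k)"
      by (rule order_trans[OF h mult_right_mono]) auto
    then show ?thesis using N[OF that] by (simp add: field_simps)
  qed
  then show "\<exists>M. \<forall>m\<ge>M. \<forall>n\<ge>M. opn (h (f m) - h (f n)) < e" by blast
qed

lemma Cs_st: "f \<in> Cs \<Longrightarrow> (\<lambda>n. st (f n)) \<in> Cs"
  by (rule Cs_lip1[where C = 1]) (auto simp flip: st_diff)
lemma Cs_sc: "f \<in> Cs \<Longrightarrow> (\<lambda>n. sc c * f n) \<in> Cs"
  by (rule Cs_lip1[where C = "cmod c"]) (auto simp: opn_sc simp flip: right_diff_distrib)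
lemma Cs_uminus: "f \<in> Cs \<Longrightarrow> (\<lambda>n. - f n) \<in> Cs"
  using Cs_sc[of f "-1"] by (simp add: sc_minus)

lemma Cs_add: assumes f: "f \<in> Cs" and g: "g \<in> Cs" shows "(\<lambda>n. f n + g n) \<in> Cs"
  unfolding Cs_def
proof (intro CollectI allI impI)
  fix e :: real assume "0 < e"
  then have e: "0 < e / 2" by simp
  obtain N where N1: "\<forall>j\<ge>N. \<forall>k\<ge>N. opn (f j - f k) < e / 2" using CsD[OF f e] by blast
  obtain N' where N2: "\<forall>j\<ge>N'. \<forall>k\<ge>N'. opn (g j - g k) < e / 2" using CsD[OF g e] by blast
  have N: "\<And>j k. j \<ge> N \<Longrightarrow> k \<ge> N \<Longrightarrow> opn (f j - f k) < e / 2" "\<And>j k. j \<ge> N' \<Longrightarrow> k \<ge> N' \<Longrightarrow> opn (g j - g k) < e / 2"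
    using N1 N2 by blast+
  have "opn (f j + g j - (f k + g k)) < e" if "j \<ge> max N N'" "k \<ge> max N N'" for j k
    using N(1)[of j k] N(2)[of j k] that opn_triangle[of "f j - f k" "g j - g k"] by (simp add: algebra_simps)
  then show "\<exists>M. \<forall>m\<ge>M. \<forall>n\<ge>M. opn (f m + g m - (f n + g n)) < e" by blast
qed

lemma opn_mult_diff: "opn (x * y - x' * y') \<le> opn (x - x') * opn y + opn x' * opn (y - y')"
proof -
  have "x * y - x' * y' = (x - x') * y + x' * (y - y')" by (simp add: algebra_simps)
  then show ?thesis using opn_triangle[of "(x - x') * y" "x' * (y - y')"] opn_mult[of "x - x'" y] opn_mult[of x' "y - y'"] by simp
qed

lemma Cs_mult: assumes f: "f \<in> Cs" and g: "g \<in> Cs" shows "(\<lambda>n. f n * g n) \<in> Cs"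
  unfolding Cs_def
proof (intro CollectI allI impI)
  fix e :: real assume e: "0 < e"
  obtain B B' where B: "0 \<le> B" "\<And>n. opn (f n) \<le> B" "0 \<le> B'" "\<And>n. opn (g n) \<le> B'"
    using Cs_bounded[OF f] Cs_bounded[OF g] by metis
  define d where "d = e / (B + B' + 1)"
  have d: "0 < d" using e B by (simp add: d_def)
  obtain N where N1: "\<forall>j\<ge>N. \<forall>k\<ge>N. opn (f j - f k) < d" using CsD[OF f d] by blast
  obtain N' where N2: "\<forall>j\<ge>N'. \<forall>k\<ge>N'. opn (g j - g k) < d" using CsD[OF g d] by blast
  have N: "\<And>j k. j \<ge> N \<Longrightarrow> k \<ge> N \<Longrightarrow> opn (f j - f k) < d" "\<And>j k. j \<ge> N' \<Longrightarrow> k \<ge> N' \<Longrightarrow> opn (g j - g k) < d"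
    using N1 N2 by blast+
  have "opn (f j * g j - f k * g k) < e" if "j \<ge> max N N'" "k \<ge> max N N'" for j k
  proof -
    have "opn (f j * g j - f k * g k) \<le> d * B' + B * d"
      using N(1)[of j k] N(2)[of j k] that B d by (intro order_trans[OF opn_mult_diff] add_mono mult_mono) auto
    also have "\<dots> < d * (B + B' + 1)" using d by (simp add: algebra_simps)
    finally show ?thesis using B by (simp add: d_def)
  qed
  then show "\<exists>M. \<forall>m\<ge>M. \<forall>n\<ge>M. opn (f m * g m - f n * g n) < e" by blast
qed

lemma eqv_lip1: assumes "eqv f g" "\<And>x y. opn (h x - h y) \<le> C * opn (x - y)" shows "eqv (\<lambda>n. h (f n)) (\<lambda>n. h (g n))"
  unfolding eqv_def
  by (rule squeeze_zero[OF tendsto_mult_right_zero[OF assms(1)[unfolded eqv_def], of C]]) (rule opn_nonneg, rule assms(2))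

lemma eqv_add: assumes "eqv f f'" "eqv g g'" shows "eqv (\<lambda>n. f n + g n) (\<lambda>n. f' n + g' n)"
proof -
  have "(\<lambda>n. opn (f n - f' n) + opn (g n - g' n)) \<longlonglongrightarrow> 0" using tendsto_add[OF assms[unfolded eqv_def]] by simp
  moreover have "opn (f n + g n - (f' n + g' n)) \<le> opn (f n - f' n) + opn (g n - g' n)" for n
    using opn_triangle[of "f n - f' n" "g n - g' n"] by (simp add: algebra_simps)
  ultimately show ?thesis unfolding eqv_def by (rule squeeze_zero[OF _ opn_nonneg])
qed

lemma eqv_mult: assumes "eqv f f'" "eqv g g'" "f' \<in> Cs" "g \<in> Cs" shows "eqv (\<lambda>n. f n * g n) (\<lambda>n. f' n * g' n)"
proof -
  obtain B B' where B: "0 \<le> B" "\<And>n. opn (f' n) \<le> B" "0 \<le> B'" "\<And>n. opn (g n) \<le> B'"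
    using Cs_bounded[OF assms(3)] Cs_bounded[OF assms(4)] by metis
  have "(\<lambda>n. opn (f n - f' n) * B' + B * opn (g n - g' n)) \<longlonglongrightarrow> 0 * B' + B * 0"
    using assms(1,2) unfolding eqv_def by (intro tendsto_intros)
  then have "(\<lambda>n. opn (f n - f' n) * B' + B * opn (g n - g' n)) \<longlonglongrightarrow> 0" by simp
  moreover have "opn (f n * g n - f' n * g' n) \<le> opn (f n - f' n) * B' + B * opn (g n - g' n)" for n
    using B by (intro order_trans[OF opn_mult_diff] add_mono mult_mono) auto
  ultimately show ?thesis unfolding eqv_def by (rule squeeze_zero[OF _ opn_nonneg])
qed

lemma rep: assumes "f \<in> Cs" shows "rep f \<in> Cs" "eqv f (rep f)"
  unfolding rep_def using someI[of "\<lambda>g. g \<in> Cs \<and> eqv f g" f] assms eqv_refl by auto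

lemma rep_cong: assumes "eqv f g" shows "rep f = rep g"
proof -
  have "eqv f h \<longleftrightarrow> eqv g h" for h using assms eqv_sym eqv_trans by blast
  then show ?thesis by (simp add: rep_def)
qed

text \<open>The Cauchy sequences modulo null sequences. The C*-identity and the trace pass to limits.\<close>
theorem completion_exists:
  fixes e :: "(nat \<Rightarrow> 'a) \<Rightarrow> 'u"
  assumes e: "inj e"
  shows "\<exists>(A :: 'u cstar) \<phi> \<iota>. is_completion A \<phi> \<iota>"
proof -
  define emb where "emb = (\<lambda>f. e (rep f))"
  define dec where "dec = (\<lambda>u. inv_into UNIV e u)"
  define A where "A = \<lparr>carrier = emb ` Cs, monoid.mult = (\<lambda>u v. emb (\<lambda>n. dec u n * dec v n)), one = emb (\<lambda>_. 1),
     zero = emb (\<lambda>_. 0), add = (\<lambda>u v. emb (\<lambda>n. dec u n + dec v n)), smul = (\<lambda>c u. emb (\<lambda>n. sc c * dec u n)),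
     adj = (\<lambda>u. emb (\<lambda>n. st (dec u n))), nrm = (\<lambda>u. lim (\<lambda>n. opn (dec u n)))\<rparr>"
  define \<phi> where "\<phi> = (\<lambda>u. lim (\<lambda>n. tr (dec u n)))"
  define \<iota> where "\<iota> = (\<lambda>x. emb (\<lambda>_. x))"
  have dec: "dec (emb f) = rep f" for f using e by (simp add: dec_def emb_def)
  have emb_eq: "emb f = emb g \<longleftrightarrow> eqv f g" if "f \<in> Cs" "g \<in> Cs" for f g
  proof
    assume "emb f = emb g"
    then have "rep f = rep g" using e by (simp add: emb_def inj_def)
    then show "eqv f g" using rep(2)[OF that(1)] rep(2)[OF that(2)] eqv_sym eqv_trans by metis
  qed (simp add: emb_def rep_cong)
  have emb_cong: "eqv f g \<Longrightarrow> emb f = emb g" for f g by (simp add: emb_def rep_cong)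
  have carr: "emb f \<in> carrier A" if "f \<in> Cs" for f using that by (simp add: A_def)
  have carrE: "\<exists>f\<in>Cs. u = emb f" if "u \<in> carrier A" for u using that by (auto simp: A_def)
  have mult: "emb f \<otimes>\<^bsub>A\<^esub> emb g = emb (\<lambda>n. f n * g n)" if "f \<in> Cs" "g \<in> Cs" for f g
    using that rep by (auto simp: A_def dec intro!: emb_cong eqv_mult[THEN eqv_sym])
  have add: "emb f \<oplus>\<^bsub>A\<^esub> emb g = emb (\<lambda>n. f n + g n)" if "f \<in> Cs" "g \<in> Cs" for f g
    using that rep by (auto simp: A_def dec intro!: emb_cong eqv_add[THEN eqv_sym])
  have smul: "smul A c (emb f) = emb (\<lambda>n. sc c * f n)" if "f \<in> Cs" for f c
    using eqv_lip1[OF eqv_sym[OF rep(2)[OF that]], of "\<lambda>x. sc c * x" "cmod c"]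
    by (auto simp: A_def dec opn_sc simp flip: right_diff_distrib intro!: emb_cong)
  have adj: "adj A (emb f) = emb (\<lambda>n. st (f n))" if "f \<in> Cs" for f
    using eqv_lip1[OF eqv_sym[OF rep(2)[OF that]], of st 1]
    by (auto simp: A_def dec simp flip: st_diff intro!: emb_cong)
  have one: "\<one>\<^bsub>A\<^esub> = emb (\<lambda>_. 1)" and zero: "\<zero>\<^bsub>A\<^esub> = emb (\<lambda>_. 0)" by (auto simp: A_def)
  have nrm: "(\<lambda>n. opn (f n)) \<longlonglongrightarrow> nrm A (emb f)" if "f \<in> Cs" for f
  proof -
    have "(\<lambda>n. opn (rep f n)) \<longlonglongrightarrow> nrm A (emb f)"
      using Cs_opn_conv[OF rep(1)[OF that]] by (simp add: A_def dec convergent_LIMSEQ_iff)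
    moreover have "(\<lambda>n. opn (f n) - opn (rep f n)) \<longlonglongrightarrow> 0"
      by (rule tendsto_0_le[of "\<lambda>n. opn (f n - rep f n)" _ _ 1]) (use rep(2)[OF that] opn_diff_abs in \<open>auto simp: eqv_def\<close>)
    ultimately have "(\<lambda>n. opn (f n) - opn (rep f n) + opn (rep f n)) \<longlonglongrightarrow> 0 + nrm A (emb f)" by (intro tendsto_add)
    then show ?thesis by simp
  qed
  have phi: "(\<lambda>n. tr (f n)) \<longlonglongrightarrow> \<phi> (emb f)" if "f \<in> Cs" for f
  proof -
    have lip: "cmod (tr x - tr y) \<le> 1 * opn (x - y)" for x y using tr_le_opn[of "x - y"] by simp
    have "(\<lambda>n. tr (rep f n)) \<longlonglongrightarrow> \<phi> (emb f)"
      using Cs_conv[OF rep(1)[OF that] lip] by (simp add: \<phi>_def dec convergent_LIMSEQ_iff)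
    moreover have "(\<lambda>n. tr (f n) - tr (rep f n)) \<longlonglongrightarrow> 0"
      by (rule tendsto_0_le[of "\<lambda>n. opn (f n - rep f n)" _ _ 1]) (use rep(2)[OF that] lip in \<open>auto simp: eqv_def\<close>)
    ultimately have "(\<lambda>n. tr (f n) - tr (rep f n) + tr (rep f n)) \<longlonglongrightarrow> 0 + \<phi> (emb f)" by (intro tendsto_add)
    then show ?thesis by simp
  qed
  note ops = mult add smul adj
  note closed = Cs_const Cs_add Cs_mult Cs_sc Cs_st Cs_uminus
  have abl: "abelian_group A"
  proof (rule abelian_groupI)
    fix u v w assume "u \<in> carrier A" "v \<in> carrier A" "w \<in> carrier A"
    then obtain f g h where fgh: "f \<in> Cs" "u = emb f" "g \<in> Cs" "v = emb g" "h \<in> Cs" "w = emb h" by (metis carrE)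
    show "u \<oplus>\<^bsub>A\<^esub> v \<oplus>\<^bsub>A\<^esub> w = u \<oplus>\<^bsub>A\<^esub> (v \<oplus>\<^bsub>A\<^esub> w)" using fgh by (simp add: add closed add.assoc)
  next
    fix u v assume "u \<in> carrier A" "v \<in> carrier A"
    then obtain f g where fgh: "f \<in> Cs" "u = emb f" "g \<in> Cs" "v = emb g" by (metis carrE)
    show "u \<oplus>\<^bsub>A\<^esub> v = v \<oplus>\<^bsub>A\<^esub> u" using fgh by (simp add: add closed add.commute)
    show "u \<oplus>\<^bsub>A\<^esub> v \<in> carrier A" using fgh by (simp add: add closed carr)
  next
    fix u assume "u \<in> carrier A"
    then obtain f where fgh: "f \<in> Cs" "u = emb f" by (metis carrE)
    show "\<zero>\<^bsub>A\<^esub> \<oplus>\<^bsub>A\<^esub> u = u" using fgh by (simp add: add zero closed)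
    show "\<exists>y\<in>carrier A. y \<oplus>\<^bsub>A\<^esub> u = \<zero>\<^bsub>A\<^esub>"
      using fgh by (intro bexI[of _ "emb (\<lambda>n. - f n)"]) (simp_all add: add zero closed carr)
  qed (simp add: zero closed carr)
  have mon: "monoid A"
  proof (rule monoidI)
    fix u v w assume "u \<in> carrier A" "v \<in> carrier A" "w \<in> carrier A"
    then obtain f g h where fgh: "f \<in> Cs" "u = emb f" "g \<in> Cs" "v = emb g" "h \<in> Cs" "w = emb h" by (metis carrE)
    show "u \<otimes>\<^bsub>A\<^esub> v \<otimes>\<^bsub>A\<^esub> w = u \<otimes>\<^bsub>A\<^esub> (v \<otimes>\<^bsub>A\<^esub> w)" using fgh by (simp add: mult closed mult.assoc)
  next
    fix u v assume "u \<in> carrier A" "v \<in> carrier A"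
    then obtain f g where fgh: "f \<in> Cs" "u = emb f" "g \<in> Cs" "v = emb g" by (metis carrE)
    show "u \<otimes>\<^bsub>A\<^esub> v \<in> carrier A" using fgh by (simp add: mult closed carr)
  next
    fix u assume "u \<in> carrier A"
    then obtain f where fgh: "f \<in> Cs" "u = emb f" by (metis carrE)
    show "\<one>\<^bsub>A\<^esub> \<otimes>\<^bsub>A\<^esub> u = u" "u \<otimes>\<^bsub>A\<^esub> \<one>\<^bsub>A\<^esub> = u" using fgh by (simp_all add: mult one closed)
  qed (simp add: one closed carr)
  interpret ring A
  proof (rule ringI[OF abl mon])
    fix u v w assume "u \<in> carrier A" "v \<in> carrier A" "w \<in> carrier A"
    then obtain f g h where fgh: "f \<in> Cs" "u = emb f" "g \<in> Cs" "v = emb g" "h \<in> Cs" "w = emb h" by (metis carrE)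
    show "(u \<oplus>\<^bsub>A\<^esub> v) \<otimes>\<^bsub>A\<^esub> w = u \<otimes>\<^bsub>A\<^esub> w \<oplus>\<^bsub>A\<^esub> v \<otimes>\<^bsub>A\<^esub> w" using fgh by (simp add: add mult closed distrib_right)
    show "w \<otimes>\<^bsub>A\<^esub> (u \<oplus>\<^bsub>A\<^esub> v) = w \<otimes>\<^bsub>A\<^esub> u \<oplus>\<^bsub>A\<^esub> w \<otimes>\<^bsub>A\<^esub> v" using fgh by (simp add: add mult closed distrib_left)
  qed
  have minus: "emb f \<ominus>\<^bsub>A\<^esub> emb g = emb (\<lambda>n. f n - g n)" if "f \<in> Cs" "g \<in> Cs" for f g
  proof -
    have "\<ominus>\<^bsub>A\<^esub> emb g = emb (\<lambda>n. - g n)"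
      by (rule minus_equality) (use that in \<open>simp_all add: add zero closed carr\<close>)
    then show ?thesis using that by (simp add: a_minus_def add closed)
  qed
  have lims: "l = k" if "(F :: nat \<Rightarrow> real) \<longlonglongrightarrow> l" "F \<longlonglongrightarrow> k" for F l k using that LIMSEQ_unique by blast
  have limc: "l = k" if "(F :: nat \<Rightarrow> complex) \<longlonglongrightarrow> l" "F \<longlonglongrightarrow> k" for F l k using that LIMSEQ_unique by blast
  have dense: "\<exists>x. nrm A (a \<ominus>\<^bsub>A\<^esub> \<iota> x) < \<epsilon>" if a: "a \<in> carrier A" and eps: "0 < \<epsilon>" for a \<epsilon>
  proof -
    obtain f where f: "f \<in> Cs" "a = emb f" using carrE[OF a] by metis
    obtain N where N: "\<forall>j\<ge>N. \<forall>k\<ge>N. opn (f j - f k) < \<epsilon> / 2"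
      using CsD[OF f(1) half_gt_zero[OF eps]] by blast
    have "(\<lambda>n. opn (f n - f N)) \<longlonglongrightarrow> nrm A (a \<ominus>\<^bsub>A\<^esub> \<iota> (f N))"
      using nrm[OF Cs_add[OF f(1) Cs_const[of "- f N"]]] f(1) by (simp add: \<iota>_def f(2) minus closed)
    then have "nrm A (a \<ominus>\<^bsub>A\<^esub> \<iota> (f N)) \<le> \<epsilon> / 2"
      by (rule LIMSEQ_le_const2) (use N in \<open>auto intro!: exI[of _ N] less_imp_le\<close>)
    then show ?thesis using eps by (intro exI[of _ "f N"]) linarith
  qed
  have nrm_iota: "nrm A (\<iota> x) = opn x" for x using lims[OF nrm[OF Cs_const[of x]]] by (simp add: \<iota>_def)
  have A: "cstar_algebra A"
  proof
    fix u v :: 'u and c d :: complex assume "u \<in> carrier A" and "v \<in> carrier A"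
    then obtain f g where fg: "f \<in> Cs" "u = emb f" "g \<in> Cs" "v = emb g" by (metis carrE)
    show "smul A c (u \<oplus>\<^bsub>A\<^esub> v) = smul A c u \<oplus>\<^bsub>A\<^esub> smul A c v" "smul A c u \<otimes>\<^bsub>A\<^esub> v = smul A c (u \<otimes>\<^bsub>A\<^esub> v)"
      "u \<otimes>\<^bsub>A\<^esub> smul A c v = smul A c (u \<otimes>\<^bsub>A\<^esub> v)" "adj A (u \<oplus>\<^bsub>A\<^esub> v) = adj A u \<oplus>\<^bsub>A\<^esub> adj A v"
      "adj A (u \<otimes>\<^bsub>A\<^esub> v) = adj A v \<otimes>\<^bsub>A\<^esub> adj A u"
      using fg by (simp_all add: ops closed distrib_left mult.assoc sc_left_comm)
    show "nrm A (u \<oplus>\<^bsub>A\<^esub> v) \<le> nrm A u + nrm A v"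
      using LIMSEQ_le[OF nrm[OF Cs_add[OF fg(1,3)]] tendsto_add[OF nrm[OF fg(1)] nrm[OF fg(3)]]] opn_triangle fg by (auto simp: add)
    show "nrm A (u \<otimes>\<^bsub>A\<^esub> v) \<le> nrm A u * nrm A v"
      using LIMSEQ_le[OF nrm[OF Cs_mult[OF fg(1,3)]] tendsto_mult[OF nrm[OF fg(1)] nrm[OF fg(3)]]] opn_mult fg by (auto simp: mult)
  next
    fix u :: 'u and c d :: complex assume "u \<in> carrier A"
    then obtain f where f: "f \<in> Cs" "u = emb f" by (metis carrE)
    show "smul A c u \<in> carrier A" "adj A u \<in> carrier A" "smul A 1 u = u" "adj A (adj A u) = u"
      "smul A (c + d) u = smul A c u \<oplus>\<^bsub>A\<^esub> smul A d u" "smul A c (smul A d u) = smul A (c * d) u"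
      using f by (simp_all add: ops closed carr sc_add distrib_right sc_mult mult.assoc)
    show "adj A (smul A c u) = smul A (cnj c) (adj A u)" using f by (simp add: ops closed del: st_mult)
    show "0 \<le> nrm A u" using nrm[OF f(1)] f(2) by (auto intro: LIMSEQ_le_const)
    show "nrm A u = 0 \<longleftrightarrow> u = \<zero>\<^bsub>A\<^esub>"
    proof
      assume "nrm A u = 0"
      then have "eqv f (\<lambda>_. 0)" using nrm[OF f(1)] by (simp add: eqv_def f(2))
      then show "u = \<zero>\<^bsub>A\<^esub>" by (simp add: f(2) zero emb_cong)
    next
      assume "u = \<zero>\<^bsub>A\<^esub>" then show "nrm A u = 0" using nrm_iota[of 0] by (simp add: zero \<iota>_def)
    qed
    show "nrm A (smul A c u) = cmod c * nrm A u"
      using lims[OF nrm[OF Cs_sc[OF f(1), of c]]] tendsto_mult_left[OF nrm[OF f(1)], of "cmod c"] by (simp add: smul f opn_sc)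
    show "nrm A (adj A u \<otimes>\<^bsub>A\<^esub> u) = (nrm A u)\<^sup>2"
      using lims[OF nrm[OF Cs_mult[OF Cs_st[OF f(1)] f(1)]]] tendsto_power[OF nrm[OF f(1)], of 2]
      by (simp add: mult adj f closed opn_cstar)
  next
    fix S :: "nat \<Rightarrow> 'u"
    assume S: "\<And>n. S n \<in> carrier A" "\<forall>e>0. \<exists>N. \<forall>j\<ge>N. \<forall>k\<ge>N. nrm A (S j \<ominus>\<^bsub>A\<^esub> S k) < e"
    obtain F where F: "\<And>n. F n \<in> Cs" "\<And>n. S n = emb (F n)" using carrE[OF S(1)] by metis
    have "\<forall>n. \<exists>x. nrm A (S n \<ominus>\<^bsub>A\<^esub> \<iota> x) < 1 / real (Suc n)" using dense[OF S(1)] by simp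
    then obtain x where x: "\<And>n. nrm A (S n \<ominus>\<^bsub>A\<^esub> \<iota> (x n)) < 1 / real (Suc n)" by metis
    have tri: "nrm A (emb f \<ominus>\<^bsub>A\<^esub> emb h) \<le> nrm A (emb f \<ominus>\<^bsub>A\<^esub> emb g) + nrm A (emb g \<ominus>\<^bsub>A\<^esub> emb h)"
      if "f \<in> Cs" "g \<in> Cs" "h \<in> Cs" for f g h
    proof -
      have D: "(\<lambda>n. p n - q n) \<in> Cs" if "p \<in> Cs" "q \<in> Cs" for p q using Cs_add[OF that(1) Cs_uminus[OF that(2)]] by simp
      show ?thesis using that D
        by (auto simp: minus intro!: LIMSEQ_le[OF nrm[OF D[OF that(1,3)]] tendsto_add[OF nrm[OF D[OF that(1,2)]] nrm[OF D[OF that(2,3)]]]] opn_triangle_diff)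
    qed
    have sym: "nrm A (emb f \<ominus>\<^bsub>A\<^esub> emb g) = nrm A (emb g \<ominus>\<^bsub>A\<^esub> emb f)" if "f \<in> Cs" "g \<in> Cs" for f g
    proof -
      have D: "(\<lambda>n. p n - q n) \<in> Cs" if "p \<in> Cs" "q \<in> Cs" for p q using Cs_add[OF that(1) Cs_uminus[OF that(2)]] by simp
      show ?thesis using lims[OF nrm[OF D[OF that]]] nrm[OF D[OF that(2,1)]] that by (simp add: minus opn_diff_commute)
    qed
    have triA: "nrm A (u \<ominus>\<^bsub>A\<^esub> w) \<le> nrm A (u \<ominus>\<^bsub>A\<^esub> v) + nrm A (v \<ominus>\<^bsub>A\<^esub> w)"
      if uvw: "u \<in> carrier A" "v \<in> carrier A" "w \<in> carrier A" for u v w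
    proof -
      obtain f g h where "f \<in> Cs" "u = emb f" "g \<in> Cs" "v = emb g" "h \<in> Cs" "w = emb h" using uvw carrE by metis
      then show ?thesis using tri[of f g h] by simp
    qed
    have symA: "nrm A (u \<ominus>\<^bsub>A\<^esub> v) = nrm A (v \<ominus>\<^bsub>A\<^esub> u)" if uv: "u \<in> carrier A" "v \<in> carrier A" for u v
    proof -
      obtain f g where "f \<in> Cs" "u = emb f" "g \<in> Cs" "v = emb g" using uv carrE by metis
      then show ?thesis using sym[of f g] by simp
    qed
    have ic: "\<iota> x \<in> carrier A" for x by (simp add: \<iota>_def closed carr)
    have opn_iota: "opn (x j - x k) = nrm A (\<iota> (x j) \<ominus>\<^bsub>A\<^esub> \<iota> (x k))" for j k
      using nrm_iota[of "x j - x k"] by (simp add: \<iota>_def minus closed)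
    have x_small: "\<exists>N. \<forall>n\<ge>N. nrm A (S n \<ominus>\<^bsub>A\<^esub> \<iota> (x n)) < \<epsilon>" if eps: "0 < \<epsilon>" for \<epsilon>
    proof -
      obtain N where "1 / real (Suc N) < \<epsilon>" using reals_Archimedean[OF eps] by (auto simp: inverse_eq_divide)
      then have "1 / real (Suc n) < \<epsilon>" if "n \<ge> N" for n using that by (smt (verit) frac_le of_nat_0_less_iff of_nat_mono Suc_le_mono zero_less_Suc)
      then show ?thesis using x less_trans by blast
    qed
    have xC: "x \<in> Cs"
      unfolding Cs_def
    proof (intro CollectI allI impI)
      fix \<epsilon> :: real assume "0 < \<epsilon>"
      then have e3: "0 < \<epsilon> / 3" by simp
      obtain N where N: "\<forall>j\<ge>N. \<forall>k\<ge>N. nrm A (S j \<ominus>\<^bsub>A\<^esub> S k) < \<epsilon> / 3" using S(2) e3 by blast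
      obtain N' where N': "\<forall>n\<ge>N'. nrm A (S n \<ominus>\<^bsub>A\<^esub> \<iota> (x n)) < \<epsilon> / 3" using x_small[OF e3] by blast
      have "opn (x j - x k) < \<epsilon>" if "j \<ge> max N N'" "k \<ge> max N N'" for j k
      proof -
        have "opn (x j - x k) \<le> nrm A (\<iota> (x j) \<ominus>\<^bsub>A\<^esub> S j) + (nrm A (S j \<ominus>\<^bsub>A\<^esub> S k) + nrm A (S k \<ominus>\<^bsub>A\<^esub> \<iota> (x k)))"
          unfolding opn_iota using triA[of "\<iota> (x j)" "S j" "\<iota> (x k)", OF ic S(1) ic] triA[of "S j" "S k" "\<iota> (x k)", OF S(1) S(1) ic]
          by linarith
        also have "nrm A (\<iota> (x j) \<ominus>\<^bsub>A\<^esub> S j) = nrm A (S j \<ominus>\<^bsub>A\<^esub> \<iota> (x j))" by (rule symA[OF ic S(1)])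
        finally show ?thesis using N[rule_format, of j k] N'[rule_format, of j] N'[rule_format, of k] that by simp
      qed
      then show "\<exists>N. \<forall>j\<ge>N. \<forall>k\<ge>N. opn (x j - x k) < \<epsilon>" by blast
    qed
    have "(\<lambda>n. nrm A (S n \<ominus>\<^bsub>A\<^esub> emb x)) \<longlonglongrightarrow> 0"
      unfolding LIMSEQ_iff
    proof (intro allI impI)
      fix \<epsilon> :: real assume "0 < \<epsilon>"
      then have e3: "0 < \<epsilon> / 3" by simp
      obtain N where N: "\<forall>n\<ge>N. nrm A (S n \<ominus>\<^bsub>A\<^esub> \<iota> (x n)) < \<epsilon> / 3" using x_small[OF e3] by blast
      obtain N' where N': "\<forall>j\<ge>N'. \<forall>k\<ge>N'. opn (x j - x k) < \<epsilon> / 3" using CsD[OF xC e3] by blast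
      have "nrm A (S n \<ominus>\<^bsub>A\<^esub> emb x) < \<epsilon>" if "n \<ge> max N N'" for n
      proof -
        have D: "(\<lambda>k. x n - x k) \<in> Cs" using Cs_add[OF Cs_const[of "x n"] Cs_uminus[OF xC]] by simp
        have "nrm A (\<iota> (x n) \<ominus>\<^bsub>A\<^esub> emb x) \<le> \<epsilon> / 3"
        proof -
          have "nrm A (emb (\<lambda>k. x n - x k)) \<le> \<epsilon> / 3"
            by (rule LIMSEQ_le_const2[OF nrm[OF D]]) (use N' that in \<open>auto intro!: exI[of _ N'] less_imp_le\<close>)
          then show ?thesis using xC by (simp add: \<iota>_def minus closed)
        qed
        then show ?thesis 
          using triA[of "S n" "\<iota> (x n)" "emb x", OF S(1) ic carr[OF xC]] N[rule_format, of n] that \<open>0 < \<epsilon>\<close> by simp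
      qed
      moreover have "0 \<le> nrm A (S n \<ominus>\<^bsub>A\<^esub> emb x)" for n
        using nrm[OF Cs_add[OF F(1) Cs_uminus[OF xC]], of n] F xC by (auto simp: minus intro: LIMSEQ_le_const)
      ultimately show "\<exists>no. \<forall>n\<ge>no. norm (nrm A (S n \<ominus>\<^bsub>A\<^esub> emb x) - 0) < \<epsilon>" by (intro exI[of _ "max N N'"]) auto
    qed
    then show "\<exists>x\<in>carrier A. (\<lambda>n. nrm A (S n \<ominus>\<^bsub>A\<^esub> x)) \<longlonglongrightarrow> 0" using carr[OF xC] by blast
  qed
  interpret cstar_algebra A by (rule A)
  have "tracial_cstar_space A \<phi>"
  proof
    fix u v :: 'u and c :: complex assume "u \<in> carrier A" and "v \<in> carrier A"
    then obtain f g where fg: "f \<in> Cs" "u = emb f" "g \<in> Cs" "v = emb g" by (metis carrE)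
    show "\<phi> (u \<oplus>\<^bsub>A\<^esub> v) = \<phi> u + \<phi> v"
      using limc[OF phi[OF Cs_add[OF fg(1,3)]]] tendsto_add[OF phi[OF fg(1)] phi[OF fg(3)]] fg by (simp add: add)
    show "\<phi> (u \<otimes>\<^bsub>A\<^esub> v) = \<phi> (v \<otimes>\<^bsub>A\<^esub> u)"
      using limc[OF phi[OF Cs_mult[OF fg(1,3)]]] phi[OF Cs_mult[OF fg(3,1)]] fg by (simp add: mult tr_comm)
  next
    fix u :: 'u and c :: complex assume "u \<in> carrier A"
    then obtain f where f: "f \<in> Cs" "u = emb f" by (metis carrE)
    show "\<phi> (smul A c u) = c * \<phi> u"
      using limc[OF phi[OF Cs_sc[OF f(1), of c]]] tendsto_mult_left[OF phi[OF f(1)], of c] f by (simp add: smul)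
    have lim: "(\<lambda>n. tr (st (f n) * f n)) \<longlonglongrightarrow> \<phi> (adj A u \<otimes>\<^bsub>A\<^esub> u)"
      using phi[OF Cs_mult[OF Cs_st[OF f(1)] f(1)]] f by (simp add: mult adj closed)
    show "\<phi> (adj A u \<otimes>\<^bsub>A\<^esub> u) \<in> \<real>\<^sub>\<ge>\<^sub>0"
      by (rule Lim_in_closed_set[OF closed_nonneg_Reals_complex _ _ lim]) (auto simp: tr_pos)
  next
    show "\<phi> \<one>\<^bsub>A\<^esub> = 1" using limc[OF phi[OF Cs_const[of 1]]] by (simp add: one)
  qed
  then have "is_completion A \<phi> \<iota>"
    unfolding is_completion_def using nrm_iota limc[OF phi[OF Cs_const]]
    by (auto simp: \<iota>_def carr closed ops one)
  then show ?thesis by blast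
qed

end

section \<open>Moments of tuples in C*-probability spaces\<close>

context cstar_algebra
begin

lemma smul_0: "x \<in> carrier A \<Longrightarrow> smul A 0 x = \<zero>"
proof -
  assume x: "x \<in> carrier A"
  have yy: "smul A 0 x \<oplus> smul A 0 x = smul A 0 x" using smul_add_left[OF x, of 0 0] by simp
  have "smul A 0 x = (smul A 0 x \<oplus> smul A 0 x) \<oplus> \<ominus> smul A 0 x" using smul_closed[OF x, of 0] by (simp add: a_assoc r_neg)
  then show ?thesis unfolding yy using smul_closed[OF x, of 0] by (simp add: r_neg)
qed

lemma minus_smul: "x \<in> carrier A \<Longrightarrow> \<ominus> x = smul A (-1) x"
proof -
  assume x: "x \<in> carrier A"
  have "smul A (-1) x \<oplus> x = \<zero>" using smul_add_left[OF x, of "-1" 1] smul_one[OF x] smul_0[OF x] by simp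
  then show ?thesis using minus_equality x smul_closed by metis
qed

lemma word_prod_simps [simp]: "word_prod A [] = \<one>" "word_prod A (x # xs) = x \<otimes> word_prod A xs"
  by (auto simp: word_prod_def)
lemma word_prod_closed: "(\<And>x. x \<in> set xs \<Longrightarrow> x \<in> carrier A) \<Longrightarrow> word_prod A xs \<in> carrier A"
  by (induction xs) auto
lemma word_prod_append: "(\<And>x. x \<in> set xs \<Longrightarrow> x \<in> carrier A) \<Longrightarrow> (\<And>x. x \<in> set ys \<Longrightarrow> x \<in> carrier A) \<Longrightarrow>
   word_prod A (xs @ ys) = word_prod A xs \<otimes> word_prod A ys"
  by (induction xs) (auto simp: m_assoc word_prod_closed)

end

context tracial_cstar_space
begin

lemma state_zero: "\<phi> \<zero> = 0" using state_smul[of \<zero> 0] smul_0[of \<zero>] by simp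

lemma state_finsum: "finite S \<Longrightarrow> (\<And>i. i \<in> S \<Longrightarrow> f i \<in> carrier A) \<Longrightarrow> \<phi> (\<Oplus>i\<in>S. f i) = (\<Sum>i\<in>S. \<phi> (f i))"
  by (induction S rule: finite_induct) (auto simp: state_zero state_add finsum_insert Pi_def)

lemma state_eval_poly:
  assumes "\<And>x. Y x \<in> carrier A"
  shows "\<phi> (eval_poly A Y P) = word_lin (\<lambda>w. \<phi> (word_prod A (map Y w))) P"
  unfolding eval_poly_def word_lin_def using assms
  by (subst state_finsum) (auto intro!: smul_closed word_prod_closed sum.cong state_smul)

end

section \<open>Cardinalities\<close>

text \<open>The type has at most continuum many elements. Then there are also at most continuum many sequences in it, such as
  those which represent the elements of a completion.\<close>
definition cont_small :: "'b itself \<Rightarrow> bool" where "cont_small _ \<longleftrightarrow> (\<exists>g :: 'b \<Rightarrow> real. inj g)"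

lemma cont_smallI: "inj (g :: 'b \<Rightarrow> 'd) \<Longrightarrow> cont_small TYPE('d) \<Longrightarrow> cont_small TYPE('b)"
  unfolding cont_small_def by (metis inj_compose)

lemma cont_small_seq_real: "cont_small TYPE(nat \<Rightarrow> real)"
proof -
  obtain b :: "real \<Rightarrow> nat set" where b: "bij b"
    using nat_sets_eqpoll_reals eqpoll_sym unfolding eqpoll_def by blast
  obtain d :: "nat set \<Rightarrow> real" where d: "bij d" using nat_sets_eqpoll_reals unfolding eqpoll_def by blast
  define g where "g = (\<lambda>f :: nat \<Rightarrow> real. d (prod_encode ` {(n, k). k \<in> b (f n)}))"
  have "inj g"
  proof (rule injI)
    fix f f' :: "nat \<Rightarrow> real" assume "g f = g f'"
    then have "prod_encode ` {(n, k). k \<in> b (f n)} = prod_encode ` {(n, k). k \<in> b (f' n)}"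
      unfolding g_def by (rule injD[OF bij_is_inj[OF d]])
    then have "{(n, k). k \<in> b (f n)} = {(n, k). k \<in> b (f' n)}"
      by (simp only: inj_image_eq_iff[OF inj_prod_encode])
    then have "b (f n) = b (f' n)" for n by (auto simp: set_eq_iff)
    then have "f n = f' n" for n by (rule injD[OF bij_is_inj[OF b]])
    then show "f = f'" by (rule ext)
  qed
  then show ?thesis by (auto simp: cont_small_def)
qed

lemma cont_small_seq: "cont_small TYPE('b) \<Longrightarrow> cont_small TYPE(nat \<Rightarrow> 'b)"
proof -
  assume "cont_small TYPE('b)"
  then obtain g :: "'b \<Rightarrow> real" where "inj g" by (auto simp: cont_small_def)
  then have "inj (\<lambda>f :: nat \<Rightarrow> 'b. g \<circ> f)" by (auto simp: inj_def fun_eq_iff)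
  then show ?thesis by (rule cont_smallI[OF _ cont_small_seq_real])
qed

lemma cont_small_prod: "cont_small TYPE('b) \<Longrightarrow> cont_small TYPE('d) \<Longrightarrow> cont_small TYPE('b \<times> 'd)"
proof -
  assume *: "cont_small TYPE('b)" "cont_small TYPE('d)"
  obtain g :: "'b \<Rightarrow> real" where g: "inj g" using *(1) unfolding cont_small_def by blast
  obtain h :: "'d \<Rightarrow> real" where h: "inj h" using *(2) unfolding cont_small_def by blast
  have "inj (\<lambda>p :: 'b \<times> 'd. \<lambda>n::nat. if n = 0 then g (fst p) else h (snd p))"
  proof (rule injI)
    fix p q :: "'b \<times> 'd"
    assume eq: "(\<lambda>n::nat. if n = 0 then g (fst p) else h (snd p)) = (\<lambda>n. if n = 0 then g (fst q) else h (snd q))"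
    from fun_cong[OF eq, of 0] fun_cong[OF eq, of 1] show "p = q"
      using injD[OF g, of "fst p" "fst q"] injD[OF h, of "snd p" "snd q"] by (simp add: prod_eq_iff)
  qed
  then show ?thesis by (rule cont_smallI[OF _ cont_small_seq_real])
qed

lemma cont_small_list: "cont_small TYPE('b) \<Longrightarrow> cont_small TYPE('b list)"
proof -
  assume "cont_small TYPE('b)"
  then obtain g :: "'b \<Rightarrow> real" where g: "inj g" by (auto simp: cont_small_def)
  define F where "F = (\<lambda>(xs :: 'b list) n. if n = 0 then real (length xs) else if n - 1 < length xs then g (xs ! (n - 1)) else 0)"
  have "inj F"
  proof (rule injI)
    fix xs ys assume eq: "F xs = F ys"
    from fun_cong[OF eq, of 0] have l: "length xs = length ys" by (simp add: F_def)
    have "xs ! i = ys ! i" if "i < length xs" for i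
      using fun_cong[OF eq, of "Suc i"] that l g by (simp add: F_def inj_eq)
    then show "xs = ys" using l by (simp add: list_eq_iff_nth_eq)
  qed
  then show ?thesis by (rule cont_smallI[OF _ cont_small_seq_real])
qed

lemma cont_small_real: "cont_small TYPE(real)" by (auto simp: cont_small_def intro: exI[of _ id])

lemma cont_small_complex: "cont_small TYPE(complex)"
  by (rule cont_smallI[of "\<lambda>z. (Re z, Im z)", OF _ cont_small_prod[OF cont_small_real cont_small_real]])
    (auto simp: inj_def complex_eq_iff)

lemma cont_small_finite: "cont_small TYPE('b::finite)"
proof -
  obtain f :: "'b \<Rightarrow> nat" where "inj f" using finite_imp_inj_to_nat_seg[of "UNIV :: 'b set"] by auto
  then have "inj (\<lambda>x. real (f x))" by (auto simp: inj_def)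
  then show ?thesis by (auto simp: cont_small_def)
qed

lemma cont_small_ncpoly: assumes "cont_small TYPE('x)" shows "cont_small TYPE('x ncpoly)"
proof -
  define g where "g = (\<lambda>P :: 'x ncpoly. SOME l. set l = (\<lambda>w. (w, Poly_Mapping.lookup P w)) ` Poly_Mapping.keys P)"
  have g: "set (g P) = (\<lambda>w. (w, Poly_Mapping.lookup P w)) ` Poly_Mapping.keys P" for P
    unfolding g_def by (rule someI_ex) (simp add: finite_list)
  have "inj g"
  proof (rule injI)
    fix P Q :: "'x ncpoly" assume "g P = g Q"
    then have eq: "(\<lambda>w. (w, Poly_Mapping.lookup P w)) ` Poly_Mapping.keys P = (\<lambda>w. (w, Poly_Mapping.lookup Q w)) ` Poly_Mapping.keys Q"
      using g by metis
    have "Poly_Mapping.lookup P w = Poly_Mapping.lookup Q w" for w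
    proof (cases "w \<in> Poly_Mapping.keys P")
      case True then have "(w, Poly_Mapping.lookup P w) \<in> (\<lambda>w. (w, Poly_Mapping.lookup Q w)) ` Poly_Mapping.keys Q" unfolding eq[symmetric] by blast
      then show ?thesis by auto
    next
      case False
      then have "w \<notin> Poly_Mapping.keys Q" using eq by (metis (no_types, lifting) Pair_inject imageE imageI)
      then show ?thesis using False by (simp add: in_keys_iff)
    qed
    then show "P = Q" by (rule poly_mapping_eqI)
  qed
  then show ?thesis
    by (rule cont_smallI[OF _ cont_small_list[OF cont_small_prod[OF cont_small_list[OF assms] cont_small_complex]]])
qed

lemma universe_inj:
  assumes "(UNIV :: real set) \<lesssim> (UNIV :: 'u set)" "cont_small TYPE('a)"
  shows "\<exists>e :: (nat \<Rightarrow> 'a) \<Rightarrow> 'u. inj e"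
proof -
  obtain f :: "real \<Rightarrow> 'u" where "inj f" using assms(1) by (auto simp: lepoll_def)
  moreover obtain g :: "(nat \<Rightarrow> 'a) \<Rightarrow> real" where "inj g" using cont_small_seq[OF assms(2)] by (auto simp: cont_small_def)
  ultimately show ?thesis by (metis inj_compose)
qed

section \<open>Passing between a tracial pre-C*-algebra and its completion\<close>

context trace_algebra
begin

text \<open>Convexity, tested in the vector states of the completion.\<close>
definition mono_field :: "real \<Rightarrow> real \<Rightarrow> ('m::finite \<Rightarrow> 'm ncpoly) \<Rightarrow> bool" where
  "mono_field c M D \<longleftrightarrow> (\<forall>X Y y. (\<forall>i. opn (X i) \<le> M \<and> opn (Y i) \<le> M) \<longrightarrow>
     c * (\<Sum>i\<in>UNIV. (n2 (st (X i - Y i) * y))\<^sup>2) \<le>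
       (\<Sum>i\<in>UNIV. Re (tr (st y * (ev X (D i) - ev Y (D i)) * st (X i - Y i) * y))))"

context
  fixes A :: "'u cstar" and \<phi> \<iota>
  assumes comp: "is_completion A \<phi> \<iota>"
begin

lemma comp_space: "tracial_cstar_space A \<phi>" using comp by (simp add: is_completion_def)

interpretation A: tracial_cstar_space A \<phi> by (rule comp_space)

lemma io_closed [simp]: "\<iota> x \<in> carrier A"
  and io_add: "\<iota> (x + y) = \<iota> x \<oplus>\<^bsub>A\<^esub> \<iota> y" and io_mult: "\<iota> (x * y) = \<iota> x \<otimes>\<^bsub>A\<^esub> \<iota> y" and io_one: "\<iota> 1 = \<one>\<^bsub>A\<^esub>"
  and io_sc: "\<iota> (sc c * x) = smul A c (\<iota> x)" and io_st: "\<iota> (st x) = adj A (\<iota> x)" and io_nrm: "nrm A (\<iota> x) = opn x"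
  and io_tr: "\<phi> (\<iota> x) = tr x"
  using comp by (auto simp: is_completion_def)

lemma io_0: "\<iota> 0 = \<zero>\<^bsub>A\<^esub>" using io_sc[of 0 0] A.smul_0[of "\<iota> 0"] by simp
lemma io_uminus: "\<iota> (- x) = \<ominus>\<^bsub>A\<^esub> \<iota> x" using io_sc[of "-1" x] by (simp add: sc_minus A.minus_smul)
lemma io_diff: "\<iota> (x - y) = \<iota> x \<ominus>\<^bsub>A\<^esub> \<iota> y" using io_add[of x "- y"] by (simp add: io_uminus A.minus_eq)
lemma io_sum: "finite S \<Longrightarrow> \<iota> (\<Sum>i\<in>S. f i) = (\<Oplus>\<^bsub>A\<^esub>i\<in>S. \<iota> (f i))"
  by (induction S rule: finite_induct) (auto simp: io_0 io_add A.finsum_insert)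
lemma io_prod: "\<iota> (prod_list xs) = word_prod A (map \<iota> xs)"
  by (induction xs) (auto simp: io_one io_mult)
lemma io_ev: "eval_poly A (\<lambda>x. \<iota> (X x)) P = \<iota> (ev X P)"
  unfolding eval_poly_def ev_def io_sum[OF finite_keys] io_sc io_prod by (simp add: o_def)
lemma io_dot: "tuple_dot A (\<lambda>i. \<iota> (X i)) (\<lambda>i. \<iota> (Y i)) = \<iota> (sc (1/2) * (\<Sum>i\<in>UNIV. X i * st (Y i) + Y i * st (X i)))"
  unfolding tuple_dot_def io_sc io_sum[OF finite_class.finite_UNIV] by (simp add: io_add io_mult io_st)

lemma mono_field_of_convex:
  fixes V :: "'m::finite ncpoly"
  assumes conv: "cM_convex TYPE('u) c M V"
  shows "mono_field c M (\<lambda>i. cyc_deriv i V)"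
  unfolding mono_field_def
proof (intro allI impI)
  fix X Y :: "'m \<Rightarrow> 'a" and y
  assume XY: "\<forall>i. opn (X i) \<le> M \<and> opn (Y i) \<le> M"
  define H where "H = (\<lambda>i. X i - Y i)"
  define G where "G = (\<lambda>i. ev X (cyc_deriv i V) - ev Y (cyc_deriv i V))"
  define q where "q = sc (1/2) * (\<Sum>i\<in>UNIV. G i * st (H i) + H i * st (G i)) - sc (of_real c) * (sc (1/2) * (\<Sum>i\<in>UNIV. H i * st (H i) + H i * st (H i)))"
  have "cstar_le A (smul A (of_real c) (tuple_dot A (tuple_diff A (\<lambda>i. \<iota> (X i)) (\<lambda>i. \<iota> (Y i))) (tuple_diff A (\<lambda>i. \<iota> (X i)) (\<lambda>i. \<iota> (Y i)))))
          (tuple_dot A (tuple_diff A (cyc_grad_at A V (\<lambda>i. \<iota> (X i))) (cyc_grad_at A V (\<lambda>i. \<iota> (Y i)))) (tuple_diff A (\<lambda>i. \<iota> (X i)) (\<lambda>i. \<iota> (Y i))))"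
    using conv A.cstar_algebra_axioms XY unfolding cM_convex_def by (simp add: io_nrm)
  moreover have "tuple_diff A (\<lambda>i. \<iota> (X i)) (\<lambda>i. \<iota> (Y i)) = (\<lambda>i. \<iota> (H i))"
    by (simp add: tuple_diff_def H_def io_diff)
  moreover have "tuple_diff A (cyc_grad_at A V (\<lambda>i. \<iota> (X i))) (cyc_grad_at A V (\<lambda>i. \<iota> (Y i))) = (\<lambda>i. \<iota> (G i))"
    by (simp add: tuple_diff_def cyc_grad_at_def G_def io_diff io_ev)
  ultimately have "cstar_positive A (\<iota> q)"
    by (simp add: cstar_le_def io_dot q_def io_diff io_sc)
  then obtain z where z: "z \<in> carrier A" "\<iota> q = adj A z \<otimes>\<^bsub>A\<^esub> z" by (auto simp: cstar_positive_def)
  have "tr (st y * q * y) = \<phi> (adj A (z \<otimes>\<^bsub>A\<^esub> \<iota> y) \<otimes>\<^bsub>A\<^esub> (z \<otimes>\<^bsub>A\<^esub> \<iota> y))"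
    using z(1) by (simp add: io_tr[symmetric] io_mult io_st z(2) A.adj_mult A.adj_closed A.m_assoc)
  then have "0 \<le> Re (tr (st y * q * y))" using A.state_pos[of "z \<otimes>\<^bsub>A\<^esub> \<iota> y"] z by (simp add: complex_nonneg_Reals_iff)
  moreover have "Re (tr (st y * q * y)) = (\<Sum>i\<in>UNIV. Re (tr (st y * G i * st (H i) * y))) - c * (\<Sum>i\<in>UNIV. (n2 (st (H i) * y))\<^sup>2)"
  proof -
    have conj: "Re (tr (st y * (H i * st (G i)) * y)) = Re (tr (st y * G i * st (H i) * y))" for i
      using tr_st[of "st y * G i * st (H i) * y"] by (simp add: mult.assoc)
    have sq: "Re (tr (st y * (H i * st (H i)) * y)) = (n2 (st (H i) * y))\<^sup>2" for i
      by (simp add: n2_square mult.assoc)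
    have e1: "tr (st y * (sc d * x) * y) = d * tr (st y * x * y)" for d x
      by (simp add: sc_left_comm mult.assoc)
    have e2: "tr (st y * (\<Sum>i\<in>UNIV. f i) * y) = (\<Sum>i\<in>UNIV. tr (st y * f i * y))" for f :: "'m \<Rightarrow> 'a"
      by (simp add: sum_distrib_left sum_distrib_right tr_sum)
    have "tr (st y * q * y) = 1/2 * (\<Sum>i\<in>UNIV. tr (st y * (G i * st (H i)) * y) + tr (st y * (H i * st (G i)) * y))
        - of_real c * (1/2 * (\<Sum>i\<in>UNIV. tr (st y * (H i * st (H i)) * y) + tr (st y * (H i * st (H i)) * y)))"
      unfolding q_def right_diff_distrib left_diff_distrib tr_diff e1 e2 by (simp only: distrib_left distrib_right tr_add)
    then show ?thesis
      by (simp add: sum.distrib conj sq mult.assoc[of "st y" "G _"] Re_sum flip: sum_distrib_left)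
  qed
  ultimately show "c * (\<Sum>i\<in>UNIV. (n2 (st (X i - Y i) * y))\<^sup>2) \<le>
       (\<Sum>i\<in>UNIV. Re (tr (st y * (ev X (cyc_deriv i V) - ev Y (cyc_deriv i V)) * st (X i - Y i) * y)))"
    unfolding H_def[symmetric] G_def[symmetric] by (simp add: H_def G_def)
qed

end

end

section \<open>Accretive matrices\<close>

definition accretive :: "real \<Rightarrow> ('x::finite \<Rightarrow> 'x \<Rightarrow> complex) \<Rightarrow> bool" where
  "accretive c B \<longleftrightarrow> (\<forall>v. c * (\<Sum>x\<in>UNIV. (cmod (v x))\<^sup>2) \<le> Re (\<Sum>x\<in>UNIV. \<Sum>y\<in>UNIV. cnj (v x) * B x y * v y))"

lemma accretive_kernel:
  assumes "accretive c B" "0 < c" and "\<And>x. (\<Sum>y\<in>UNIV. B x y * v y) = 0" shows "v x = 0"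
proof -
  have "(\<Sum>x\<in>UNIV. \<Sum>y\<in>UNIV. cnj (v x) * B x y * v y) = (\<Sum>x\<in>UNIV. cnj (v x) * (\<Sum>y\<in>UNIV. B x y * v y))"
    by (simp add: sum_distrib_left mult.assoc)
  then have "c * (\<Sum>x\<in>UNIV. (cmod (v x))\<^sup>2) \<le> 0" using assms(1)[unfolded accretive_def, rule_format, of v] assms(3) by simp
  then have "(\<Sum>x\<in>UNIV. (cmod (v x))\<^sup>2) \<le> 0" using assms(2) by (simp add: mult_le_0_iff)
  then have "(\<Sum>x\<in>UNIV. (cmod (v x))\<^sup>2) = 0" using sum_nonneg[of UNIV "\<lambda>x. (cmod (v x))\<^sup>2"] by simp
  then show ?thesis by (simp add: sum_nonneg_eq_0_iff)
qed

lemma accretive_transpose: assumes "accretive c B" shows "accretive c (\<lambda>x y. B y x)"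
  unfolding accretive_def
proof
  fix v :: "'a \<Rightarrow> complex"
  have "(\<Sum>x\<in>UNIV. \<Sum>y\<in>UNIV. cnj (v x) * B y x * v y) = (\<Sum>y\<in>UNIV. \<Sum>x\<in>UNIV. cnj (cnj (v y)) * B y x * cnj (v x))"
    by (subst sum.swap) (simp add: mult_ac)
  then show "c * (\<Sum>x\<in>UNIV. (cmod (v x))\<^sup>2) \<le> Re (\<Sum>x\<in>UNIV. \<Sum>y\<in>UNIV. cnj (v x) * B y x * v y)"
    using assms[unfolded accretive_def, rule_format, of "\<lambda>x. cnj (v x)"] by simp
qed

text \<open>Injectivity suffices in finite dimension.\<close>
lemma accretive_solve:
  assumes B: "accretive c B" "0 < c" shows "\<exists>v. \<forall>x. (\<Sum>y\<in>UNIV. B x y * v y) = b x"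
proof -
  define f where "f = (\<lambda>v :: complex^'a. \<chi> x. \<Sum>y\<in>UNIV. B x y * v $ y)"
  have lin: "linear f"
    by (rule linearI) (simp_all add: f_def vec_eq_iff distrib_left sum.distrib scaleR_sum_right)
  have "inj f"
    unfolding linear_injective_0[OF lin]
  proof (intro allI impI)
    fix v assume "f v = 0"
    then have "(\<Sum>y\<in>UNIV. B x y * v $ y) = 0" for x by (simp add: f_def vec_eq_iff)
    from accretive_kernel[OF B this] show "v = 0" by (simp add: vec_eq_iff)
  qed
  then have "surj f" by (rule linear_injective_imp_surjective[OF lin]) (rule refl)
  then obtain v where "f v = (\<chi> x. b x)" by (metis surjD)
  then show ?thesis by (intro exI[of _ "\<lambda>y. v $ y"]) (simp add: f_def vec_eq_iff)
qed

section \<open>The Lyapunov equation\<close>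

text \<open>A negative minimal value of the quadratic form of \<open>G\<close> on the sphere would decrease further along the flow
  of \<open>- C\<close>, relative to the norm.\<close>
lemma lyapunov_nonneg:
  fixes G C :: "'a::euclidean_space \<Rightarrow> 'a"
  assumes G: "linear G" and C: "linear C" and c: "0 < c" "\<And>v. c * (v \<bullet> v) \<le> v \<bullet> C v"
    and pos: "\<And>v. 0 \<le> C v \<bullet> G v + v \<bullet> G (C v)"
  shows "0 \<le> v \<bullet> G v"
proof -
  have ne: "sphere (0::'a) 1 \<noteq> {}" using vector_choose_size[of 1] by auto
  have cont: "continuous_on (sphere 0 1) (\<lambda>v. v \<bullet> G v)"
    by (intro continuous_intros linear_continuous_on linear_conv_bounded_linear[THEN iffD1] G)
  obtain v0 where v0: "v0 \<in> sphere 0 1" and min: "\<And>w. w \<in> sphere 0 1 \<Longrightarrow> v0 \<bullet> G v0 \<le> w \<bullet> G w"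
    using continuous_attains_inf[OF compact_sphere ne cont] by blast
  define l where "l = v0 \<bullet> G v0"
  have v1: "v0 \<bullet> v0 = 1" using v0 by (simp add: dot_square_norm)
  have q: "l * (w \<bullet> w) \<le> w \<bullet> G w" for w
  proof (cases "w = 0")
    case True then show ?thesis using linear_0[OF G] by simp
  next
    case False
    have "l \<le> (w /\<^sub>R norm w) \<bullet> G (w /\<^sub>R norm w)" unfolding l_def by (rule min) (use False in simp)
    also have "\<dots> = (w \<bullet> G w) / (norm w)\<^sup>2" by (simp add: linear_scale[OF G] power2_eq_square divide_inverse)
    finally show ?thesis using False by (simp add: pos_le_divide_eq dot_square_norm)
  qed
  have "0 \<le> l"
  proof (rule ccontr)
    assume "\<not> 0 \<le> l"
    then have l: "l < 0" by simp
    define Q where "Q = \<bar>C v0 \<bullet> G (C v0)\<bar> - l * (C v0 \<bullet> C v0)"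
    have Q: "0 \<le> Q" using mult_nonpos_nonneg[of l "C v0 \<bullet> C v0"] l by (simp add: Q_def)
    have bound: "2 * c * (- l) \<le> h * Q" if h: "0 < h" for h
    proof -
      define w where "w = v0 - h *\<^sub>R C v0"
      have Gw: "w \<bullet> G w = l - h * (C v0 \<bullet> G v0 + v0 \<bullet> G (C v0)) + h\<^sup>2 * (C v0 \<bullet> G (C v0))"
        by (simp add: w_def l_def linear_diff[OF G] linear_scale[OF G] inner_diff_left inner_diff_right algebra_simps power2_eq_square)
      have ww: "w \<bullet> w = 1 - 2 * h * (v0 \<bullet> C v0) + h\<^sup>2 * (C v0 \<bullet> C v0)"
        by (simp add: w_def v1 inner_diff_left inner_diff_right algebra_simps power2_eq_square inner_commute)
      have "c \<le> v0 \<bullet> C v0" using c(2)[of v0] v1 by simp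
      then have "l * (w \<bullet> w) \<ge> l * (1 - 2 * h * c + h\<^sup>2 * (C v0 \<bullet> C v0))"
        unfolding ww using h l by (intro mult_left_mono_neg) auto
      moreover have "w \<bullet> G w \<le> l + h\<^sup>2 * \<bar>C v0 \<bullet> G (C v0)\<bar>"
      proof -
        have "h\<^sup>2 * (C v0 \<bullet> G (C v0)) \<le> h\<^sup>2 * \<bar>C v0 \<bullet> G (C v0)\<bar>" by (intro mult_left_mono) auto
        moreover have "0 \<le> h * (C v0 \<bullet> G v0 + v0 \<bullet> G (C v0))" using pos[of v0] h by simp
        ultimately show ?thesis unfolding Gw by linarith
      qed
      ultimately have "l * (1 - 2 * h * c + h\<^sup>2 * (C v0 \<bullet> C v0)) \<le> l + h\<^sup>2 * \<bar>C v0 \<bullet> G (C v0)\<bar>"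
        using q[of w] by linarith
      then have "h * (2 * c * (- l)) \<le> h * (h * Q)" by (simp add: Q_def algebra_simps power2_eq_square)
      from mult_left_le_imp_le[OF this h] show ?thesis .
    qed
    define h where "h = c * (- l) / (Q + 1)"
    have "0 < h" unfolding h_def using c l Q by (intro divide_pos_pos mult_pos_pos) auto
    have "h * Q < h * (Q + 1)" using \<open>0 < h\<close> by simp
    also have "h * (Q + 1) = c * (- l)" using Q by (simp add: h_def)
    finally have "2 * c * (- l) < c * (- l)" using bound[OF \<open>0 < h\<close>] by linarith
    moreover have "0 < c * (- l)" using c l by (simp add: mult_pos_neg)
    ultimately show False by linarith
  qed
  then show ?thesis using q[of v] by (smt (verit) inner_ge_zero mult_nonneg_nonneg)
qed

text \<open>The operator \<open>k \<mapsto> conj(B) k + k B\<^sup>T\<close> of the Lyapunov equation.\<close>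
definition lyap :: "('x::finite \<Rightarrow> 'x \<Rightarrow> complex) \<Rightarrow> ('x \<Rightarrow> 'x \<Rightarrow> complex) \<Rightarrow> 'x \<Rightarrow> 'x \<Rightarrow> complex" where
  "lyap B k x y = (\<Sum>z\<in>UNIV. cnj (B x z) * k z y) + (\<Sum>z\<in>UNIV. B y z * k x z)"

text \<open>The real part of the operator on matrices is at least twice that of \<open>B\<close>, by its action on columns and on rows.\<close>
lemma lyap_inj:
  assumes B: "accretive c B" "0 < c" and eq: "\<And>x y. lyap B k x y = lyap B k' x y"
  shows "k x y = k' x y"
proof -
  define d where "d = (\<lambda>x y. k x y - k' x y)"
  have d0: "lyap B d x y = 0" for x y
    using eq[of x y] by (simp add: lyap_def d_def right_diff_distrib sum_subtractf) (simp add: algebra_simps)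
  define N where "N = (\<Sum>x\<in>UNIV. \<Sum>y\<in>UNIV. (cmod (d x y))\<^sup>2)"
  have col: "c * (\<Sum>x\<in>UNIV. (cmod (d x y))\<^sup>2) \<le> Re (\<Sum>x\<in>UNIV. \<Sum>z\<in>UNIV. cnj (d x y) * (cnj (B x z) * d z y))" for y
  proof -
    have eq: "(\<Sum>x\<in>UNIV. \<Sum>z\<in>UNIV. cnj (d x y) * (cnj (B x z) * d z y)) =
        cnj (\<Sum>x\<in>UNIV. \<Sum>z\<in>UNIV. cnj (cnj (d x y)) * B x z * cnj (d z y))" by (simp add: mult.assoc)
    show ?thesis using B(1)[unfolded accretive_def, rule_format, of "\<lambda>x. cnj (d x y)"]
      unfolding eq cnj.sel complex_mod_cnj .
  qed
  have row: "c * (\<Sum>y\<in>UNIV. (cmod (d x y))\<^sup>2) \<le> Re (\<Sum>y\<in>UNIV. \<Sum>z\<in>UNIV. cnj (d x y) * (B y z * d x z))" for x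
    using B(1)[unfolded accretive_def, rule_format, of "\<lambda>y. d x y"] by (simp add: mult_ac)
  have "0 = Re (\<Sum>x\<in>UNIV. \<Sum>y\<in>UNIV. cnj (d x y) * lyap B d x y)" by (simp add: d0)
  also have "\<dots> = Re (\<Sum>y\<in>UNIV. \<Sum>x\<in>UNIV. \<Sum>z\<in>UNIV. cnj (d x y) * (cnj (B x z) * d z y))
      + Re (\<Sum>x\<in>UNIV. \<Sum>y\<in>UNIV. \<Sum>z\<in>UNIV. cnj (d x y) * (B y z * d x z))"
    by (subst sum.swap[of _ UNIV UNIV]) (simp add: lyap_def distrib_left sum.distrib sum_distrib_left)
  also have "\<dots> \<ge> (\<Sum>y\<in>UNIV. c * (\<Sum>x\<in>UNIV. (cmod (d x y))\<^sup>2)) + (\<Sum>x\<in>UNIV. c * (\<Sum>y\<in>UNIV. (cmod (d x y))\<^sup>2))"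
    unfolding Re_sum[of _ UNIV] using col row by (intro add_mono sum_mono) (simp_all add: Re_sum)
  finally have "c * N + c * N \<le> 0"
    by (simp add: N_def sum_distrib_left[symmetric] sum.swap[of "\<lambda>y x. (cmod (d x y))\<^sup>2"])
  then have "N \<le> 0" using B(2) by (simp add: mult_le_0_iff)
  moreover have "(cmod (d x y))\<^sup>2 \<le> N"
  proof -
    have "(cmod (d x y))\<^sup>2 \<le> (\<Sum>y\<in>UNIV. (cmod (d x y))\<^sup>2)" by (rule member_le_sum) auto
    also have "\<dots> \<le> N" unfolding N_def by (rule member_le_sum[of x UNIV "\<lambda>x. \<Sum>y\<in>UNIV. (cmod (d x y))\<^sup>2"]) (auto intro: sum_nonneg)
    finally show ?thesis .
  qed
  ultimately have "(cmod (d x y))\<^sup>2 \<le> 0" by linarith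
  then show ?thesis by (simp add: d_def)
qed

lemma lyap_solve:
  assumes B: "accretive c B" "0 < c" shows "\<exists>k. \<forall>x y. lyap B k x y = J x y"
proof -
  define f where "f = (\<lambda>K :: complex^'a^'a. \<chi> x y. lyap B (\<lambda>x y. K $ x $ y) x y)"
  have lin: "linear f"
    by (rule linearI) (simp_all add: f_def lyap_def vec_eq_iff distrib_left sum.distrib scaleR_sum_right scaleR_add_right)
  have "inj f"
    unfolding linear_injective_0[OF lin]
  proof (intro allI impI)
    fix K assume "f K = 0"
    then have "lyap B (\<lambda>x y. K $ x $ y) x y = lyap B (\<lambda>x y. 0) x y" for x y by (simp add: f_def vec_eq_iff lyap_def[of B "\<lambda>x y. 0"])
    from lyap_inj[OF B this] show "K = 0" by (simp add: vec_eq_iff)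
  qed
  then have "surj f" by (rule linear_injective_imp_surjective[OF lin]) (rule refl)
  then obtain K where "f K = (\<chi> x y. J x y)" by (metis surjD)
  then show ?thesis by (intro exI[of _ "\<lambda>x y. K $ x $ y"]) (simp add: f_def vec_eq_iff)
qed

lemma lyap_herm:
  assumes B: "accretive c B" "0 < c" and k: "\<And>x y. lyap B k x y = J x y" and J: "\<And>x y. J y x = cnj (J x y)"
  shows "k y x = cnj (k x y)"
proof -
  have "lyap B (\<lambda>x y. cnj (k y x)) x y = lyap B k x y" for x y
  proof -
    have "lyap B (\<lambda>x y. cnj (k y x)) x y = cnj (lyap B k y x)" by (simp add: lyap_def mult_ac add_ac)
    then show ?thesis using J[of x y] by (simp add: k)
  qed
  from lyap_inj[OF B this, of x y] show ?thesis by (metis complex_cnj_cnj)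
qed

lemma sesq_finite:
  fixes f :: "'x::finite \<Rightarrow> 'x \<Rightarrow> complex"
  shows "\<exists>v. sesq f xs xs = (\<Sum>x\<in>UNIV. \<Sum>y\<in>UNIV. cnj (v x) * f x y * v y)"
proof -
  define v where "v = (\<lambda>(xs :: (complex \<times> 'x) list) x. \<Sum>(c, b)\<leftarrow>xs. if b = x then c else (0::complex))"
  have v: "v [] x = 0" "v (p # xs) x = (if snd p = x then fst p else 0) + v xs x" for p xs x
    by (auto simp: v_def case_prod_beta)
  have lin: "lin_ext \<phi> ys = (\<Sum>y\<in>UNIV. \<phi> y * v ys y)" for \<phi> :: "'x \<Rightarrow> complex" and ys
    by (induction ys) (auto simp: v distrib_left sum.distrib if_distrib[of "\<lambda>z. _ * z"] sum.delta cong: if_cong)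
  have "sesq f zs ys = (\<Sum>x\<in>UNIV. cnj (v zs x) * (\<Sum>y\<in>UNIV. f x y * v ys y))" for zs ys
    by (induction zs) (auto simp: v lin distrib_right sum.distrib if_distrib[of cnj] if_distrib[of "\<lambda>z. z * _"] sum.delta cong: if_cong)
  then show ?thesis by (intro exI[of _ "v xs"]) (simp add: sum_distrib_left mult.assoc)
qed

lemma inner_complex_sum: "v \<bullet> w = Re (\<Sum>x\<in>UNIV. cnj (v $ x) * w $ x)" for v w :: "complex^'x::finite"
  by (simp add: inner_vec_def inner_complex_def)

text \<open>The equation says that the quadratic form of \<open>k\<close> increases along the flow of the transpose of \<open>B\<close>.\<close>
lemma lyap_psd:
  fixes B k J :: "'x::finite \<Rightarrow> 'x \<Rightarrow> complex"
  assumes B: "accretive c B" "0 < c" and k: "\<And>x y. lyap B k x y = J x y" and J: "psd J"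
  shows "psd k"
proof -
  define G where "G = (\<lambda>v :: complex^'x. \<chi> x. \<Sum>y\<in>UNIV. k x y * v $ y)"
  define C where "C = (\<lambda>v :: complex^'x. \<chi> z. \<Sum>x\<in>UNIV. B x z * v $ x)"
  have lin: "linear G" "linear C"
    by (rule linearI; simp add: G_def C_def vec_eq_iff distrib_left sum.distrib scaleR_sum_right)+
  have acc: "c * (v \<bullet> v) \<le> v \<bullet> C v" for v
  proof -
    have "v \<bullet> v = (\<Sum>x\<in>UNIV. (cmod (v $ x))\<^sup>2)" by (simp add: inner_vec_def dot_square_norm)
    then show ?thesis using accretive_transpose[OF B(1), unfolded accretive_def, rule_format, of "\<lambda>x. v $ x"]
      unfolding inner_complex_sum[of v "C v"] by (simp add: C_def sum_distrib_left mult.assoc)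
  qed
  have pos: "0 \<le> C v \<bullet> G v + v \<bullet> G (C v)" for v
  proof -
    have "(\<Sum>z\<in>UNIV. cnj (C v $ z) * G v $ z) + (\<Sum>x\<in>UNIV. cnj (v $ x) * G (C v) $ x)
       = (\<Sum>x\<in>UNIV. \<Sum>y\<in>UNIV. cnj (v $ x) * J x y * v $ y)"
    proof -
      have 1: "(\<Sum>z\<in>UNIV. cnj (C v $ z) * G v $ z) = (\<Sum>x\<in>UNIV. \<Sum>y\<in>UNIV. cnj (v $ x) * (\<Sum>z\<in>UNIV. cnj (B x z) * k z y) * v $ y)"
      proof -
        have "(\<Sum>z\<in>UNIV. cnj (C v $ z) * G v $ z) = (\<Sum>z\<in>UNIV. \<Sum>x\<in>UNIV. \<Sum>y\<in>UNIV. cnj (v $ x) * (cnj (B x z) * k z y) * v $ y)"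
        proof (rule sum.cong[OF refl])
          fix z
          have "cnj (C v $ z) = (\<Sum>x\<in>UNIV. cnj (v $ x) * cnj (B x z))" by (simp add: C_def mult.commute)
          moreover have "G v $ z = (\<Sum>y\<in>UNIV. k z y * v $ y)" by (simp add: G_def)
          ultimately show "cnj (C v $ z) * G v $ z = (\<Sum>x\<in>UNIV. \<Sum>y\<in>UNIV. cnj (v $ x) * (cnj (B x z) * k z y) * v $ y)"
            by (simp only: sum_product) (simp only: mult.assoc)
        qed
        also have "\<dots> = (\<Sum>x\<in>UNIV. \<Sum>z\<in>UNIV. \<Sum>y\<in>UNIV. cnj (v $ x) * (cnj (B x z) * k z y) * v $ y)"
          by (rule sum.swap)
        also have "\<dots> = (\<Sum>x\<in>UNIV. \<Sum>y\<in>UNIV. \<Sum>z\<in>UNIV. cnj (v $ x) * (cnj (B x z) * k z y) * v $ y)"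
          by (intro sum.cong refl sum.swap)
        finally show ?thesis by (simp add: sum_distrib_left sum_distrib_right)
      qed
      have 2: "(\<Sum>x\<in>UNIV. cnj (v $ x) * G (C v) $ x) = (\<Sum>x\<in>UNIV. \<Sum>y\<in>UNIV. cnj (v $ x) * (\<Sum>z\<in>UNIV. B y z * k x z) * v $ y)"
      proof (intro sum.cong refl)
        fix x
        have "cnj (v $ x) * G (C v) $ x = (\<Sum>z\<in>UNIV. \<Sum>y\<in>UNIV. cnj (v $ x) * (B y z * k x z) * v $ y)"
          by (simp add: C_def G_def sum_distrib_left mult_ac)
        also have "\<dots> = (\<Sum>y\<in>UNIV. \<Sum>z\<in>UNIV. cnj (v $ x) * (B y z * k x z) * v $ y)" by (rule sum.swap)
        finally show "cnj (v $ x) * G (C v) $ x = (\<Sum>y\<in>UNIV. cnj (v $ x) * (\<Sum>z\<in>UNIV. B y z * k x z) * v $ y)"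
          by (simp add: sum_distrib_left sum_distrib_right)
      qed
      show ?thesis unfolding 1 2 k[symmetric] lyap_def by (simp add: sum.distrib distrib_left distrib_right)
    qed
    moreover have "0 \<le> Re (\<Sum>x\<in>UNIV. \<Sum>y\<in>UNIV. cnj (v $ x) * J x y * v $ y)"
    proof -
      obtain xs :: "'x list" where xs: "set xs = UNIV" "distinct xs" using finite_distinct_list[of "UNIV :: 'x set"] by auto
      have "lin_ext \<phi> (map (\<lambda>x. (v $ x, x)) ys) = (\<Sum>y\<leftarrow>ys. \<phi> y * v $ y)" for \<phi> and ys
        by (induction ys) (auto simp: mult.commute)
      then have "sesq J (map (\<lambda>x. (v $ x, x)) zs) (map (\<lambda>x. (v $ x, x)) ys) = (\<Sum>x\<leftarrow>zs. cnj (v $ x) * (\<Sum>y\<leftarrow>ys. J x y * v $ y))" for zs ys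
        by (induction zs) auto
      then have "sesq J (map (\<lambda>x. (v $ x, x)) xs) (map (\<lambda>x. (v $ x, x)) xs) = (\<Sum>x\<in>UNIV. \<Sum>y\<in>UNIV. cnj (v $ x) * J x y * v $ y)"
        using xs by (simp add: sum_list_distinct_conv_sum_set sum_distrib_left mult.assoc)
      then show ?thesis using J unfolding psd_def complex_nonneg_Reals_iff by metis
    qed
    ultimately show ?thesis unfolding inner_complex_sum by (simp only: plus_complex.sel(1)[symmetric])
  qed
  have herm: "k y x = cnj (k x y)" for x y by (rule lyap_herm[OF B k psd_herm[OF J]])
  show ?thesis
    unfolding psd_def
  proof
    fix xs
    obtain v where v: "sesq k xs xs = (\<Sum>x\<in>UNIV. \<Sum>y\<in>UNIV. cnj (v x) * k x y * v y)" using sesq_finite by blast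
    have "cnj (sesq k xs xs) = (\<Sum>x\<in>UNIV. \<Sum>y\<in>UNIV. v x * k y x * cnj (v y))"
      unfolding v by (simp add: herm[symmetric])
    also have "\<dots> = sesq k xs xs" unfolding v by (subst sum.swap) (simp add: mult_ac)
    finally have "Im (sesq k xs xs) = 0" by (metis Reals_cnj_iff complex_is_Real_iff)
    moreover have "Re (sesq k xs xs) = (\<chi> x. v x) \<bullet> G (\<chi> x. v x)"
      by (simp add: v inner_complex_sum G_def sum_distrib_left mult.assoc)
    moreover have "0 \<le> (\<chi> x. v x) \<bullet> G (\<chi> x. v x)" by (rule lyapunov_nonneg[OF lin B(2) acc pos])
    ultimately show "sesq k xs xs \<in> \<real>\<^sub>\<ge>\<^sub>0" by (simp add: complex_nonneg_Reals_iff)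
  qed
qed

section \<open>Matrix algebras\<close>

primrec mprod :: "nat \<Rightarrow> ('x \<Rightarrow> nat \<Rightarrow> nat \<Rightarrow> complex) \<Rightarrow> 'x list \<Rightarrow> nat \<Rightarrow> nat \<Rightarrow> complex" where
  "mprod n X [] i j = of_bool (i = j)"
| "mprod n X (x # w) i j = (\<Sum>l<n. X x i l * mprod n X w l j)"

lemma mprod_append: "i < n \<Longrightarrow> mprod n X (u @ v) i j = (\<Sum>l<n. mprod n X u i l * mprod n X v l j)"
proof (induction u arbitrary: i)
  case Nil then show ?case by (simp add: sum.delta if_distrib[of "\<lambda>z. z * _"] of_bool_def cong: if_cong)
next
  case (Cons x u)
  have "mprod n X ((x # u) @ v) i j = (\<Sum>p<n. \<Sum>l<n. X x i p * mprod n X u p l * mprod n X v l j)"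
    by (simp add: Cons.IH sum_distrib_left mult.assoc)
  also have "\<dots> = (\<Sum>l<n. \<Sum>p<n. X x i p * mprod n X u p l * mprod n X v l j)" by (rule sum.swap)
  finally show ?case by (simp add: sum_distrib_right)
qed

text \<open>The letter \<open>(p, q)\<close> stands for the matrix unit with entry \<open>1\<close> in row \<open>p\<close> and column \<open>q\<close>.\<close>
definition unit_mat :: "nat \<times> nat \<Rightarrow> nat \<Rightarrow> nat \<Rightarrow> complex" where
  "unit_mat x i j = of_bool (i = fst x \<and> j = snd x)"

definition mtr :: "nat \<Rightarrow> (nat \<times> nat) list \<Rightarrow> complex" where
  "mtr n w = (\<Sum>i<n. mprod n unit_mat w i i) / of_nat n"

lemma mprod_unit_Cons: "mprod n unit_mat (x # w) i j = of_bool (i = fst x \<and> snd x < n) * mprod n unit_mat w (snd x) j"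
  by (auto simp: unit_mat_def of_bool_def if_distrib[of "\<lambda>z. z * _"] sum.delta cong: if_cong)

lemma mprod_wstar: "i < n \<Longrightarrow> j < n \<Longrightarrow> mprod n unit_mat (wstar prod.swap w) i j = cnj (mprod n unit_mat w j i)"
proof (induction w arbitrary: i j)
  case (Cons x w)
  have "mprod n unit_mat (wstar prod.swap (x # w)) i j =
     (\<Sum>l<n. mprod n unit_mat (wstar prod.swap w) i l * mprod n unit_mat [prod.swap x] l j)"
    using Cons.prems by (simp add: mprod_append del: mprod.simps)
  also have "\<dots> = (\<Sum>l<n. if l = snd x then (if fst x < n \<and> fst x = j then mprod n unit_mat (wstar prod.swap w) i l else 0) else 0)"
    by (intro sum.cong) (auto simp: mprod_unit_Cons simp del: mprod.simps(2))
  also have "\<dots> = cnj (mprod n unit_mat (x # w) j i)"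
    using Cons by (auto simp: mprod_unit_Cons sum.delta simp del: mprod.simps(2))
  finally show ?case .
qed auto

lemma psd_sum: "finite S \<Longrightarrow> (\<And>i. i \<in> S \<Longrightarrow> psd (f i)) \<Longrightarrow> psd (\<lambda>u v. \<Sum>i\<in>S. f i u v)"
  by (induction S rule: finite_induct) (auto intro: psd_add simp: psd_def[of "\<lambda>_ _. 0"] sesq_zero)

lemma moment_fun_mtr: assumes n: "0 < n" shows "moment_fun prod.swap (\<lambda>_. 1) (mtr n)"
proof -
  have star: "mtr n (wstar prod.swap u @ v) = (\<Sum>i<n. \<Sum>l<n. cnj (mprod n unit_mat u l i) * mprod n unit_mat v l i) / of_nat n" for u v
    by (simp add: mtr_def mprod_append mprod_wstar)
  have inv: "(1 / of_nat n :: complex) \<in> \<real>\<^sub>\<ge>\<^sub>0" 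
  proof -
    have "complex_of_real (1 / real n) \<in> \<real>\<^sub>\<ge>\<^sub>0" by (simp only: nonneg_Reals_of_real_iff) simp
    then show ?thesis by (simp only: of_real_divide of_real_of_nat_eq of_real_1)
  qed
  show ?thesis
    unfolding moment_fun_def
  proof (intro conjI allI)
    show "mtr n [] = 1" using n by (simp add: mtr_def)
    show "mtr n (u @ v) = mtr n (v @ u)" for u v
    proof -
      have "(\<Sum>i<n. mprod n unit_mat (u @ v) i i) = (\<Sum>i<n. \<Sum>l<n. mprod n unit_mat u i l * mprod n unit_mat v l i)" by (simp add: mprod_append)
      also have "\<dots> = (\<Sum>l<n. \<Sum>i<n. mprod n unit_mat v l i * mprod n unit_mat u i l)" by (subst sum.swap) (simp add: mult.commute)
      also have "\<dots> = (\<Sum>l<n. mprod n unit_mat (v @ u) l l)" by (simp add: mprod_append)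
      finally show ?thesis by (simp add: mtr_def)
    qed
    have "psd (\<lambda>u v. 1 / of_nat n * (\<Sum>i<n. \<Sum>l<n. cnj (mprod n unit_mat u l i) * mprod n unit_mat v l i))"
      by (intro psd_cmult psd_sum psd_rank1 inv) auto
    then show "psd (\<lambda>u v. mtr n (wstar prod.swap u @ v))" by (rule psd_cong) (simp add: star)
    show "psd (\<lambda>u v. of_real (1\<^sup>2) * mtr n (wstar prod.swap u @ v) - mtr n (wstar prod.swap (x # u) @ x # v))" for x
    proof -
      (* The matrix unit x maps the basis vector snd x to fst x and kills the others. *)
      define S where "S = (if fst x < n \<and> snd x < n then {..<n} - {snd x} else {..<n})"
      have "psd (\<lambda>u v. 1 / of_nat n * (\<Sum>i<n. \<Sum>l\<in>S. cnj (mprod n unit_mat u l i) * mprod n unit_mat v l i))"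
        by (intro psd_cmult psd_sum psd_rank1 inv) (auto simp: S_def)
      then show ?thesis
      proof (rule psd_cong)
        fix u v
        define F where "F = (\<lambda>i l. cnj (mprod n unit_mat u l i) * mprod n unit_mat v l i)"
        have "(\<Sum>l<n. cnj (mprod n unit_mat (x # u) l i) * mprod n unit_mat (x # v) l i)
            = (\<Sum>l<n. if l = fst x then (if snd x < n then F i (snd x) else 0) else 0)" for i
          by (intro sum.cong) (auto simp: mprod_unit_Cons F_def simp del: mprod.simps(2))
        then have xx: "(\<Sum>l<n. cnj (mprod n unit_mat (x # u) l i) * mprod n unit_mat (x # v) l i)
            = (if fst x < n \<and> snd x < n then F i (snd x) else 0)" for i by (simp add: sum.delta)
        have "(\<Sum>l<n. F i l) - (if fst x < n \<and> snd x < n then F i (snd x) else 0) = (\<Sum>l\<in>S. F i l)" for i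
          by (auto simp: S_def sum_diff1)
        then have "(\<Sum>i<n. \<Sum>l\<in>S. F i l) = (\<Sum>i<n. \<Sum>l<n. F i l) - (\<Sum>i<n. if fst x < n \<and> snd x < n then F i (snd x) else 0)"
          by (simp add: sum_subtractf[symmetric])
        then show "1 / of_nat n * (\<Sum>i<n. \<Sum>l\<in>S. cnj (mprod n unit_mat u l i) * mprod n unit_mat v l i)
          = of_real (1\<^sup>2) * mtr n (wstar prod.swap u @ v) - mtr n (wstar prod.swap (x # u) @ x # v)"
          unfolding star xx F_def[symmetric] by (simp add: F_def diff_divide_distrib)
      qed
    qed
  qed simp
qed

text \<open>Convexity, tested on \<open>n \<times> n\<close> matrices in the vector state of the first basis vector.\<close>
lemma convex_matrices:
  fixes V :: "'m::finite ncpoly" and X Y :: "'m \<Rightarrow> nat \<Rightarrow> nat \<Rightarrow> complex"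
  assumes U: "(UNIV :: real set) \<lesssim> (UNIV :: 'u set)" and conv: "cM_convex TYPE('u) c M V" and n: "0 < n"
    and XM: "\<And>i. (\<Sum>p<n. \<Sum>q<n. cmod (X i p q)) \<le> M" and YM: "\<And>i. (\<Sum>p<n. \<Sum>q<n. cmod (Y i p q)) \<le> M"
  shows "c * (\<Sum>i\<in>UNIV. \<Sum>q<n. (cmod (X i 0 q - Y i 0 q))\<^sup>2) \<le>
    Re (\<Sum>i\<in>UNIV. \<Sum>q<n. (word_lin (\<lambda>w. mprod n X w 0 q) (cyc_deriv i V) - word_lin (\<lambda>w. mprod n Y w 0 q) (cyc_deriv i V)) * cnj (X i 0 q - Y i 0 q))"
proof -
  note mom = moment_fun_mtr[OF n]
  interpret trace_algebra "Poly_Mapping.single []" "pstar prod.swap" "word_lin (mtr n)"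
    by (rule moment_fun_trace_algebra(1)[OF mom]) simp
  let ?tr = "word_lin (mtr n)"
  have small: "cont_small TYPE((nat \<times> nat) ncpoly)"
  proof (intro cont_small_ncpoly cont_small_prod)
    show "cont_small TYPE(nat)" "cont_small TYPE(nat)" by (auto simp: cont_small_def inj_def intro!: exI[of _ real])
  qed
  obtain A :: "'u cstar" and \<phi> \<iota> where comp: "is_completion A \<phi> \<iota>"
    using universe_inj[OF U small] completion_exists by blast
  have mono: "mono_field c M (\<lambda>i. cyc_deriv i V)" by (rule mono_field_of_convex[OF comp conv])
  define Mat where "Mat = (\<lambda>P i j. word_lin (\<lambda>w. mprod n unit_mat w i j) P)"
  have Mat_simps: "Mat (P + Q) i j = Mat P i j + Mat Q i j" "Mat (P - Q) i j = Mat P i j - Mat Q i j"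
    "Mat (Poly_Mapping.single w z) i j = z * mprod n unit_mat w i j" "Mat 0 i j = 0" for P Q w z i j
  proof -
    show add: "Mat (P + Q) i j = Mat P i j + Mat Q i j" for P Q by (simp add: Mat_def)
    show "Mat (P - Q) i j = Mat P i j - Mat Q i j" using add[of "P - Q" Q] by simp
  qed (simp_all add: Mat_def)
  have Mat_sum: "Mat (\<Sum>s\<in>S. f s) i j = (\<Sum>s\<in>S. Mat (f s) i j)" for f :: "'b \<Rightarrow> (nat \<times> nat) ncpoly" and S i j
    by (induction S rule: infinite_finite_induct) (auto simp: Mat_simps)
  have Mat_mult: "Mat (P * Q) i j = (\<Sum>l<n. Mat P i l * Mat Q l j)" if "i < n" for P Q i j
  proof (induction P rule: ncpoly_induct)
    case (add p w z)
    have "Mat (Poly_Mapping.single w z * Q) i j = (\<Sum>l<n. z * mprod n unit_mat w i l * Mat Q l j)"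
      by (induction Q rule: ncpoly_induct)
        (auto simp: Mat_simps distrib_left single_mult mprod_append[OF that] sum.distrib sum_distrib_left mult_ac)
    then show ?case using add by (simp add: distrib_right Mat_simps sum.distrib)
  qed (simp add: Mat_simps)
  have Mat_star: "Mat (pstar prod.swap P) i j = cnj (Mat P j i)" if "i < n" "j < n" for P i j
    by (induction P rule: ncpoly_induct) (auto simp: Mat_simps mprod_wstar that)
  have Mat_tr: "?tr P = (\<Sum>i<n. Mat P i i) / of_nat n" for P
    by (induction P rule: ncpoly_induct) (auto simp: Mat_simps mtr_def sum.distrib sum_distrib_left add_divide_distrib)
  have Mat_sc: "Mat (Poly_Mapping.single [] z * P) i j = z * Mat P i j" for z P i j
    by (induction P rule: ncpoly_induct) (auto simp: Mat_simps distrib_left single_mult algebra_simps)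
  define emb where "emb = (\<lambda>Z :: nat \<Rightarrow> nat \<Rightarrow> complex. \<Sum>p<n. \<Sum>q<n. Poly_Mapping.single [] (Z p q) * Poly_Mapping.single [(p, q)] 1 :: (nat \<times> nat) ncpoly)"
  have Mat_emb: "Mat (emb Z) i j = Z i j" if "i < n" "j < n" for Z i j
  proof -
    have "Mat (emb Z) i j = (\<Sum>p<n. \<Sum>q<n. Z p q * mprod n unit_mat [(p, q)] i j)" by (simp add: emb_def Mat_sum Mat_sc Mat_simps del: mprod.simps)
    also have "\<dots> = (\<Sum>p<n. if p = i then (\<Sum>q<n. if q = j then Z p q else 0) else 0)"
      by (intro sum.cong) (auto simp: mprod_unit_Cons sum.neutral simp del: mprod.simps(2) intro!: sum.cong)
    finally show ?thesis using that by (simp add: sum.delta)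
  qed
  have opn_emb: "opn (emb Z) \<le> (\<Sum>p<n. \<Sum>q<n. cmod (Z p q))" for Z
    unfolding emb_def
  proof (intro order_trans[OF opn_sum] sum_mono)
    fix p q
    have "opn (Poly_Mapping.single [(p, q)] 1) \<le> 1" by (rule moment_fun_trace_algebra(2)[OF mom]) simp
    then show "opn (Poly_Mapping.single [] (Z p q) * Poly_Mapping.single [(p, q)] 1) \<le> cmod (Z p q)"
      unfolding opn_sc by (rule mult_left_le) simp
  qed
  define XX where "XX = (\<lambda>i. emb (X i))" define YY where "YY = (\<lambda>i. emb (Y i))"
  have "opn (XX i) \<le> M \<and> opn (YY i) \<le> M" for i
    unfolding XX_def YY_def using order_trans[OF opn_emb XM] order_trans[OF opn_emb YM] by blast
  note mono' = mono[unfolded mono_field_def, rule_format, of XX YY, OF this]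
  (* The projection to the first basis vector turns the trace into its vector state, up to the factor n. *)
  define y where "y = (Poly_Mapping.single [(0, 0)] 1 :: (nat \<times> nat) ncpoly)"
  have Mat_y: "Mat y i j = of_bool (i = 0 \<and> j = 0)" for i j
    using n by (auto simp: y_def Mat_simps mprod_unit_Cons simp del: mprod.simps(2))
  have Mat_yr: "Mat (P * y) i j = of_bool (j = 0) * Mat P i 0" if "i < n" for P i j
    using n by (simp add: Mat_mult[OF that] Mat_y of_bool_def if_distrib[of "\<lambda>z. _ * z"] sum.delta cong: if_cong)
  have tr_y: "?tr (pstar prod.swap y * P * y) = Mat P 0 0 / of_nat n" for P
  proof -
    have "?tr (pstar prod.swap y * P * y) = ?tr (P * y * pstar prod.swap y)" by (simp add: tr_comm mult.assoc)
    moreover have "pstar prod.swap y = y" by (simp add: y_def)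
    moreover have "(\<Sum>i<n. Mat (P * y * y) i i) = (\<Sum>i<n. if i = 0 then Mat P 0 0 else 0)"
      using n by (intro sum.cong) (auto simp: Mat_yr)
    ultimately show ?thesis using n by (simp add: Mat_tr sum.delta)
  qed
  have Mat_ev: "Mat (ncp.ev (\<lambda>i. emb (Z i)) P) i q = word_lin (\<lambda>w. mprod n Z w i q) P" if iq: "i < n" "q < n" for Z :: "'m \<Rightarrow> nat \<Rightarrow> nat \<Rightarrow> complex" and P i q
  proof -
    have w: "Mat (prod_list (map (\<lambda>i. emb (Z i)) w)) i q = mprod n Z w i q" if "i < n" for w i
      using that
    proof (induction w arbitrary: i)
      case Nil then show ?case by (simp add: one_ncpoly Mat_simps del: ncp.sc_one)
    next
      case (Cons x w) then show ?case by (simp add: Mat_mult Mat_emb)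
    qed
    show ?thesis by (simp add: ncp.ev_def Mat_sum Mat_sc w iq word_lin_def)
  qed
  have Kr: "Mat (pstar prod.swap (XX i - YY i)) q 0 = cnj (X i 0 q - Y i 0 q)" if "q < n" for i q
    using n that by (simp add: Mat_star Mat_simps XX_def YY_def Mat_emb)
  have lhs: "(n2 (pstar prod.swap (XX i - YY i) * y))\<^sup>2 = (\<Sum>q<n. (cmod (X i 0 q - Y i 0 q))\<^sup>2) / n" for i
  proof -
    have "(n2 (pstar prod.swap (XX i - YY i) * y))\<^sup>2 = Re (?tr (pstar prod.swap y * ((XX i - YY i) * pstar prod.swap (XX i - YY i)) * y))"
      by (simp add: n2_square mult.assoc)
    moreover have "Mat ((XX i - YY i) * pstar prod.swap (XX i - YY i)) 0 0 = (\<Sum>q<n. of_real ((cmod (X i 0 q - Y i 0 q))\<^sup>2))"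
      unfolding Mat_mult[OF n]
    proof (intro sum.cong refl)
      fix q assume "q \<in> {..<n}" then have q: "q < n" by simp
      have "Mat (XX i - YY i) 0 q = X i 0 q - Y i 0 q" using n q by (simp add: Mat_simps XX_def YY_def Mat_emb)
      then show "Mat (XX i - YY i) 0 q * Mat (pstar prod.swap (XX i - YY i)) q 0 = of_real ((cmod (X i 0 q - Y i 0 q))\<^sup>2)"
        by (simp only: Kr[OF q] of_real_power cmod_square_eq)
    qed
    ultimately show ?thesis unfolding tr_y by (simp only: of_real_sum[symmetric] Re_divide_of_nat Re_complex_of_real)
  qed
  define Z where "Z = (\<lambda>i. \<Sum>q<n. (word_lin (\<lambda>w. mprod n X w 0 q) (cyc_deriv i V) - word_lin (\<lambda>w. mprod n Y w 0 q) (cyc_deriv i V)) * cnj (X i 0 q - Y i 0 q))"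
  have rhs: "?tr (pstar prod.swap y * (ncp.ev XX (cyc_deriv i V) - ncp.ev YY (cyc_deriv i V)) * pstar prod.swap (XX i - YY i) * y) = Z i / of_nat n" for i
  proof -
    have "Mat ((ncp.ev XX (cyc_deriv i V) - ncp.ev YY (cyc_deriv i V)) * pstar prod.swap (XX i - YY i)) 0 0 = Z i"
      unfolding Mat_mult[OF n] Z_def
    proof (intro sum.cong refl)
      fix q assume "q \<in> {..<n}" then have q: "q < n" by simp
      show "Mat (ncp.ev XX (cyc_deriv i V) - ncp.ev YY (cyc_deriv i V)) 0 q * Mat (pstar prod.swap (XX i - YY i)) q 0
         = (word_lin (\<lambda>w. mprod n X w 0 q) (cyc_deriv i V) - word_lin (\<lambda>w. mprod n Y w 0 q) (cyc_deriv i V)) * cnj (X i 0 q - Y i 0 q)"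
      proof -
        have "Mat (ncp.ev XX P) 0 q = word_lin (\<lambda>w. mprod n X w 0 q) P" "Mat (ncp.ev YY P) 0 q = word_lin (\<lambda>w. mprod n Y w 0 q) P" for P
          unfolding XX_def YY_def by (rule Mat_ev[OF n q])+
        then show ?thesis unfolding Kr[OF q] Mat_simps(2) by (simp only:)
      qed
    qed
    then show ?thesis using tr_y[of "(ncp.ev XX (cyc_deriv i V) - ncp.ev YY (cyc_deriv i V)) * pstar prod.swap (XX i - YY i)"] by (simp add: mult.assoc)
  qed
  have "c * ((\<Sum>i\<in>UNIV. \<Sum>q<n. (cmod (X i 0 q - Y i 0 q))\<^sup>2) / n) \<le> Re (\<Sum>i\<in>UNIV. Z i) / n"
    using mono'[of y, unfolded lhs rhs] by (simp add: sum_divide_distrib[symmetric] Re_divide_of_nat Re_sum)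
  then show ?thesis using n unfolding Z_def by (simp add: divide_le_cancel)
qed

section \<open>Convex potentials have affine gradients\<close>

definition affine_poly :: "'x ncpoly \<Rightarrow> bool" where
  "affine_poly D \<longleftrightarrow> (\<forall>u. 2 \<le> length u \<longrightarrow> Poly_Mapping.lookup D u = 0)"

text \<open>A path \<open>0 \<leftarrow> 1 \<leftarrow> \<dots> \<leftarrow> d\<close> whose edges carry the letters of \<open>u\<close> and weight \<open>s\<close>, except for the weight \<open>z\<close> of the
  second edge, together with an edge of weight \<open>t\<close> from \<open>d\<close> to \<open>0\<close> with letter \<open>i\<close>.\<close>
definition path_mat :: "'m list \<Rightarrow> 'm \<Rightarrow> complex \<Rightarrow> complex \<Rightarrow> complex \<Rightarrow> 'm \<Rightarrow> nat \<Rightarrow> nat \<Rightarrow> complex" where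
  "path_mat u i s z t l p q = (if q = Suc p \<and> p < length u \<and> l = u ! p then (if p = 1 then z else s) else 0) +
     (if p = 0 \<and> q = length u \<and> l = i then t else 0)"

lemma mprod_path_tail:
  assumes "1 \<le> p" "p \<le> length u"
  shows "mprod (Suc (length u)) (path_mat u i s z t) w p (length u) =
    (if w = drop p u then (\<Prod>r=p..<length u. if r = 1 then z else s) else 0)"
  using assms
proof (induction w arbitrary: p)
  case Nil then show ?case by auto
next
  case (Cons l w)
  let ?n = "Suc (length u)"
  have "mprod ?n (path_mat u i s z t) (l # w) p (length u) = (\<Sum>q<?n. if q = Suc p then
      (if p < length u \<and> l = u ! p then (if p = 1 then z else s) else 0) * mprod ?n (path_mat u i s z t) w (Suc p) (length u) else 0)"
    unfolding mprod.simps using Cons.prems by (intro sum.cong) (auto simp: path_mat_def)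
  also have "\<dots> = (if p < length u \<and> l = u ! p then (if p = 1 then z else s) * mprod ?n (path_mat u i s z t) w (Suc p) (length u) else 0)"
    by (simp add: sum.delta)
  also have "\<dots> = (if l # w = drop p u then (\<Prod>r=p..<length u. if r = 1 then z else s) else 0)"
  proof (cases "p < length u")
    case True
    have "drop p u = u ! p # drop (Suc p) u" using True by (simp add: Cons_nth_drop_Suc)
    then show ?thesis using True Cons.prems Cons.IH[of "Suc p"] by (auto simp: prod.atLeast_Suc_lessThan)
  qed (use Cons.prems in auto)
  finally show ?case .
qed

lemma mprod_path:
  assumes "2 \<le> length u"
  shows "mprod (Suc (length u)) (path_mat u i s z t) w 0 (length u) =
    (if w = u then s ^ (length u - 1) * z else 0) + (if w = [i] then t else 0)"
proof (cases w)
  case Nil then show ?thesis using assms by auto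
next
  case (Cons l v)
  let ?n = "Suc (length u)"
  have pr: "s * (\<Prod>r=1..<length u. if r = 1 then z else s) = s ^ (length u - 1) * z"
  proof -
    have "(\<Prod>r=1..<length u. if r = 1 then z else s) = z * (\<Prod>r=2..<length u. if r = 1 then z else s)"
      using assms by (subst prod.atLeast_Suc_lessThan) (auto simp: numeral_2_eq_2)
    also have "(\<Prod>r=2..<length u. if r = 1 then z else s) = (\<Prod>r=2..<length u. s)" by (intro prod.cong) auto
    finally have e: "(\<Prod>r=1..<length u. if r = 1 then z else s) = z * s ^ (length u - 2)" by simp
    have "length u - 1 = Suc (length u - 2)" using assms by simp
    then show ?thesis unfolding e by simp
  qed
  have u: "u = u ! 0 # drop 1 u" using assms by (cases u) auto
  have "mprod ?n (path_mat u i s z t) w 0 (length u) = (\<Sum>q<?n.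
      (if q = 1 then (if l = u ! 0 then s else 0) * mprod ?n (path_mat u i s z t) v 1 (length u) else 0) +
      (if q = length u then (if l = i then t else 0) * mprod ?n (path_mat u i s z t) v (length u) (length u) else 0))"
    unfolding Cons mprod.simps using assms by (intro sum.cong) (auto simp: path_mat_def distrib_right)
  also have "\<dots> = (if l = u ! 0 then s else 0) * mprod ?n (path_mat u i s z t) v 1 (length u)
      + (if l = i then t else 0) * mprod ?n (path_mat u i s z t) v (length u) (length u)"
    using assms by (auto simp: sum.distrib sum.delta simp del: sum.lessThan_Suc)
  also have "mprod ?n (path_mat u i s z t) v 1 (length u) = (if v = drop 1 u then (\<Prod>r=1..<length u. if r = 1 then z else s) else 0)"
    using assms by (intro mprod_path_tail) auto
  also have "mprod ?n (path_mat u i s z t) v (length u) (length u) = (if v = [] then 1 else 0)"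
    using assms by (subst mprod_path_tail) auto
  also have "(if l = u ! 0 then s else 0) * (if v = drop 1 u then (\<Prod>r=1..<length u. if r = 1 then z else s) else 0)
      = (if w = u then s ^ (length u - 1) * z else 0)"
  proof -
    have "w = u \<longleftrightarrow> l = u ! 0 \<and> v = drop 1 u" by (subst u) (simp add: Cons)
    then show ?thesis unfolding pr[symmetric] by simp
  qed
  also have "(if l = i then t else 0) * (if v = [] then 1 else 0) = (if w = [i] then t else 0)" using Cons by auto
  finally show ?thesis .
qed

lemma word_lin_if: "word_lin (\<lambda>w. if w = u then z else 0) P = Poly_Mapping.lookup P u * z"
  by (induction P rule: ncpoly_induct) (auto simp: lookup_add lookup_single when_def algebra_simps)

lemma word_lin_fun_add: "word_lin (\<lambda>w. f w + g w) P = word_lin f P + word_lin g P"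
  by (simp add: word_lin_def sum.distrib distrib_left)

text \<open>The path from \<open>d\<close> to \<open>0\<close> reads \<open>u\<close>, so that the entry \<open>(0, d)\<close> of \<open>D\<^sub>i V\<close> at the matrices of the path is the coefficient
  of \<open>u\<close> times the weights, up to the contribution of the extra edge. In row \<open>0\<close>, the difference to the matrices
  without the second and the extra edge only sees the extra edge. Hence the inequality reads
  \<open>c t\<^sup>2 \<le> t Re (g s\<^sup>d\<^sup>-\<^sup>1 z) + O(t\<^sup>2)\<close>, with \<open>g\<close> the coefficient, which is absurd for small \<open>t\<close> and \<open>z\<close> of phase opposite
  to \<open>g\<close>.\<close>
theorem convex_gradient_affine:
  fixes V :: "'m::finite ncpoly"
  assumes U: "(UNIV :: real set) \<lesssim> (UNIV :: 'u set)" and conv: "cM_convex TYPE('u) c M V" and c: "0 < c" and M: "0 < M"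
    and u: "2 \<le> length u"
  shows "Poly_Mapping.lookup (cyc_deriv i V) u = 0"
proof (rule ccontr)
  define d where "d = length u"
  define g where "g = Poly_Mapping.lookup (cyc_deriv i V) u"
  define b where "b = Re (Poly_Mapping.lookup (cyc_deriv i V) [i])"
  assume "Poly_Mapping.lookup (cyc_deriv i V) u \<noteq> 0"
  then have g: "0 < cmod g" by (simp add: g_def)
  (* There are (d + 1)^2 entries, each of size at most 2 s, so that the norms are bounded by M. *)
  define s where "s = M / (2 * (real d + 1)\<^sup>2)"
  have s: "0 < s" using M by (simp add: s_def zero_less_power)
  define z where "z = - of_real s * cnj g / of_real (cmod g)"
  have z: "cmod z = s" using g s by (simp add: z_def norm_mult norm_divide)
  have gz: "g * z = - of_real (s * cmod g)"
    using g by (simp add: z_def field_simps) (metis cmod_square_eq mult.assoc mult.commute power2_eq_square)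
  have key: "cmod g * s ^ d \<le> (b - c) * t" if t: "0 < t" "t \<le> s" for t
  proof -
    define X where "X = path_mat u i (of_real s) z (of_real t)"
    define Y where "Y = path_mat u i (of_real s) 0 0"
    have entry: "cmod (path_mat u i (of_real s) z' t' l p q) \<le> 2 * s" if "cmod z' \<le> s" "cmod t' \<le> s" for z' t' l p q
      using that s by (auto simp: path_mat_def intro!: order_trans[OF norm_triangle_ineq])
    have tot: "(\<Sum>p<Suc d. \<Sum>q<Suc d. 2 * s) \<le> M"
    proof -
      have "(\<Sum>p<Suc d. \<Sum>q<Suc d. 2 * s) = 2 * (real d + 1)\<^sup>2 * s" by (simp add: power2_eq_square algebra_simps del: sum.lessThan_Suc)
      moreover have "2 * (real d + 1)\<^sup>2 \<noteq> 0" by (simp add: add_nonneg_eq_0_iff)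
      ultimately show ?thesis by (simp add: s_def)
    qed
    have K: "X l 0 q - Y l 0 q = (if q = d \<and> l = i then of_real t else 0)" for l q
      using u by (auto simp: X_def Y_def path_mat_def d_def)
    have "c * (\<Sum>l\<in>UNIV. \<Sum>q<Suc d. (cmod (X l 0 q - Y l 0 q))\<^sup>2) \<le>
      Re (\<Sum>l\<in>UNIV. \<Sum>q<Suc d. (word_lin (\<lambda>w. mprod (Suc d) X w 0 q) (cyc_deriv l V) - word_lin (\<lambda>w. mprod (Suc d) Y w 0 q) (cyc_deriv l V)) * cnj (X l 0 q - Y l 0 q))"
    proof (rule convex_matrices[OF U conv])
      show "(\<Sum>p<Suc d. \<Sum>q<Suc d. cmod (X l p q)) \<le> M" for l
        by (rule order_trans[OF sum_mono[OF sum_mono] tot]) (use t z in \<open>simp add: X_def entry\<close>)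
      show "(\<Sum>p<Suc d. \<Sum>q<Suc d. cmod (Y l p q)) \<le> M" for l
        by (rule order_trans[OF sum_mono[OF sum_mono] tot]) (use s in \<open>auto simp: Y_def intro!: entry\<close>)
    qed simp
    also have "(\<Sum>l\<in>UNIV. \<Sum>q<Suc d. (cmod (X l 0 q - Y l 0 q))\<^sup>2) = (\<Sum>l\<in>UNIV. if l = i then (\<Sum>q<Suc d. if q = d then t\<^sup>2 else 0) else 0)"
      using t by (intro sum.cong) (auto simp: K intro!: sum.cong simp del: sum.lessThan_Suc sum.delta sum.delta')
    also have "\<dots> = t\<^sup>2" by (simp add: sum.delta del: sum.lessThan_Suc)
    also have "(\<Sum>l\<in>UNIV. \<Sum>q<Suc d. (word_lin (\<lambda>w. mprod (Suc d) X w 0 q) (cyc_deriv l V) - word_lin (\<lambda>w. mprod (Suc d) Y w 0 q) (cyc_deriv l V)) * cnj (X l 0 q - Y l 0 q))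
       = (\<Sum>l\<in>UNIV. if l = i then (\<Sum>q<Suc d. if q = d then
           (word_lin (\<lambda>w. mprod (Suc d) X w 0 d) (cyc_deriv i V) - word_lin (\<lambda>w. mprod (Suc d) Y w 0 d) (cyc_deriv i V)) * of_real t else 0) else 0)"
      by (intro sum.cong) (auto simp: K intro!: sum.cong simp del: sum.lessThan_Suc sum.delta sum.delta')
    also have "\<dots> = (word_lin (\<lambda>w. mprod (Suc d) X w 0 d) (cyc_deriv i V) - word_lin (\<lambda>w. mprod (Suc d) Y w 0 d) (cyc_deriv i V)) * of_real t"
      by (simp add: sum.delta del: sum.lessThan_Suc)
    also have "word_lin (\<lambda>w. mprod (Suc d) X w 0 d) (cyc_deriv i V) = g * (of_real s ^ (d - 1) * z) + Poly_Mapping.lookup (cyc_deriv i V) [i] * of_real t"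
      unfolding X_def d_def mprod_path[OF u] word_lin_fun_add word_lin_if g_def by (rule refl)
    also have "word_lin (\<lambda>w. mprod (Suc d) Y w 0 d) (cyc_deriv i V) = 0"
      unfolding Y_def d_def mprod_path[OF u] word_lin_fun_add word_lin_if by simp
    also have "g * (of_real s ^ (d - 1) * z) = - of_real (cmod g * s ^ d)"
    proof -
      have "s ^ d = s * s ^ (d - 1)" using u by (cases "length u") (auto simp: d_def)
      moreover have "g * (of_real s ^ (d - 1) * z) = of_real s ^ (d - 1) * (g * z)" by simp
      ultimately show ?thesis unfolding gz by simp
    qed
    finally have "c * t\<^sup>2 \<le> (b * t - cmod g * s ^ d) * t" by (simp add: b_def algebra_simps del: of_real_mult)
    then have "(cmod g * s ^ d) * t \<le> ((b - c) * t) * t" by (simp add: algebra_simps power2_eq_square)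
    then show ?thesis using t by simp
  qed
  define e where "e = cmod g * s ^ d"
  have e: "0 < e" using g s by (simp add: e_def)
  define r where "r = \<bar>b - c\<bar> + 1"
  have r: "0 < r" "b - c \<le> r" by (auto simp: r_def)
  define t where "t = min s (e / (2 * r))"
  have t: "0 < t" "t \<le> s" "t \<le> e / (2 * r)" using s e r by (auto simp: t_def)
  have "(b - c) * t \<le> r * (e / (2 * r))" using t r e by (intro mult_mono) auto
  also have "\<dots> = e / 2" using r by simp
  finally show False using key[OF t(1,2)] e unfolding e_def[symmetric] by linarith
qed

text \<open>The \<open>1 \<times> 1\<close> matrices already give this; small multiples of the given vector satisfy the norm bound.\<close>
lemma convex_gradient_accretive:
  fixes V :: "'m::finite ncpoly"
  assumes U: "(UNIV :: real set) \<lesssim> (UNIV :: 'u set)" and conv: "cM_convex TYPE('u) c M V" and c: "0 < c" and M: "0 < M"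
  shows "c * (\<Sum>i\<in>UNIV. (cmod (v i))\<^sup>2) \<le> Re (\<Sum>i\<in>UNIV. \<Sum>j\<in>UNIV. cnj (v i) * Poly_Mapping.lookup (cyc_deriv i V) [j] * v j)"
proof -
  define r where "r = M / ((\<Sum>i\<in>UNIV. cmod (v i)) + 1)"
  have sv: "cmod (v i) \<le> (\<Sum>i\<in>UNIV. cmod (v i))" for i by (rule member_le_sum) auto
  have s0: "0 \<le> (\<Sum>i\<in>UNIV. cmod (v i))" by (intro sum_nonneg) auto
  have r: "0 < r" using M s0 by (simp add: r_def)
  define X where "X = (\<lambda>i (p::nat) (q::nat). of_real r * v i)"
  define B where "B = (\<lambda>i j. Poly_Mapping.lookup (cyc_deriv i V) [j])"
  have bound: "r * cmod (v i) \<le> M" for i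
  proof -
    have "r * cmod (v i) \<le> r * ((\<Sum>i\<in>UNIV. cmod (v i)) + 1)" using sv[of i] r by (intro mult_left_mono) auto
    then show ?thesis using s0 by (simp add: r_def)
  qed
  have A: "c * (\<Sum>i\<in>UNIV. \<Sum>q<1. (cmod (X i 0 q - 0))\<^sup>2) \<le>
    Re (\<Sum>i\<in>UNIV. \<Sum>q<1. (word_lin (\<lambda>w. mprod 1 X w 0 q) (cyc_deriv i V) - word_lin (\<lambda>w. mprod 1 (\<lambda>_ _ _. 0) w 0 q) (cyc_deriv i V)) * cnj (X i 0 q - 0))"
    by (rule convex_matrices[OF U conv]) (use M bound r in \<open>auto simp: X_def norm_mult\<close>)
  have E: "word_lin (\<lambda>w. mprod 1 X w 0 0) (cyc_deriv i V) - word_lin (\<lambda>w. mprod 1 (\<lambda>_ _ _. 0) w 0 0) (cyc_deriv i V) = of_real r * (\<Sum>j\<in>UNIV. B i j * v j)" for i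
  proof -
    define f where "f = (\<lambda>w. mprod 1 X w 0 0 - mprod 1 (\<lambda>_ _ _. 0) w 0 0)"
    have "word_lin (\<lambda>w. mprod 1 X w 0 0) (cyc_deriv i V) - word_lin (\<lambda>w. mprod 1 (\<lambda>_ _ _. 0) w 0 0) (cyc_deriv i V) = word_lin f (cyc_deriv i V)"
      by (simp add: word_lin_def f_def right_diff_distrib sum_subtractf)
    also have "\<dots> = word_lin (\<lambda>w. \<Sum>j\<in>UNIV. if w = [j] then of_real r * v j else 0) (cyc_deriv i V)"
      unfolding word_lin_def
    proof (intro sum.cong refl)
      fix w assume "w \<in> Poly_Mapping.keys (cyc_deriv i V)"
      then have "\<not> 2 \<le> length w" using convex_gradient_affine[OF U conv c M, of w i] by (auto simp: in_keys_iff)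
      then consider "w = []" | l where "w = [l]" by (cases w; cases "tl w") auto
      then show "Poly_Mapping.lookup (cyc_deriv i V) w * f w = Poly_Mapping.lookup (cyc_deriv i V) w * (\<Sum>j\<in>UNIV. if w = [j] then of_real r * v j else 0)"
        by cases (auto simp: f_def X_def sum.delta)
    qed
    also have "\<dots> = (\<Sum>j\<in>UNIV. word_lin (\<lambda>w. if w = [j] then of_real r * v j else 0) (cyc_deriv i V))"
      unfolding word_lin_def sum_distrib_left by (rule sum.swap)
    finally show ?thesis unfolding word_lin_if by (simp add: B_def sum_distrib_left mult_ac)
  qed
  have one: "(\<Sum>q<1. f q) = f 0" for f :: "nat \<Rightarrow> 'z::comm_monoid_add" by simp
  have "c * (\<Sum>i\<in>UNIV. (r * cmod (v i))\<^sup>2) \<le> Re (\<Sum>i\<in>UNIV. of_real r * (\<Sum>j\<in>UNIV. B i j * v j) * cnj (of_real r * v i))"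
    using A[unfolded one E] by (simp only: X_def diff_0_right norm_mult norm_of_real abs_of_pos[OF r])
  also have "(\<Sum>i\<in>UNIV. of_real r * (\<Sum>j\<in>UNIV. B i j * v j) * cnj (of_real r * v i)) = of_real (r\<^sup>2) * (\<Sum>i\<in>UNIV. \<Sum>j\<in>UNIV. cnj (v i) * B i j * v j)"
    by (simp add: sum_distrib_left power2_eq_square mult_ac)
  also have "Re \<dots> = r\<^sup>2 * Re (\<Sum>i\<in>UNIV. \<Sum>j\<in>UNIV. cnj (v i) * B i j * v j)"
    unfolding times_complex.sel Re_complex_of_real Im_complex_of_real by simp
  also have "c * (\<Sum>i\<in>UNIV. (r * cmod (v i))\<^sup>2) = r\<^sup>2 * (c * (\<Sum>i\<in>UNIV. (cmod (v i))\<^sup>2))"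
    by (simp add: power_mult_distrib sum_distrib_left mult_ac)
  finally show ?thesis using r by (simp add: B_def mult_le_cancel_left)
qed

section \<open>Semicircular families\<close>

text \<open>A family with means \<open>a x\<close> and covariances \<open>\<lambda>x y. k (iv x) y\<close>, whose letter \<open>iv x\<close> is the adjoint of the letter \<open>x\<close>;
  \<open>k\<close> is the inner product of the centred letters. A word is a basis vector of the full Fock space, namely the tensor
  product of its letters.\<close>
locale semicircular_family =
  fixes iv :: "'x \<Rightarrow> 'x" and k :: "'x \<Rightarrow> 'x \<Rightarrow> complex" and a :: "'x \<Rightarrow> complex"
  assumes iv_iv: "iv (iv x) = x" and k_psd: "psd k" and k_swap: "k (iv x) y = k (iv y) x"
    and a_iv: "a (iv x) = cnj (a x)"
begin

fun K :: "'x list \<Rightarrow> 'x list \<Rightarrow> complex" where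
  "K [] [] = 1"
| "K (x # u) (y # v) = k x y * K u v"
| "K [] (y # v) = 0"
| "K (x # u) [] = 0"

text \<open>The kernel \<open>K\<close> on words shorter than \<open>n\<close>, built by operations which preserve positivity.\<close>
primrec Kn :: "nat \<Rightarrow> 'x list \<Rightarrow> 'x list \<Rightarrow> complex" where
  "Kn 0 u v = 0"
| "Kn (Suc n) u v = cnj (of_bool (u = [])) * of_bool (v = []) +
     cnj (of_bool (u \<noteq> [])) * of_bool (v \<noteq> []) * (k (hd u) (hd v) * Kn n (tl u) (tl v))"

lemma k_herm: "k x y = cnj (k y x)" by (rule psd_herm[OF k_psd])

lemma psd_zero: "psd (\<lambda>u v. 0)" by (simp add: psd_def sesq_zero)

lemma psd_Kn: "psd (Kn n)"
proof (induction n)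
  case 0 show ?case by (simp add: psd_zero)
next
  case (Suc n)
  have "psd (\<lambda>u v. Kn (Suc n) u v)" unfolding Kn.simps
    by (intro psd_mult psd_add psd_rank1 psd_scale psd_pull[OF k_psd] psd_pull[OF Suc])
  then show ?case by simp
qed

lemma K_eq_Kn: "length u < n \<Longrightarrow> K u v = Kn n u v"
proof (induction u v arbitrary: n rule: K.induct)
  case (2 x u y v) then show ?case by (cases n) auto
next
  case (4 x u) then show ?case by (cases n) auto
qed (auto simp: less_Suc_eq_0_disj dest!: gr0_implies_Suc)

lemma psd_K: "psd K"
proof (rule psd_limit[of Kn])
  show "(\<lambda>n. Kn n u v) \<longlonglongrightarrow> K u v" for u v
  proof (intro tendsto_eventually eventually_sequentiallyI[of "Suc (length u)"])
    show "Kn n u v = K u v" if "Suc (length u) \<le> n" for n using K_eq_Kn[of u n v] that by simp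
  qed
qed (rule psd_Kn)

text \<open>A letter acts as the sum of a scalar, a creation and an annihilation operator; \<open>appr\<close> is the action from the
  right. The operators act on functions of the basis by transposition, so that words act in reading order and no
  quotient by null vectors is needed.\<close>
definition ann :: "'x \<Rightarrow> 'x list \<Rightarrow> (complex \<times> 'x list) list" where
  "ann x b = (case b of [] \<Rightarrow> [] | y # b' \<Rightarrow> [(k (iv x) y, b')])"
definition app :: "'x \<Rightarrow> 'x list \<Rightarrow> (complex \<times> 'x list) list" where
  "app x b = [(a x, b)] @ [(1, x # b)] @ ann x b"
definition appr :: "'x \<Rightarrow> 'x list \<Rightarrow> (complex \<times> 'x list) list" where
  "appr x b = [(a x, b), (1, b @ [x])] @ (if b = [] then [] else [(k (iv x) (last b), butlast b)])"

definition T :: "'x \<Rightarrow> ('x list \<Rightarrow> complex) \<Rightarrow> 'x list \<Rightarrow> complex" where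
  "T x \<phi> b = lin_ext \<phi> (app x b)"
definition TR :: "'x \<Rightarrow> ('x list \<Rightarrow> complex) \<Rightarrow> 'x list \<Rightarrow> complex" where
  "TR x \<phi> b = lin_ext \<phi> (appr x b)"
definition Rc :: "'x \<Rightarrow> ('x list \<Rightarrow> complex) \<Rightarrow> 'x list \<Rightarrow> complex" where
  "Rc g \<phi> b = \<phi> (b @ [g])"
definition E :: "'x list \<Rightarrow> complex" where "E b = (if b = [] then 1 else 0)"
definition tau :: "'x list \<Rightarrow> complex" where "tau w = fold T w E []"

lemma T_simps: "T x \<phi> [] = a x * \<phi> [] + \<phi> [x]" "T x \<phi> (y # b) = a x * \<phi> (y # b) + \<phi> (x # y # b) + k (iv x) y * \<phi> b"
  by (auto simp: T_def app_def ann_def)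

lemma T_comm_TR: "T x (TR y \<phi>) = TR y (T x \<phi>)"
proof
  fix b :: "'x list"
  have s: "k (iv y) x = k (iv x) y" by (rule k_swap)
  consider "b = []" | g where "b = [g]" | g p ps where "b = g # p # ps" by (metis list.exhaust)
  then show "T x (TR y \<phi>) b = TR y (T x \<phi>) b"
    by cases (auto simp: T_simps TR_def appr_def s algebra_simps)
qed

lemma fold_T_comm_TR: "fold T w (TR y \<phi>) = TR y (fold T w \<phi>)"
  by (induction w arbitrary: \<phi>) (auto simp: T_comm_TR)

lemma T_E: "T x E = TR x E"
proof
  fix b :: "'x list"
  consider "b = []" | g where "b = [g]" | g p ps where "b = g # p # ps" by (metis list.exhaust)
  then show "T x E b = TR x E b" by cases (auto simp: T_simps TR_def appr_def E_def)
qed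

lemma TR_vac: "TR x \<phi> [] = T x \<phi> []" by (auto simp: T_simps TR_def appr_def)

text \<open>Left and right multiplication agree on the vacuum, also after pairing with the vacuum, and commute with
  each other: this is the trace property.\<close>
lemma tau_rotate: "tau (x # w) = tau (w @ [x])"
  by (simp add: tau_def T_E fold_T_comm_TR TR_vac)

lemma tau_comm: "tau (u @ v) = tau (v @ u)"
proof (induction u arbitrary: v)
  case (Cons x u) show ?case using tau_rotate[of x "u @ v"] Cons[of "v @ [x]"] by simp
qed simp

lemma tau_Nil [simp]: "tau [] = 1" by (simp add: tau_def E_def)

lemma T_linear: "T x (\<lambda>b. \<phi> b + \<psi> b) = (\<lambda>b. T x \<phi> b + T x \<psi> b)"
  "T x (\<lambda>b. c * \<phi> b) = (\<lambda>b. c * T x \<phi> b)" "T x (\<lambda>b. 0) = (\<lambda>b. 0)"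
  by (auto simp: T_def fun_eq_iff lin_ext_add lin_ext_cmult lin_ext_zero)

lemma fold_T_linear: "fold T w (\<lambda>b. \<phi> b + \<psi> b) = (\<lambda>b. fold T w \<phi> b + fold T w \<psi> b)"
  "fold T w (\<lambda>b. c * \<phi> b) = (\<lambda>b. c * fold T w \<phi> b)" "fold T w (\<lambda>b. 0) = (\<lambda>b. 0)"
  by (induction w arbitrary: \<phi> \<psi>) (auto simp: T_linear)

text \<open>Removing a letter at the far end commutes with the operators up to a rank one term, which splits a word
  in two.\<close>
lemma Rc_T: "Rc g (T x \<phi>) = (\<lambda>b. T x (Rc g \<phi>) b + k (iv x) g * \<phi> [] * E b)"
proof
  fix b show "Rc g (T x \<phi>) b = T x (Rc g \<phi>) b + k (iv x) g * \<phi> [] * E b"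
    by (cases b) (auto simp: Rc_def T_simps E_def)
qed

lemma Rc_fold: "Rc g (fold T w \<phi>) [] = fold T w (Rc g \<phi>) [] +
   (\<Sum>l<length w. k (iv (w ! l)) g * fold T (take l w) \<phi> [] * tau (drop (Suc l) w))"
proof (induction w arbitrary: \<phi>)
  case (Cons x w)
  have "Rc g (fold T (x # w) \<phi>) [] = fold T w (Rc g (T x \<phi>)) [] +
     (\<Sum>l<length w. k (iv (w ! l)) g * fold T (take l w) (T x \<phi>) [] * tau (drop (Suc l) w))"
    by (simp add: Cons)
  also have "fold T w (Rc g (T x \<phi>)) [] = fold T w (T x (Rc g \<phi>)) [] + k (iv x) g * \<phi> [] * tau w"
    by (simp add: Rc_T fold_T_linear tau_def)
  finally show ?case by (simp add: sum.lessThan_Suc_shift del: sum.lessThan_Suc)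
qed simp

text \<open>The Schwinger-Dyson equation of a semicircular family with covariance \<open>\<lambda>x y. k (iv x) y\<close> and means \<open>a\<close>.\<close>
lemma tau_Cons: "tau (g # w) = a g * tau w +
   (\<Sum>l<length w. k (iv (w ! l)) g * tau (take l w) * tau (drop (Suc l) w))"
proof -
  have "tau (w @ [g]) = a g * tau w + Rc g (fold T w E) []" by (simp add: tau_def T_simps Rc_def)
  moreover have "Rc g E = (\<lambda>_. 0)" by (auto simp: Rc_def E_def)
  ultimately have "tau (w @ [g]) = a g * tau w + (\<Sum>l<length w. k (iv (w ! l)) g * tau (take l w) * tau (drop (Suc l) w))"
    by (simp add: Rc_fold fold_T_linear tau_def)
  then show ?thesis using tau_rotate[of g w] by simp
qed

lemma K_vac: "K [] = E"
proof
  fix b show "K [] b = E b" by (cases b) (auto simp: E_def)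
qed

lemma K_herm: "K u v = cnj (K v u)" by (rule psd_herm[OF psd_K])

text \<open>The letter \<open>iv x\<close> acts as the adjoint of the letter \<open>x\<close>.\<close>
lemma T_K: "T (iv x) (K b) b' = cnj (lin_ext (K b') (app x b))"
  by (cases b; cases b') (auto simp: T_simps app_def ann_def iv_iv a_iv simp flip: K_herm k_herm)

primrec vec :: "'x list \<Rightarrow> (complex \<times> 'x list) list" where
  "vec [] = [(1, [])]"
| "vec (x # w) = bind_list (vec w) (app x)"

lemma lin_ext_vec: "lin_ext \<phi> (vec w) = fold T w \<phi> []"
  by (induction w arbitrary: \<phi>) (auto simp: lin_ext_bind T_def[abs_def])

lemma lin_ext_K: "lin_ext (\<lambda>b. cnj (lin_ext (K b) us)) ys = sesq K us ys"
proof -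
  have "cnj (lin_ext (K b) us) = sesq K us [(1, b)]" for b
    by (induction us) (auto simp: K_herm[of b])
  moreover have "lin_ext (\<lambda>b. sesq K us [(1, b)]) ys = sesq K us ys"
    by (induction ys) (auto simp: sesq_right sesq_Cons_right algebra_simps)
  ultimately show ?thesis by simp
qed

lemma fold_T_wstar: "fold T (wstar iv u) (K []) b = cnj (lin_ext (K b) (vec u))"
proof (induction u arbitrary: b)
  case Nil show ?case using K_herm[of b "[]"] by simp
next
  case (Cons x u)
  have "fold T (wstar iv u) (K []) = (\<lambda>b. cnj (lin_ext (K b) (vec u)))" using Cons by auto
  then have "fold T (wstar iv (x # u)) (K []) b = sesq K (vec u) (app (iv x) b)"
    by (simp add: T_def lin_ext_K)
  also have "\<dots> = cnj (lin_ext (K b) (bind_list (vec u) (app x)))"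
  proof -
    have "sesq K us (app (iv x) b) = cnj (lin_ext (\<lambda>c. lin_ext (K b) (app x c)) us)" for us
      using T_K[of x _ b] by (induction us) (auto simp: T_def)
    then show ?thesis by (simp add: lin_ext_bind)
  qed
  finally show ?case by simp
qed

lemma tau_star: "tau (wstar iv u @ w) = sesq K (vec u) (vec w)"
proof -
  have "tau (wstar iv u @ w) = lin_ext (fold T (wstar iv u) (K [])) (vec w)"
    by (simp add: tau_def lin_ext_vec K_vac)
  also have "fold T (wstar iv u) (K []) = (\<lambda>b. cnj (lin_ext (K b) (vec u)))"
    by (rule ext) (rule fold_T_wstar)
  finally show ?thesis by (simp only: lin_ext_K)
qed

text \<open>Annihilation is bounded: pairing with a vector is a contraction up to its norm, by Cauchy-Schwarz.\<close>
lemma psd_ann: "psd (\<lambda>u v. k (iv x) (iv x) * K u v - sesq K (ann x u) (ann x v))"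
proof -
  define g where "g = iv x"
  have kgg: "k g g \<in> \<real>\<^sub>\<ge>\<^sub>0" using psd_diag[OF k_psd, of g] .
  define A where "A = (\<lambda>y y'. k g g * k y y' - cnj (k g y) * k g y')"
  have psdA: "psd A"
  proof (cases "k g g = 0")
    case True
    then have "k g y = 0" for y using psd_null[OF k_psd, of g y] by simp
    then show ?thesis by (simp add: A_def True psd_zero)
  next
    case False
    have "psd (\<lambda>y y'. k g g * (k y y' - k y g * k g y' / k g g))"
      using psd_cmult[OF psd_schur_complement[OF k_psd, of g] kgg] .
    moreover have "k g g * (k y y' - k y g * k g y' / k g g) = A y y'" for y y'
      using False by (simp add: A_def k_herm[of y g] field_simps)
    ultimately show ?thesis by simp
  qed
  have "psd (\<lambda>u v. k g g * (cnj (of_bool (u = [])) * of_bool (v = []))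
     + cnj (of_bool (u \<noteq> [])) * of_bool (v \<noteq> []) * (A (hd u) (hd v) * K (tl u) (tl v)))"
    using kgg by (intro psd_add psd_scale psd_cmult psd_rank1 psd_mult psd_pull[OF psdA] psd_pull[OF psd_K])
  moreover have "k g g * (cnj (of_bool (u = [])) * of_bool (v = []))
     + cnj (of_bool (u \<noteq> [])) * of_bool (v \<noteq> []) * (A (hd u) (hd v) * K (tl u) (tl v)) = k g g * K u v - sesq K (ann x u) (ann x v)" for u v
    by (cases u; cases v) (auto simp: ann_def A_def algebra_simps simp flip: g_def)
  ultimately show ?thesis by (simp add: g_def)
qed

definition R :: "'x \<Rightarrow> real" where
  "R x = sqrt (3 * ((cmod (a x))\<^sup>2 + Re (k x x) + Re (k (iv x) (iv x))))"

lemma k_diag: "0 \<le> Re (k x x)" "k x x = of_real (Re (k x x))"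
  using psd_diag[OF k_psd, of x] by (auto simp: complex_nonneg_Reals_iff complex_eq_iff)

text \<open>The parallelogram identity \<open>3 (|p|\<^sup>2 + |q|\<^sup>2 + |r|\<^sup>2) - |p + q + r|\<^sup>2 = |p - q|\<^sup>2 + |q - r|\<^sup>2 + |p - r|\<^sup>2\<close> for the three
  parts of the operator.\<close>
lemma psd_app: "psd (\<lambda>u v. of_real ((R x)\<^sup>2) * K u v - sesq K (app x u) (app x v))"
proof -
  define neg where "neg = (\<lambda>xs :: (complex \<times> 'x list) list. map (\<lambda>(d, b'). (- 1 * d, b')) xs)"
  define p where "p = (\<lambda>u :: 'x list. [(a x, u)])"
  define q where "q = (\<lambda>u. [(1 :: complex, x # u)])"
  have "psd (\<lambda>u v. 3 * (k (iv x) (iv x) * K u v - sesq K (ann x u) (ann x v)) +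
     (sesq K (p u @ neg (q u)) (p v @ neg (q v)) + sesq K (q u @ neg (ann x u)) (q v @ neg (ann x v)) +
      sesq K (p u @ neg (ann x u)) (p v @ neg (ann x v))))"
    by (intro psd_add psd_cmult psd_ann psd_bind[OF psd_K]) (simp add: complex_nonneg_Reals_iff)
  moreover have "3 * (k (iv x) (iv x) * K u v - sesq K (ann x u) (ann x v)) +
     (sesq K (p u @ neg (q u)) (p v @ neg (q v)) + sesq K (q u @ neg (ann x u)) (q v @ neg (ann x v)) +
      sesq K (p u @ neg (ann x u)) (p v @ neg (ann x v))) =
     of_real ((R x)\<^sup>2) * K u v - sesq K (app x u) (app x v)" for u v
  proof -
    have pp: "sesq K (p u) (p v) = of_real ((cmod (a x))\<^sup>2) * K u v"
      by (simp add: p_def cmod_square_eq mult.commute)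
    have qq: "sesq K (q u) (q v) = k x x * K u v" by (simp add: q_def)
    have "(R x)\<^sup>2 = 3 * ((cmod (a x))\<^sup>2 + Re (k x x) + Re (k (iv x) (iv x)))"
      using k_diag(1)[of x] k_diag(1)[of "iv x"] by (simp add: R_def)
    then have R2: "of_real ((R x)\<^sup>2) = 3 * (of_real ((cmod (a x))\<^sup>2) + k x x + k (iv x) (iv x))"
      by (simp flip: k_diag(2))
    have app: "app x w = p w @ q w @ ann x w" for w by (simp add: app_def p_def q_def)
    show ?thesis unfolding R2 app neg_def sesq_simps(3) sesq_right sesq_scale pp qq
      by (simp only: complex_cnj_minus complex_cnj_one) (simp add: algebra_simps)
  qed
  ultimately show ?thesis by (rule psd_cong)
qed

text \<open>Positivity holds since \<open>tau (wstar iv u @ v)\<close> is the inner product of the vectors which \<open>u\<close> and \<open>v\<close> create from the vacuum.\<close>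
theorem moment_fun_tau: "moment_fun iv R tau"
  unfolding moment_fun_def
proof (intro conjI allI tau_Nil)
  show "tau (u @ v) = tau (v @ u)" for u v by (rule tau_comm)
  show "psd (\<lambda>u v. tau (wstar iv u @ v))" unfolding tau_star by (rule psd_bind[OF psd_K])
  show "0 \<le> R x" for x using k_diag(1)[of x] k_diag(1)[of "iv x"] by (simp add: R_def)
  from psd_bind[OF psd_app, of _ vec]
  show "psd (\<lambda>u v. of_real ((R x)\<^sup>2) * tau (wstar iv u @ v) - tau (wstar iv (x # u) @ (x # v)))" for x
    unfolding tau_star sesq_diff sesq_cmult vec.simps sesq_bind by simp
qed

end

section \<open>Moments\<close>

text \<open>The variables are the letters, in the completion of the algebra of polynomials.\<close>
lemma moment_fun_realized:
  fixes m :: "'x list \<Rightarrow> complex"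
  assumes U: "(UNIV :: real set) \<lesssim> (UNIV :: 'u set)" and small: "cont_small TYPE('x)"
    and m: "moment_fun iv R m" and iv: "\<And>x. iv (iv x) = x"
  shows "\<exists>(A :: 'u cstar) \<phi> X. tracial_cstar_space A \<phi> \<and> (\<forall>x. X x \<in> carrier A \<and> adj A (X x) = X (iv x)) \<and>
     (\<forall>P. \<phi> (eval_poly A X P) = word_lin m P)"
proof -
  interpret trace_algebra "Poly_Mapping.single []" "pstar iv" "word_lin m"
    by (rule moment_fun_trace_algebra(1)[OF m iv])
  obtain A :: "'u cstar" and \<phi> \<iota> where comp: "is_completion A \<phi> \<iota>"
    using universe_inj[OF U cont_small_ncpoly[OF small]] completion_exists by blast
  interpret A: tracial_cstar_space A \<phi> by (rule comp_space[OF comp])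
  define X where "X = (\<lambda>x. \<iota> (Poly_Mapping.single [x] 1))"
  have w: "prod_list (map (\<lambda>x. Poly_Mapping.single [x] 1) w) = (Poly_Mapping.single w 1 :: 'x ncpoly)" for w
    by (induction w) (auto simp: one_ncpoly single_mult simp del: ncp.sc_one)
  have ev: "ncp.ev (\<lambda>x. Poly_Mapping.single [x] 1) P = P" for P :: "'x ncpoly"
    unfolding ncp.ev_def w using poly_mapping_sum_single[of P] by (simp add: single_mult)
  have "\<phi> (eval_poly A X P) = word_lin m P" for P
    unfolding X_def io_ev[OF comp] ev io_tr[OF comp] by (rule refl)
  moreover have "X x \<in> carrier A \<and> adj A (X x) = X (iv x)" for x
    using io_closed[OF comp] io_st[OF comp, of "Poly_Mapping.single [x] 1"] by (simp add: X_def)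
  ultimately show ?thesis using A.tracial_cstar_space_axioms by blast
qed

lemma is_law_moments:
  assumes "is_law TYPE('u) (\<mu> :: 'm var ncpoly \<Rightarrow> complex)"
  shows "\<exists>m. \<mu> = word_lin m \<and> m [] = 1 \<and> (\<forall>u v. m (u @ v) = m (v @ u))"
proof -
  obtain A :: "'u cstar" and \<phi> X where A: "tracial_cstar_space A \<phi>" and X: "\<And>i. X i \<in> carrier A"
    and \<mu>: "\<And>P. \<mu> P = \<phi> (eval_poly A (with_adj A X) P)"
    using assms unfolding is_law_def by auto
  interpret tracial_cstar_space A \<phi> by (rule A)
  have wc: "with_adj A X x \<in> carrier A" for x by (cases x) (auto simp: X adj_closed)
  define W where "W = (\<lambda>w. word_prod A (map (with_adj A X) w))"
  have Wc: "W w \<in> carrier A" for w unfolding W_def by (rule word_prod_closed) (auto simp: wc)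
  have "W (u @ v) = W u \<otimes>\<^bsub>A\<^esub> W v" for u v unfolding W_def map_append by (rule word_prod_append) (auto simp: wc)
  then have "\<phi> (W (u @ v)) = \<phi> (W (v @ u))" for u v using Wc by (simp add: state_tracial)
  moreover have "\<mu> P = word_lin (\<lambda>w. \<phi> (W w)) P" for P unfolding \<mu> W_def by (rule state_eval_poly) (rule wc)
  then have "\<mu> = word_lin (\<lambda>w. \<phi> (W w))" by (rule ext)
  moreover have "\<phi> (W []) = 1" by (simp add: W_def state_one)
  ultimately show ?thesis by (intro exI[of _ "\<lambda>w. \<phi> (W w)"]) auto
qed

lemma is_sa_law_moments:
  assumes "is_sa_law TYPE('u) (\<mu> :: 'm ncpoly \<Rightarrow> complex)"
  shows "\<exists>m. \<mu> = word_lin m \<and> m [] = 1"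
proof -
  obtain A :: "'u cstar" and \<phi> X where A: "tracial_cstar_space A \<phi>" and X: "\<And>i. X i \<in> carrier A"
    and \<mu>: "\<And>P. \<mu> P = \<phi> (eval_poly A X P)"
    using assms unfolding is_sa_law_def by auto
  interpret tracial_cstar_space A \<phi> by (rule A)
  have "\<mu> P = word_lin (\<lambda>w. \<phi> (word_prod A (map X w))) P" for P unfolding \<mu> by (rule state_eval_poly) (rule X)
  then have "\<mu> = word_lin (\<lambda>w. \<phi> (word_prod A (map X w)))" by (rule ext)
  then show ?thesis by (intro exI[of _ "\<lambda>w. \<phi> (word_prod A (map X w))"]) (simp add: state_one)
qed

section \<open>Derivatives on words\<close>

lemma sum_positions_add:
  fixes f :: "'b list \<Rightarrow> nat \<Rightarrow> complex \<Rightarrow> 'v::comm_monoid_add"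
  assumes "\<And>w k. f w k 0 = 0" "\<And>w k c d. f w k (c + d) = f w k c + f w k d"
  shows "(\<Sum>w\<in>Poly_Mapping.keys (P + Q). \<Sum>k | k < length w \<and> w ! k = x. f w k (Poly_Mapping.lookup (P + Q) w)) =
     (\<Sum>w\<in>Poly_Mapping.keys P. \<Sum>k | k < length w \<and> w ! k = x. f w k (Poly_Mapping.lookup P w)) +
     (\<Sum>w\<in>Poly_Mapping.keys Q. \<Sum>k | k < length w \<and> w ! k = x. f w k (Poly_Mapping.lookup Q w))"
  by (rule sum_keys_add[where f = "\<lambda>w c. \<Sum>k | k < length w \<and> w ! k = x. f w k c"]) (auto simp: assms sum.distrib)

lemma free_diff_add: "free_diff x (P + Q) = free_diff x P + free_diff x Q"
  unfolding free_diff_def by (rule sum_positions_add) (auto simp: single_add)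
lemma cyc_deriv_add: "cyc_deriv x (P + Q) = cyc_deriv x P + cyc_deriv x Q"
  unfolding cyc_deriv_def by (rule sum_positions_add) (auto simp: single_add)
lemma free_diff_0 [simp]: "free_diff x 0 = 0" by (simp add: free_diff_def)
lemma cyc_deriv_0 [simp]: "cyc_deriv x 0 = 0" by (simp add: cyc_deriv_def)
lemma free_diff_sum: "free_diff x (\<Sum>i\<in>I. f i) = (\<Sum>i\<in>I. free_diff x (f i))"
  by (induction I rule: infinite_finite_induct) (auto simp: free_diff_add)

text \<open>The rest of the cyclic word \<open>w\<close> after its letter at position \<open>k\<close>.\<close>
definition rotate_out :: "nat \<Rightarrow> 'x list \<Rightarrow> 'x list" where
  "rotate_out k w = drop (Suc k) w @ take k w"

lemma length_rotate_out: "k < length w \<Longrightarrow> length (rotate_out k w) = length w - 1"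
  by (simp add: rotate_out_def)

lemma free_diff_single: "free_diff x (Poly_Mapping.single w c) =
   (\<Sum>k<length w. if w ! k = x then Poly_Mapping.single (take k w, drop (Suc k) w) c else 0)"
proof -
  have "free_diff x (Poly_Mapping.single w c) = (\<Sum>k | k < length w \<and> w ! k = x. Poly_Mapping.single (take k w, drop (Suc k) w) c)"
    unfolding free_diff_def
    by (rule sum_keys_single[where f = "\<lambda>w c. \<Sum>k | k < length w \<and> w ! k = x. Poly_Mapping.single (take k w, drop (Suc k) w) c"]) simp
  then show ?thesis by (simp add: sum.inter_filter[symmetric] lessThan_def)
qed

lemma cyc_deriv_single: "cyc_deriv x (Poly_Mapping.single w c) =
   (\<Sum>k<length w. if w ! k = x then Poly_Mapping.single (rotate_out k w) c else 0)"
proof -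
  have "cyc_deriv x (Poly_Mapping.single w c) = (\<Sum>k | k < length w \<and> w ! k = x. Poly_Mapping.single (rotate_out k w) c)"
    unfolding cyc_deriv_def rotate_out_def
    by (rule sum_keys_single[where f = "\<lambda>w c. \<Sum>k | k < length w \<and> w ! k = x. Poly_Mapping.single (drop (Suc k) w @ take k w) c"]) simp
  then show ?thesis by (simp add: sum.inter_filter[symmetric] lessThan_def)
qed

lemma cyc_deriv_coeffs:
  "Poly_Mapping.lookup (cyc_deriv i V) [] = Poly_Mapping.lookup V [i]"
  "Poly_Mapping.lookup (cyc_deriv i V) [j] = Poly_Mapping.lookup V [i, j] + Poly_Mapping.lookup V [j, i]"
proof -
  have s: "Poly_Mapping.lookup (cyc_deriv i (Poly_Mapping.single w c)) v =
      (\<Sum>k<length w. if w ! k = i \<and> rotate_out k w = v then c else 0)" for w v c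
    unfolding cyc_deriv_single lookup_sum by (intro sum.cong) (auto simp: lookup_single when_def)
  have long: "Poly_Mapping.lookup (cyc_deriv i (Poly_Mapping.single w c)) v = 0" if "length w \<noteq> Suc (length v)" for w v c
    unfolding s by (intro sum.neutral ballI) (use that in \<open>auto simp: length_rotate_out\<close>)
  have 1: "Poly_Mapping.lookup (cyc_deriv i (Poly_Mapping.single w c)) [] = Poly_Mapping.lookup (Poly_Mapping.single w c) [i]" for w c
  proof (cases "length w = 1")
    case True
    then obtain a where "w = [a]" by (cases w) auto
    then show ?thesis unfolding s by (simp add: rotate_out_def lookup_single)
  next
    case False
    then have "Poly_Mapping.lookup (cyc_deriv i (Poly_Mapping.single w c)) [] = 0" by (intro long) simp
    moreover have "w \<noteq> [i]" using False by auto
    ultimately show ?thesis by (simp add: lookup_single_not_eq)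
  qed
  have 2: "Poly_Mapping.lookup (cyc_deriv i (Poly_Mapping.single w c)) [j] =
     Poly_Mapping.lookup (Poly_Mapping.single w c) [i, j] + Poly_Mapping.lookup (Poly_Mapping.single w c) [j, i]" for w c
  proof (cases "length w = 2")
    case True
    then obtain a d where "w = [a, d]" by (cases w; cases "tl w") auto
    then show ?thesis unfolding s by (auto simp: rotate_out_def lookup_single when_def numeral_2_eq_2)
  next
    case False
    then have "Poly_Mapping.lookup (cyc_deriv i (Poly_Mapping.single w c)) [j] = 0" by (intro long) simp
    moreover have "w \<noteq> [i, j]" "w \<noteq> [j, i]" using False by auto
    ultimately show ?thesis by (simp add: lookup_single_not_eq)
  qed
  show "Poly_Mapping.lookup (cyc_deriv i V) [] = Poly_Mapping.lookup V [i]"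
    by (induction V rule: ncpoly_induct) (auto simp: cyc_deriv_add lookup_add 1)
  show "Poly_Mapping.lookup (cyc_deriv i V) [j] = Poly_Mapping.lookup V [i, j] + Poly_Mapping.lookup V [j, i]"
    by (induction V rule: ncpoly_induct) (auto simp: cyc_deriv_add lookup_add 2)
qed

lemma tensor_fun_add: "tensor_fun \<mu> (S + T) = tensor_fun \<mu> S + tensor_fun \<mu> T"
  unfolding tensor_fun_def case_prod_unfold prod.collapse
  by (rule sum_keys_add[where f = "\<lambda>p c. c * \<mu> (Poly_Mapping.single (fst p) 1) * \<mu> (Poly_Mapping.single (snd p) 1)"])
    (auto simp: algebra_simps)
lemma tensor_fun_0 [simp]: "tensor_fun \<mu> 0 = 0" by (simp add: tensor_fun_def)
lemma tensor_fun_sum: "tensor_fun \<mu> (\<Sum>i\<in>I. f i) = (\<Sum>i\<in>I. tensor_fun \<mu> (f i))"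
  by (induction I rule: infinite_finite_induct) (auto simp: tensor_fun_add)
lemma tensor_fun_single: "tensor_fun (word_lin m) (Poly_Mapping.single (u, v) c) = c * m u * m v"
  unfolding tensor_fun_def case_prod_unfold prod.collapse
  by (subst sum_keys_single[where f = "\<lambda>p c. c * word_lin m (Poly_Mapping.single (fst p) 1) * word_lin m (Poly_Mapping.single (snd p) 1)"])
    auto

text \<open>The value of \<open>m \<otimes> m\<close> on the free difference quotient of \<open>w\<close> with respect to all letters satisfying \<open>p\<close>.\<close>
definition splits :: "('x list \<Rightarrow> complex) \<Rightarrow> ('x \<Rightarrow> bool) \<Rightarrow> 'x list \<Rightarrow> complex" where
  "splits m p w = (\<Sum>l<length w. if p (w ! l) then m (take l w) * m (drop (Suc l) w) else 0)"

lemma tensor_free_diff_single: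
  "tensor_fun (word_lin m) (free_diff x (Poly_Mapping.single w c)) = c * splits m (\<lambda>y. y = x) w"
  unfolding free_diff_single tensor_fun_sum splits_def sum_distrib_left
  by (intro sum.cong) (auto simp: tensor_fun_single)

lemma word_lin_affine:
  assumes "affine_poly (D :: ('x::finite) ncpoly)"
  shows "word_lin f D = Poly_Mapping.lookup D [] * f [] + (\<Sum>j\<in>UNIV. Poly_Mapping.lookup D [j] * f [j])"
proof -
  let ?S = "insert [] (range (\<lambda>j. [j]))"
  have "Poly_Mapping.keys D \<subseteq> ?S"
  proof
    fix u assume "u \<in> Poly_Mapping.keys D"
    then have "\<not> 2 \<le> length u" using assms by (auto simp: in_keys_iff affine_poly_def)
    then show "u \<in> ?S" by (cases u; cases "tl u") auto
  qed
  then have "word_lin f D = (\<Sum>w\<in>?S. Poly_Mapping.lookup D w * f w)"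
    unfolding word_lin_def by (intro sum_keys_superset) auto
  also have "\<dots> = Poly_Mapping.lookup D [] * f [] + (\<Sum>w\<in>range (\<lambda>j. [j]). Poly_Mapping.lookup D w * f w)" by (subst sum.insert) auto
  also have "(\<Sum>w\<in>range (\<lambda>j. [j]). Poly_Mapping.lookup D w * f w) = (\<Sum>j\<in>UNIV. Poly_Mapping.lookup D [j] * f [j])"
    by (subst sum.reindex) (auto simp: inj_on_def)
  finally show ?thesis .
qed

lemma word_lin_mult_single: "word_lin m (D * Poly_Mapping.single w c) = c * word_lin (\<lambda>u. m (u @ w)) D"
  by (induction D rule: ncpoly_induct) (auto simp: distrib_right single_mult algebra_simps)

section \<open>Self-adjoint laws\<close>

lemma conjugate_variables_words:
  fixes D :: "'m::finite \<Rightarrow> 'm ncpoly"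
  assumes aff: "\<And>i. affine_poly (D i)"
  shows "has_conjugate_variables (word_lin m) D \<longleftrightarrow>
    (\<forall>i w. splits m (\<lambda>y. y = i) w = Poly_Mapping.lookup (D i) [] * m w + (\<Sum>j\<in>UNIV. Poly_Mapping.lookup (D i) [j] * m (j # w)))"
    (is "_ \<longleftrightarrow> (\<forall>i w. ?l i w = ?r i w)")
proof -
  have "word_lin f (D i) = Poly_Mapping.lookup (D i) [] * f [] + (\<Sum>j\<in>UNIV. Poly_Mapping.lookup (D i) [j] * f [j])" for f i
    by (rule word_lin_affine) (rule aff)
  then have r: "word_lin m (D i * Poly_Mapping.single w c) = c * ?r i w" for i w c
    by (simp add: word_lin_mult_single)
  show ?thesis
  proof
    assume h: "has_conjugate_variables (word_lin m) D"
    show "\<forall>i w. ?l i w = ?r i w"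
    proof (intro allI)
      fix i w
      have "tensor_fun (word_lin m) (free_diff i (Poly_Mapping.single w 1)) = word_lin m (D i * Poly_Mapping.single w 1)"
        using h by (simp add: has_conjugate_variables_def)
      then show "?l i w = ?r i w" unfolding tensor_free_diff_single r by simp
    qed
  next
    assume h: "\<forall>i w. ?l i w = ?r i w"
    have "tensor_fun (word_lin m) (free_diff i P) = word_lin m (D i * P)" for i P
    proof (induction P rule: ncpoly_induct)
      case (add p w c)
      then show ?case unfolding free_diff_add tensor_fun_add tensor_free_diff_single distrib_left word_lin_simps r using h by (simp add: distrib_left)
    qed simp
    then show "has_conjugate_variables (word_lin m) D" by (simp add: has_conjugate_variables_def)
  qed
qed

text \<open>The equation for the words of length \<open>n\<close> determines the moments of length \<open>n + 1\<close>, since the linear part of the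
  gradient is invertible.\<close>
lemma conjugate_variables_unique:
  fixes D :: "'m::finite \<Rightarrow> 'm ncpoly"
  assumes aff: "\<And>i. affine_poly (D i)"
    and acc: "accretive c (\<lambda>i j. Poly_Mapping.lookup (D i) [j])" "0 < c"
    and m: "has_conjugate_variables (word_lin m) D" "m [] = 1"
    and m': "has_conjugate_variables (word_lin m') D" "m' [] = 1"
  shows "m = m'"
proof
  fix w show "m w = m' w"
  proof (induction "length w" arbitrary: w rule: less_induct)
    case less
    show ?case
    proof (cases w)
      case (Cons x v)
      have IH: "m u = m' u" if "length u \<le> length v" for u using less that by (simp add: Cons)
      have "(\<Sum>j\<in>UNIV. Poly_Mapping.lookup (D i) [j] * (m (j # v) - m' (j # v))) = 0" for i
      proof -
        have "splits m (\<lambda>y. y = i) v = splits m' (\<lambda>y. y = i) v"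
          unfolding splits_def by (intro sum.cong refl if_cong arg_cong2[where f = "(*)"] IH) auto
        moreover have "splits m (\<lambda>y. y = i) v = Poly_Mapping.lookup (D i) [] * m v + (\<Sum>j\<in>UNIV. Poly_Mapping.lookup (D i) [j] * m (j # v))"
          using m(1) unfolding conjugate_variables_words[OF aff] by blast
        moreover have "splits m' (\<lambda>y. y = i) v = Poly_Mapping.lookup (D i) [] * m' v + (\<Sum>j\<in>UNIV. Poly_Mapping.lookup (D i) [j] * m' (j # v))"
          using m'(1) unfolding conjugate_variables_words[OF aff] by blast
        ultimately have "(\<Sum>j\<in>UNIV. Poly_Mapping.lookup (D i) [j] * m (j # v)) = (\<Sum>j\<in>UNIV. Poly_Mapping.lookup (D i) [j] * m' (j # v))"
          using IH[of v] by simp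
        then show ?thesis by (simp add: right_diff_distrib sum_subtractf)
      qed
      from accretive_kernel[OF acc this, of x] show ?thesis by (simp add: Cons)
    qed (simp add: m m')
  qed
qed

text \<open>The semicircular family whose covariance is the inverse of the linear part of the gradient.\<close>
lemma conjugate_variables_exist:
  fixes D :: "'m::finite \<Rightarrow> 'm ncpoly"
  assumes U: "(UNIV :: real set) \<lesssim> (UNIV :: 'u set)"
    and aff: "\<And>i. affine_poly (D i)"
    and acc: "accretive c (\<lambda>i j. Poly_Mapping.lookup (D i) [j])" "0 < c"
    and sym: "\<And>i j. Poly_Mapping.lookup (D i) [j] = Poly_Mapping.lookup (D j) [i]"
    and real: "\<And>i j. Poly_Mapping.lookup (D i) [j] \<in> \<real>" "\<And>i. Poly_Mapping.lookup (D i) [] \<in> \<real>"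
  shows "\<exists>m. is_sa_law TYPE('u) (word_lin m) \<and> has_conjugate_variables (word_lin m) D"
proof -
  define B where "B = (\<lambda>i j. Poly_Mapping.lookup (D i) [j])"
  have acc': "accretive c B" using acc(1) by (simp add: B_def)
  have Bs: "B i j = B j i" and Br: "cnj (B i j) = B i j" for i j
    using sym real(1) by (auto simp: B_def Reals_cnj_iff)
  have "\<exists>k. \<forall>x y. lyap B k x y = 2 * (if x = y then 1 else 0)" by (rule lyap_solve[OF acc' acc(2)])
  then obtain k where k: "\<And>x y. lyap B k x y = 2 * (if x = y then 1 else 0)" by blast
  have kpsd: "psd k"
    by (rule lyap_psd[OF acc' acc(2) k]) (intro psd_cmult psd_indicator; simp add: complex_nonneg_Reals_iff)
  have ksym: "k x y = k y x" for x y
  proof (rule lyap_inj[OF acc' acc(2), of _ "\<lambda>x y. k y x", where x = x and y = y])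
    show "lyap B k x y = lyap B (\<lambda>x y. k y x) x y" for x y
    proof -
      have "lyap B (\<lambda>x y. k y x) x y = lyap B k y x" by (simp add: lyap_def Br add.commute)
      then show ?thesis unfolding k by auto
    qed
  qed
  (* The inverse of the symmetric matrix B is symmetric, so that it solves the Lyapunov equation, whose solution is unique. *)
  have inv: "(\<Sum>z\<in>UNIV. B x z * k z y) = (if x = y then 1 else 0)" for x y
  proof -
    have "\<exists>v. \<forall>x. (\<Sum>z\<in>UNIV. B x z * v z) = (if x = y then 1 else 0)" for y by (rule accretive_solve[OF acc' acc(2)])
    then obtain q where q: "\<And>x y. (\<Sum>z\<in>UNIV. B x z * q y z) = (if x = y then 1 else 0)" by metis
    have qs: "q x y = q y x" for x y
    proof -
      have "(\<Sum>z\<in>UNIV. q x z * (\<Sum>v\<in>UNIV. B z v * q y v)) = (\<Sum>v\<in>UNIV. q y v * (\<Sum>z\<in>UNIV. B v z * q x z))"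
        unfolding sum_distrib_left by (subst sum.swap) (simp add: Bs[of _ "_ :: 'm"] mult_ac)
      then show ?thesis unfolding q by (simp add: if_distrib[of "\<lambda>z. _ * z"] sum.delta sum.delta' cong: if_cong)
    qed
    have "lyap B k x y = lyap B (\<lambda>z y. q y z) x y" for x y
    proof -
      have "lyap B (\<lambda>z y. q y z) x y = (\<Sum>z\<in>UNIV. B x z * q y z) + (\<Sum>z\<in>UNIV. B y z * q x z)"
        unfolding lyap_def Br by (intro arg_cong2[where f = "(+)"] refl sum.cong) (metis qs)
      then show ?thesis unfolding k q by auto
    qed
    from lyap_inj[OF acc' acc(2) this] have "k = (\<lambda>z y. q y z)" by (intro ext) blast
    then show ?thesis by (simp add: q)
  qed
  obtain a where a: "\<And>x. (\<Sum>y\<in>UNIV. B x y * a y) = - Poly_Mapping.lookup (D x) []"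
    using accretive_solve[OF acc' acc(2), of "\<lambda>x. - Poly_Mapping.lookup (D x) []"] by blast
  have ar: "cnj (a x) = a x" for x
  proof -
    have "(\<Sum>y\<in>UNIV. B x y * (cnj (a y) - a y)) = 0" for x
    proof -
      have "(\<Sum>y\<in>UNIV. B x y * cnj (a y)) = cnj (\<Sum>y\<in>UNIV. B x y * a y)" by (simp add: Br)
      also have "\<dots> = (\<Sum>y\<in>UNIV. B x y * a y)" unfolding a using real(2) by (simp add: Reals_cnj_iff)
      finally show ?thesis by (simp add: right_diff_distrib sum_subtractf)
    qed
    from accretive_kernel[OF acc' acc(2) this] show ?thesis by simp
  qed
  interpret semicircular_family "\<lambda>x. x" k a
  proof
    show "k x y = k y x" for x y by (rule ksym)
  qed (simp_all add: kpsd ar)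
  have "has_conjugate_variables (word_lin tau) D"
    unfolding conjugate_variables_words[OF aff]
  proof (intro allI)
    fix i w
    have "(\<Sum>j\<in>UNIV. B i j * tau (j # w)) = (\<Sum>j\<in>UNIV. B i j * a j) * tau w +
       (\<Sum>l<length w. (\<Sum>j\<in>UNIV. B i j * k (w ! l) j) * (tau (take l w) * tau (drop (Suc l) w)))"
    proof -
      have "(\<Sum>l<length w. (\<Sum>j\<in>UNIV. B i j * k (w ! l) j) * (tau (take l w) * tau (drop (Suc l) w)))
         = (\<Sum>j\<in>UNIV. \<Sum>l<length w. B i j * (k (w ! l) j * tau (take l w) * tau (drop (Suc l) w)))"
        unfolding sum_distrib_right by (subst sum.swap) (simp add: mult.assoc)
      then show ?thesis unfolding tau_Cons distrib_left sum.distrib by (simp add: sum_distrib_left sum_distrib_right mult.assoc)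
    qed
    also have "(\<Sum>l<length w. (\<Sum>j\<in>UNIV. B i j * k (w ! l) j) * (tau (take l w) * tau (drop (Suc l) w))) = splits tau (\<lambda>y. y = i) w"
      unfolding splits_def ksym[of "w ! _"] inv by (intro sum.cong) auto
    finally show "splits tau (\<lambda>y. y = i) w = Poly_Mapping.lookup (D i) [] * tau w + (\<Sum>j\<in>UNIV. Poly_Mapping.lookup (D i) [j] * tau (j # w))"
      unfolding a B_def[symmetric] by (simp add: B_def)
  qed
  moreover have "is_sa_law TYPE('u) (word_lin tau)"
    using moment_fun_realized[OF U cont_small_finite moment_fun_tau] unfolding is_sa_law_def by metis
  ultimately show ?thesis by blast
qed

text \<open>Scalar matrices suffice: \<open>V\<close> takes real values at real points, and the coefficients of the gradient up to degree one
  are symmetrized coefficients of \<open>V\<close>.\<close>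
lemma self_adjoint_gradient_real:
  fixes V :: "'m::finite ncpoly"
  assumes U: "(UNIV :: real set) \<lesssim> (UNIV :: 'u set)" and sa: "self_adjoint_poly TYPE('u) V"
  shows "Poly_Mapping.lookup (cyc_deriv i V) [] \<in> \<real>" "Poly_Mapping.lookup (cyc_deriv i V) [j] \<in> \<real>"
proof -
  interpret trace_algebra "Poly_Mapping.single []" "pstar prod.swap" "word_lin (mtr 1)"
    by (rule moment_fun_trace_algebra(1)[OF moment_fun_mtr]) simp_all
  have small: "cont_small TYPE((nat \<times> nat) ncpoly)"
  proof (intro cont_small_ncpoly cont_small_prod)
    show "cont_small TYPE(nat)" "cont_small TYPE(nat)" by (auto simp: cont_small_def inj_def intro!: exI[of _ real])
  qed
  obtain A :: "'u cstar" and \<phi> \<iota> where comp: "is_completion A \<phi> \<iota>"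
    using universe_inj[OF U small] completion_exists by blast
  interpret A: tracial_cstar_space A \<phi> by (rule comp_space[OF comp])
  have val: "word_lin (\<lambda>w. \<Prod>i\<leftarrow>w. of_real (x i)) V \<in> \<real>" for x :: "'m \<Rightarrow> real"
  proof -
    define X where "X = (\<lambda>i. \<iota> (Poly_Mapping.single [] (of_real (x i))))"
    have X: "X i \<in> carrier A \<and> adj A (X i) = X i" for i
      using io_closed[OF comp] io_st[OF comp, of "Poly_Mapping.single [] (of_real (x i))"] by (simp add: X_def)
    have p: "(\<Prod>i\<leftarrow>w. Poly_Mapping.single [] (of_real (x i))) = (Poly_Mapping.single [] (\<Prod>i\<leftarrow>w. of_real (x i)) :: (nat \<times> nat) ncpoly)" for w
      by (induction w) (auto simp: single_mult)
    have "eval_poly A X V = \<iota> (Poly_Mapping.single [] (word_lin (\<lambda>w. \<Prod>i\<leftarrow>w. of_real (x i)) V))"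
      unfolding X_def io_ev[OF comp] ncp.ev_def p word_lin_def ncp.sc_sum by (simp add: single_mult)
    moreover have "adj A (eval_poly A X V) = eval_poly A X V"
      using sa X A.cstar_algebra_axioms unfolding self_adjoint_poly_def by blast
    ultimately have "\<phi> (\<iota> (pstar prod.swap (Poly_Mapping.single [] (word_lin (\<lambda>w. \<Prod>i\<leftarrow>w. of_real (x i)) V)))) =
        \<phi> (\<iota> (Poly_Mapping.single [] (word_lin (\<lambda>w. \<Prod>i\<leftarrow>w. of_real (x i)) V)))"
      by (simp only: io_st[OF comp])
    then show ?thesis unfolding io_tr[OF comp] by (simp add: mtr_def Reals_cnj_iff)
  qed
  (* Scaling the point by a real t gives a polynomial in t with real values, hence with real coefficients. *)
  have hom: "(\<Sum>w | w \<in> Poly_Mapping.keys V \<and> length w = n. Poly_Mapping.lookup V w * (\<Prod>i\<leftarrow>w. of_real (x i))) \<in> \<real>" for x :: "'m \<Rightarrow> real" and n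
  proof -
    define c where "c = (\<lambda>n. Im (\<Sum>w | w \<in> Poly_Mapping.keys V \<and> length w = n. Poly_Mapping.lookup V w * (\<Prod>i\<leftarrow>w. of_real (x i))))"
    define N where "N = max n (Max (insert 0 (length ` Poly_Mapping.keys V)))"
    have N: "length w \<le> N" if "w \<in> Poly_Mapping.keys V" for w
      using that unfolding N_def by (auto intro!: max.coboundedI2 Max_ge)
    have "(\<Sum>k\<le>N. c k * t ^ k) = 0" for t
    proof -
      have pt: "(\<Prod>i\<leftarrow>w. complex_of_real (t * x i)) = of_real (t ^ length w) * (\<Prod>i\<leftarrow>w. of_real (x i))" for w
        by (induction w) auto
      have "word_lin (\<lambda>w. \<Prod>i\<leftarrow>w. of_real (t * x i)) V =
         (\<Sum>w\<in>Poly_Mapping.keys V. of_real (t ^ length w) * (Poly_Mapping.lookup V w * (\<Prod>i\<leftarrow>w. of_real (x i))))"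
        unfolding word_lin_def pt by (intro sum.cong) auto
      also have "\<dots> = (\<Sum>k\<le>N. \<Sum>w | w \<in> Poly_Mapping.keys V \<and> length w = k. of_real (t ^ length w) * (Poly_Mapping.lookup V w * (\<Prod>i\<leftarrow>w. of_real (x i))))"
        by (rule sum.group[symmetric]) (use N in auto)
      also have "\<dots> = (\<Sum>k\<le>N. of_real (t ^ k) * (\<Sum>w | w \<in> Poly_Mapping.keys V \<and> length w = k. Poly_Mapping.lookup V w * (\<Prod>i\<leftarrow>w. of_real (x i))))"
        unfolding sum_distrib_left by (intro sum.cong) auto
      finally have "Im (\<Sum>k\<le>N. of_real (t ^ k) * (\<Sum>w | w \<in> Poly_Mapping.keys V \<and> length w = k. Poly_Mapping.lookup V w * (\<Prod>i\<leftarrow>w. of_real (x i)))) = 0"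
        using val[of "\<lambda>i. t * x i"] by (simp add: complex_is_Real_iff)
      moreover have "Im (of_real r * z) = z' * r" if "Im z = z'" for r z z' using that by simp
      ultimately show ?thesis unfolding Im_sum c_def by (simp only: times_complex.sel Re_complex_of_real Im_complex_of_real) (simp add: mult.commute)
    qed
    then have "\<forall>k\<le>N. c k = 0" using polyfun_eq_0[of c N] by blast
    then have "c n = 0" by (simp add: N_def)
    then show ?thesis by (simp add: c_def complex_is_Real_iff)
  qed
  have pick: "(\<Sum>w | w \<in> Poly_Mapping.keys V \<and> length w = n. Poly_Mapping.lookup V w * f w) = (\<Sum>w\<in>S. Poly_Mapping.lookup V w * f w)"
    if S: "finite S" "\<And>w. w \<in> S \<Longrightarrow> length w = n" "\<And>w. length w = n \<Longrightarrow> w \<notin> S \<Longrightarrow> f w = 0" for S n f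
    by (rule sum.mono_neutral_cong) (use S in \<open>auto simp: in_keys_iff\<close>)
  have one: "Poly_Mapping.lookup V [i] \<in> \<real>" for i
  proof -
    have "(\<Sum>w | w \<in> Poly_Mapping.keys V \<and> length w = 1. Poly_Mapping.lookup V w * (\<Prod>l\<leftarrow>w. of_real (of_bool (l = i)))) =
       (\<Sum>w\<in>{[i]}. Poly_Mapping.lookup V w * (\<Prod>l\<leftarrow>w. of_real (of_bool (l = i))))"
      by (rule pick) (auto simp: length_Suc_conv)
    then show ?thesis using hom[of "\<lambda>l. of_bool (l = i)" 1] by simp
  qed
  have two: "Poly_Mapping.lookup V [i, i] \<in> \<real>" for i
  proof -
    have "(\<Sum>w | w \<in> Poly_Mapping.keys V \<and> length w = 2. Poly_Mapping.lookup V w * (\<Prod>l\<leftarrow>w. of_real (of_bool (l = i)))) =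
       (\<Sum>w\<in>{[i, i]}. Poly_Mapping.lookup V w * (\<Prod>l\<leftarrow>w. of_real (of_bool (l = i))))"
      by (rule pick) (auto simp: length_Suc_conv numeral_2_eq_2)
    then show ?thesis using hom[of "\<lambda>l. of_bool (l = i)" 2] by simp
  qed
  have pair: "Poly_Mapping.lookup V [i, j] + Poly_Mapping.lookup V [j, i] \<in> \<real>"
  proof (cases "i = j")
    case True then show ?thesis using two[of i] by simp
  next
    case False
    have "(\<Sum>w | w \<in> Poly_Mapping.keys V \<and> length w = 2. Poly_Mapping.lookup V w * (\<Prod>l\<leftarrow>w. of_real (of_bool (l = i \<or> l = j)))) =
       (\<Sum>w\<in>{[i, i], [i, j], [j, i], [j, j]}. Poly_Mapping.lookup V w * (\<Prod>l\<leftarrow>w. of_real (of_bool (l = i \<or> l = j))))"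
      by (rule pick) (auto simp: length_Suc_conv numeral_2_eq_2)
    then have "Poly_Mapping.lookup V [i, i] + (Poly_Mapping.lookup V [i, j] + (Poly_Mapping.lookup V [j, i] + Poly_Mapping.lookup V [j, j])) \<in> \<real>"
      using hom[of "\<lambda>l. of_bool (l = i \<or> l = j)" 2] False by simp
    from Reals_diff[OF Reals_diff[OF this two[of i]] two[of j]] show ?thesis by (simp add: algebra_simps)
  qed
  show "Poly_Mapping.lookup (cyc_deriv i V) [] \<in> \<real>" "Poly_Mapping.lookup (cyc_deriv i V) [j] \<in> \<real>"
    unfolding cyc_deriv_coeffs by (rule one, rule pair)
qed

section \<open>Laws of variables that need not be self-adjoint\<close>

text \<open>The Schwinger-Dyson equation tested on the cyclic gradient of the word \<open>w\<close>. The index \<open>ix\<close> identifies a letter with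
  its adjoint, and \<open>b x + \<Sum>\<^sub>y B x y y\<close> is the affine polynomial paired with the derivative in the letter \<open>x\<close>.\<close>
definition weak_sd :: "('x::finite \<Rightarrow> 'm) \<Rightarrow> ('x \<Rightarrow> complex) \<Rightarrow> ('x \<Rightarrow> 'x \<Rightarrow> complex) \<Rightarrow> ('x list \<Rightarrow> complex) \<Rightarrow> 'x list \<Rightarrow> bool" where
  "weak_sd ix b B m w \<longleftrightarrow> (\<Sum>k<length w. splits m (\<lambda>y. ix y = ix (w ! k)) (rotate_out k w)) =
     (\<Sum>k<length w. b (w ! k) * m (rotate_out k w) + (\<Sum>y\<in>UNIV. B (w ! k) y * m (y # rotate_out k w)))"

lemma finite_words: "finite {w :: 'x::finite list. length w = n}"
  using finite_lists_length_eq[of "UNIV :: 'x set" n] by simp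

lemma sum_words_split:
  fixes f :: "'x::finite list \<Rightarrow> 'v::comm_monoid_add"
  assumes "k < n"
  shows "(\<Sum>w | length w = n. f w) = (\<Sum>(u, v)\<in>{u. length u = k} \<times> {v. length v = n - Suc k}. \<Sum>x\<in>UNIV. f (u @ x # v))"
proof -
  let ?S = "{u :: 'x list. length u = k} \<times> {v :: 'x list. length v = n - Suc k}"
  have "(\<Sum>p\<in>?S. \<Sum>x\<in>UNIV. f (fst p @ x # snd p)) = (\<Sum>q\<in>?S \<times> UNIV. f (fst (fst q) @ snd q # snd (fst q)))"
    by (simp add: sum.cartesian_product case_prod_unfold)
  also have "\<dots> = (\<Sum>w | length w = n. f w)"
    by (rule sum.reindex_bij_witness[where i = "\<lambda>w. ((take k w, drop (Suc k) w), w ! k)" and j = "\<lambda>q. fst (fst q) @ snd q # snd (fst q)"])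
      (use assms in \<open>auto simp: id_take_nth_drop[symmetric] nth_append\<close>)
  finally show ?thesis by (simp add: case_prod_unfold)
qed

text \<open>Applying \<open>B\<close> to the letter at one position is accretive, since it is so for each choice of the other letters.\<close>
lemma accretive_words:
  fixes d :: "'x::finite list \<Rightarrow> complex"
  assumes B: "accretive c B" and k: "k < n"
  shows "c * (\<Sum>w | length w = n. (cmod (d w))\<^sup>2) \<le>
    Re (\<Sum>w | length w = n. cnj (d w) * (\<Sum>y\<in>UNIV. B (w ! k) y * d (w[k := y])))"
proof -
  let ?S = "{u :: 'x list. length u = k} \<times> {v :: 'x list. length v = n - Suc k}"
  have "c * (\<Sum>w | length w = n. (cmod (d w))\<^sup>2) = (\<Sum>(u, v)\<in>?S. c * (\<Sum>x\<in>UNIV. (cmod (d (u @ x # v)))\<^sup>2))"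
    unfolding sum_words_split[OF k] by (simp add: sum_distrib_left case_prod_unfold)
  also have "\<dots> \<le> (\<Sum>(u, v)\<in>?S. Re (\<Sum>x\<in>UNIV. \<Sum>y\<in>UNIV. cnj (d (u @ x # v)) * B x y * d (u @ y # v)))"
  proof (rule sum_mono)
    fix p :: "'x list \<times> 'x list"
    show "(case p of (u, v) \<Rightarrow> c * (\<Sum>x\<in>UNIV. (cmod (d (u @ x # v)))\<^sup>2)) \<le>
      (case p of (u, v) \<Rightarrow> Re (\<Sum>x\<in>UNIV. \<Sum>y\<in>UNIV. cnj (d (u @ x # v)) * B x y * d (u @ y # v)))"
      using B[unfolded accretive_def, rule_format, of "\<lambda>x. d (fst p @ x # snd p)"] by (simp only: case_prod_unfold)
  qed
  also have "\<dots> = Re (\<Sum>(u, v)\<in>?S. \<Sum>x\<in>UNIV. \<Sum>y\<in>UNIV. cnj (d (u @ x # v)) * B x y * d (u @ y # v))"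
    by (simp only: Re_sum case_prod_unfold)
  also have "(\<Sum>(u, v)\<in>?S. \<Sum>x\<in>UNIV. \<Sum>y\<in>UNIV. cnj (d (u @ x # v)) * B x y * d (u @ y # v)) =
      (\<Sum>w | length w = n. cnj (d w) * (\<Sum>y\<in>UNIV. B (w ! k) y * d (w[k := y])))"
    unfolding sum_words_split[OF k]
  proof (rule sum.cong[OF refl])
    fix p :: "'x list \<times> 'x list" assume "p \<in> ?S"
    then show "(case p of (u, v) \<Rightarrow> \<Sum>x\<in>UNIV. \<Sum>y\<in>UNIV. cnj (d (u @ x # v)) * B x y * d (u @ y # v)) =
       (case p of (u, v) \<Rightarrow> \<Sum>x\<in>UNIV. cnj (d (u @ x # v)) * (\<Sum>y\<in>UNIV. B ((u @ x # v) ! k) y * d ((u @ x # v)[k := y])))"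
      by (cases p) (simp add: list_update_append nth_append sum_distrib_left mult.assoc)
  qed
  finally show ?thesis .
qed

text \<open>The difference of two solutions, on the words of the smallest length on which it is not zero, would be in the kernel
  of the operator of \<open>accretive_words\<close>.\<close>
lemma weak_sd_unique:
  fixes m m' :: "'x::finite list \<Rightarrow> complex"
  assumes B: "accretive c B" "0 < c"
    and m: "\<And>w. weak_sd ix b B m w" "m [] = 1" "\<And>u v. m (u @ v) = m (v @ u)"
    and m': "\<And>w. weak_sd ix b B m' w" "m' [] = 1" "\<And>u v. m' (u @ v) = m' (v @ u)"
  shows "m = m'"
proof
  fix w show "m w = m' w"
  proof (induction "length w" arbitrary: w rule: less_induct)
    case less
    define n where "n = length w"
    define d where "d = (\<lambda>w. m w - m' w)"
    have IH: "m u = m' u" if "length u < n" for u using less that by (simp add: n_def)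
    show ?case
    proof (cases "n = 0")
      case True then show ?thesis by (simp add: n_def m m')
    next
      case False
      have rot: "q (y # rotate_out k v) = q (v[k := y])" if "k < length v" "\<And>u v. q (u @ v) = q (v @ u)" for q :: "'x list \<Rightarrow> complex" and y k v
        using that(2)[of "y # drop (Suc k) v" "take k v"] that(1) by (simp add: rotate_out_def upd_conv_take_nth_drop)
      have zero: "(\<Sum>k<n. \<Sum>y\<in>UNIV. B (v ! k) y * d (v[k := y])) = 0" if v: "length v = n" for v
      proof -
        have e: "m (rotate_out k v) = m' (rotate_out k v)" if "k < n" for k
          using that v by (intro IH) (simp add: length_rotate_out)
        have f: "splits m p (rotate_out k v) = splits m' p (rotate_out k v)" if k: "k < n" for k p
          unfolding splits_def using k v by (intro sum.cong refl if_cong arg_cong2[where f = "(*)"] IH) (auto simp: length_rotate_out)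
        have "(\<Sum>k<n. b (v ! k) * m (rotate_out k v) + (\<Sum>y\<in>UNIV. B (v ! k) y * m (y # rotate_out k v))) =
          (\<Sum>k<n. b (v ! k) * m' (rotate_out k v) + (\<Sum>y\<in>UNIV. B (v ! k) y * m' (y # rotate_out k v)))"
          using m(1)[of v] m'(1)[of v] f unfolding weak_sd_def v by simp
        then have "(\<Sum>k<n. \<Sum>y\<in>UNIV. B (v ! k) y * m (y # rotate_out k v)) = (\<Sum>k<n. \<Sum>y\<in>UNIV. B (v ! k) y * m' (y # rotate_out k v))"
          using e by (simp add: sum.distrib)
        moreover have "m (y # rotate_out k v) = m (v[k := y])" "m' (y # rotate_out k v) = m' (v[k := y])" if "k < n" for k y
          using that v m(3) m'(3) by (auto intro!: rot)
        ultimately show ?thesis by (simp add: d_def right_diff_distrib sum_subtractf)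
      qed
      define N where "N = (\<Sum>w | length w = n. (cmod (d w))\<^sup>2)"
      have "real n * (c * N) = (\<Sum>k<n. c * N)" by simp
      also have "\<dots> \<le> (\<Sum>k<n. Re (\<Sum>w | length w = n. cnj (d w) * (\<Sum>y\<in>UNIV. B (w ! k) y * d (w[k := y]))))"
        unfolding N_def by (intro sum_mono accretive_words[OF B(1)]) simp
      also have "\<dots> = Re (\<Sum>w | length w = n. cnj (d w) * (\<Sum>k<n. \<Sum>y\<in>UNIV. B (w ! k) y * d (w[k := y])))"
        unfolding Re_sum[symmetric] sum_distrib_left by (subst sum.swap) (rule refl)
      also have "\<dots> = 0" using zero by simp
      finally have "N \<le> 0" using False B(2) by (simp add: mult_le_0_iff zero_less_mult_iff)
      moreover have "(cmod (d w))\<^sup>2 \<le> N" unfolding N_def by (rule member_le_sum) (auto simp: n_def finite_words)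
      ultimately have "(cmod (d w))\<^sup>2 \<le> 0" by linarith
      then show ?thesis by (simp add: d_def)
    qed
  qed
qed

text \<open>Two letters are removed from a cyclic word of length \<open>n\<close>: the one at \<open>k\<close>, and then the one at \<open>l\<close> in the rest, read from
  behind \<open>k\<close>. The map exchanges the order of the removals.\<close>
definition swap_pos :: "nat \<Rightarrow> nat \<times> nat \<Rightarrow> nat \<times> nat" where
  "swap_pos n = (\<lambda>(k, l). if k + l + 1 < n then (k + l + 1, n - 2 - l) else (k + l + 1 - n, n - 2 - l))"

lemma swap_pos_swap:
  "k < n \<Longrightarrow> l < n - 1 \<Longrightarrow> fst (swap_pos n (k, l)) < n \<and> snd (swap_pos n (k, l)) < n - 1 \<and> swap_pos n (swap_pos n (k, l)) = (k, l)"
  by (auto simp: swap_pos_def)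

text \<open>The splitting of the cyclic word depends only on the unordered pair of the two removed positions.\<close>
lemma sum_cyclic_antisymmetric:
  fixes F :: "'x \<Rightarrow> 'x \<Rightarrow> complex"
  assumes anti: "\<And>x y. F x y = - F y x"
  shows "(\<Sum>k<length w. \<Sum>l<length w - 1. F (w ! k) (rotate_out k w ! l) * (m (take l (rotate_out k w)) * m (drop (Suc l) (rotate_out k w)))) = 0"
proof -
  define n where "n = length w"
  define g where "g = (\<lambda>(k, l). F (w ! k) (rotate_out k w ! l) * (m (take l (rotate_out k w)) * m (drop (Suc l) (rotate_out k w))))"
  let ?S = "{..<n} \<times> {..<n - 1}"
  have first: "g (swap_pos n (k, l)) = - g (k, l)" if kl: "k + l + 1 < n" for k l
  proof -
    define A where "A = take k w"
    define M where "M = take l (drop (Suc k) w)"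
    define C where "C = drop (k + l + 2) w"
    define x where "x = w ! k" define y where "y = w ! (k + l + 1)"
    have w: "w = A @ x # M @ y # C" and len: "length A = k" "length M = l"
    proof -
      have "drop (Suc k) w = M @ y # C"
        unfolding M_def C_def y_def using kl id_take_nth_drop[of l "drop (Suc k) w"] by (simp add: n_def add_ac)
      then show "w = A @ x # M @ y # C" unfolding A_def x_def using kl id_take_nth_drop[of k w] by (simp add: n_def)
      show "length A = k" "length M = l" using kl by (auto simp: A_def M_def n_def)
    qed
    have n: "n = k + l + 2 + length C" using len by (simp add: n_def w)
    have r1: "rotate_out k w = M @ y # C @ A" by (simp add: rotate_out_def w len)
    have r2: "rotate_out (k + l + 1) w = C @ A @ x # M" by (simp add: rotate_out_def w len)
    have i: "w ! k = x" "w ! (k + l + 1) = y" by (simp_all add: x_def y_def)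
    have sp: "swap_pos n (k, l) = (k + l + 1, length C + k)" using kl n by (auto simp: swap_pos_def)
    show ?thesis unfolding sp g_def prod.case i r1 r2
      using anti[of y x] len by (simp add: nth_append)
  qed
  have all: "g (swap_pos n p) = - g p" if p: "p \<in> ?S" for p
  proof -
    obtain k l where kl: "p = (k, l)" "k < n" "l < n - 1" using p by auto
    show ?thesis
    proof (cases "k + l + 1 < n")
      case True then show ?thesis unfolding kl(1) by (rule first)
    next
      case False
      obtain k' l' where q: "swap_pos n (k, l) = (k', l')" by fastforce
      then have "k' + l' + 1 < n" using False kl by (auto simp: swap_pos_def split: if_splits)
      from first[OF this] show ?thesis using swap_pos_swap[OF kl(2,3)] unfolding kl(1) q by simp
    qed
  qed
  have "(\<Sum>p\<in>?S. g p) = (\<Sum>p\<in>?S. g (swap_pos n p))"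
    by (rule sum.reindex_bij_witness[of _ "swap_pos n" "swap_pos n"]) (use swap_pos_swap[of _ n] in \<open>auto simp: mem_Times_iff\<close>)
  also have "\<dots> = - (\<Sum>p\<in>?S. g p)" using all by (simp add: sum_negf)
  finally have "(\<Sum>p\<in>?S. g p) = 0" by simp
  then show ?thesis by (simp add: g_def n_def sum.cartesian_product)
qed

text \<open>The equation of the family with the covariance \<open>K\<close> contains \<open>B K\<close> in place of the indicator of equal indices; the two agree
  after symmetrization, which is all that a sum over cyclic words sees.\<close>
lemma weak_sd_semicircular:
  fixes B :: "'x::finite \<Rightarrow> 'x \<Rightarrow> complex"
  assumes fam: "semicircular_family iv k a"
    and cov: "\<And>x y. (\<Sum>z\<in>UNIV. B x z * k (iv y) z) + (\<Sum>z\<in>UNIV. B y z * k (iv x) z) = (if ix x = ix y then 2 else 0)"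
    and mean: "\<And>x. (\<Sum>z\<in>UNIV. B x z * a z) = - b x"
  shows "weak_sd ix b B (semicircular_family.tau iv k a) w"
proof -
  interpret semicircular_family iv k a by (rule fam)
  define C where "C = (\<lambda>x y. \<Sum>z\<in>UNIV. B x z * k (iv y) z)"
  define F where "F = (\<lambda>x y. C x y - (if ix y = ix x then 1 else 0))"
  have anti: "F x y = - F y x" for x y using cov[of x y] by (auto simp: F_def C_def add_eq_0_iff algebra_simps)
  have step: "b x * tau u + (\<Sum>y\<in>UNIV. B x y * tau (y # u)) = (\<Sum>l<length u. C x (u ! l) * (tau (take l u) * tau (drop (Suc l) u)))" for x u
  proof -
    have "(\<Sum>y\<in>UNIV. B x y * tau (y # u)) = (\<Sum>y\<in>UNIV. B x y * a y) * tau u +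
        (\<Sum>y\<in>UNIV. \<Sum>l<length u. B x y * k (iv (u ! l)) y * (tau (take l u) * tau (drop (Suc l) u)))"
      unfolding tau_Cons distrib_left sum.distrib by (simp add: sum_distrib_left sum_distrib_right mult.assoc)
    also have "(\<Sum>y\<in>UNIV. \<Sum>l<length u. B x y * k (iv (u ! l)) y * (tau (take l u) * tau (drop (Suc l) u)))
       = (\<Sum>l<length u. C x (u ! l) * (tau (take l u) * tau (drop (Suc l) u)))"
      unfolding C_def sum_distrib_right by (rule sum.swap)
    finally show ?thesis by (simp add: mean)
  qed
  have "(\<Sum>k<length w. b (w ! k) * tau (rotate_out k w) + (\<Sum>y\<in>UNIV. B (w ! k) y * tau (y # rotate_out k w)))
      - (\<Sum>k<length w. splits tau (\<lambda>y. ix y = ix (w ! k)) (rotate_out k w))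
     = (\<Sum>k<length w. \<Sum>l<length w - 1. F (w ! k) (rotate_out k w ! l) * (tau (take l (rotate_out k w)) * tau (drop (Suc l) (rotate_out k w))))"
    unfolding sum_subtractf[symmetric] step splits_def
    by (intro sum.cong refl) (auto simp: F_def length_rotate_out left_diff_distrib intro!: sum.cong)
  then show ?thesis unfolding sum_cyclic_antisymmetric[of F, OF anti] weak_sd_def by simp
qed

instance var :: (finite) finite
proof
  have "x \<in> range Var \<union> range Adj" for x :: "'a var" by (cases x) auto
  then have UN: "(UNIV :: 'a var set) = range Var \<union> range Adj" by blast
  show "finite (UNIV :: 'a var set)" unfolding UN by (metis finite_Un finite_imageI finite)
qed

lemma sum_var: "(\<Sum>x\<in>UNIV. f (x :: 'm::finite var)) = (\<Sum>i\<in>UNIV. f (Var i)) + (\<Sum>i\<in>UNIV. f (Adj i))"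
proof -
  have "x \<in> range Var \<union> range Adj" for x :: "'m var" by (cases x) auto
  then have UN: "(UNIV :: 'm var set) = range Var \<union> range Adj" by blast
  have "(\<Sum>x\<in>UNIV. f (x :: 'm var)) = (\<Sum>x\<in>range Var. f x) + (\<Sum>x\<in>range Adj. f x)"
    unfolding UN by (subst sum.union_disjoint) auto
  then show ?thesis by (simp add: sum.reindex inj_on_def)
qed

fun var_index :: "'m var \<Rightarrow> 'm" where "var_index (Var i) = i" | "var_index (Adj i) = i"

text \<open>The drift on the doubled alphabet: the adjoint letters evolve by the conjugate equation.\<close>
fun star_vec :: "('m \<Rightarrow> complex) \<Rightarrow> 'm var \<Rightarrow> complex" where
  "star_vec b (Var i) = b i" | "star_vec b (Adj i) = cnj (b i)"

fun star_mat :: "('m \<Rightarrow> 'm \<Rightarrow> complex) \<Rightarrow> 'm var \<Rightarrow> 'm var \<Rightarrow> complex" where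
  "star_mat B (Var i) (Var j) = B i j" | "star_mat B (Adj i) (Adj j) = cnj (B i j)"
| "star_mat B (Var i) (Adj j) = 0" | "star_mat B (Adj i) (Var j) = 0"

lemma star_mat_flip: "star_mat B (flip_var x) (flip_var y) = cnj (star_mat B x y)"
  by (cases x; cases y) auto
lemma star_vec_flip: "star_vec b (flip_var x) = cnj (star_vec b x)" by (cases x) auto
lemma flip_flip [simp]: "flip_var (flip_var x) = x" by (cases x) auto
lemma var_index_flip [simp]: "var_index (flip_var x) = var_index x" by (cases x) auto

lemma sum_flip: "(\<Sum>x\<in>UNIV. f (flip_var x)) = (\<Sum>x\<in>UNIV. f (x :: 'm::finite var))"
  by (rule sum.reindex_bij_witness[of _ flip_var flip_var]) auto

lemma accretive_star_mat:
  assumes B: "accretive c B" shows "accretive c (star_mat B)"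
  unfolding accretive_def
proof
  fix v :: "'a var \<Rightarrow> complex"
  have 1: "c * (\<Sum>i\<in>UNIV. (cmod (v (Var i)))\<^sup>2) \<le> Re (\<Sum>i\<in>UNIV. \<Sum>j\<in>UNIV. cnj (v (Var i)) * B i j * v (Var j))"
    using B[unfolded accretive_def, rule_format, of "\<lambda>i. v (Var i)"] .
  have eq: "(\<Sum>i\<in>UNIV. \<Sum>j\<in>UNIV. cnj (v (Adj i)) * cnj (B i j) * v (Adj j)) = cnj (\<Sum>i\<in>UNIV. \<Sum>j\<in>UNIV. cnj (cnj (v (Adj i))) * B i j * cnj (v (Adj j)))"
    by simp
  have 2: "c * (\<Sum>i\<in>UNIV. (cmod (v (Adj i)))\<^sup>2) \<le> Re (\<Sum>i\<in>UNIV. \<Sum>j\<in>UNIV. cnj (v (Adj i)) * cnj (B i j) * v (Adj j))"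
    unfolding eq cnj.sel using B[unfolded accretive_def, rule_format, of "\<lambda>i. cnj (v (Adj i))"] by (simp only: complex_mod_cnj)
  have "(\<Sum>x\<in>UNIV. \<Sum>y\<in>UNIV. cnj (v x) * star_mat B x y * v y) = (\<Sum>i\<in>UNIV. \<Sum>j\<in>UNIV. cnj (v (Var i)) * B i j * v (Var j)) +
     (\<Sum>i\<in>UNIV. \<Sum>j\<in>UNIV. cnj (v (Adj i)) * cnj (B i j) * v (Adj j))" unfolding sum_var by simp
  then show "c * (\<Sum>x\<in>UNIV. (cmod (v x))\<^sup>2) \<le> Re (\<Sum>x\<in>UNIV. \<Sum>y\<in>UNIV. cnj (v x) * star_mat B x y * v y)"
    using 1 2 by (simp only: sum_var distrib_left plus_complex.sel)
qed

lemma star_schwinger_dyson_words: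
  fixes V :: "'m::finite ncpoly"
  assumes aff: "\<And>i. affine_poly (cyc_deriv i V)"
  defines "b \<equiv> star_vec (\<lambda>i. Poly_Mapping.lookup (cyc_deriv i V) [])"
    and "B \<equiv> star_mat (\<lambda>i j. Poly_Mapping.lookup (cyc_deriv i V) [j])"
  shows "star_schwinger_dyson V (word_lin m) \<longleftrightarrow> (\<forall>w. weak_sd var_index b B m w)"
proof -
  define D where "D = (\<lambda>i. to_star_poly (cyc_deriv i V))"
  define L where "L = (\<lambda>P. \<Sum>i\<in>UNIV. tensor_fun (word_lin m) (free_diff (Var i) (cyc_deriv (Var i) P + cyc_deriv (Adj i) P) +
      free_diff (Adj i) (cyc_deriv (Var i) P + cyc_deriv (Adj i) P)))"
  define Rh where "Rh = (\<lambda>P. \<Sum>i\<in>UNIV. word_lin m (D i * cyc_deriv (Var i) P + star_poly (D i) * cyc_deriv (Adj i) P))"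
  have sd: "star_schwinger_dyson V (word_lin m) \<longleftrightarrow> (\<forall>P. L P = Rh P)"
    by (simp add: star_schwinger_dyson_def L_def Rh_def D_def Let_def)
  have add: "L (P + Q) = L P + L Q" "Rh (P + Q) = Rh P + Rh Q" "L 0 = 0" "Rh 0 = 0" for P Q
    by (simp_all add: L_def Rh_def cyc_deriv_add free_diff_add tensor_fun_add distrib_left sum.distrib add_ac)
  have wl_if: "word_lin m (Q * (if p then P else 0)) = (if p then word_lin m (Q * P) else 0)" for Q P p by simp
  have wl_sum: "word_lin m (\<Sum>i\<in>I. f i) = (\<Sum>i\<in>I. word_lin m (f i))" for I :: "nat set" and f
    by (induction I rule: infinite_finite_induct) auto
  have tsd: "to_star_poly P = (\<Sum>w\<in>Poly_Mapping.keys P. Poly_Mapping.single (map Var w) (Poly_Mapping.lookup P w))" for P :: "'m ncpoly"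
    by (simp add: to_star_poly_def)
  have ts: "to_star_poly 0 = (0 :: 'm var ncpoly)" "to_star_poly (P + Q) = to_star_poly P + to_star_poly Q"
    "to_star_poly (Poly_Mapping.single w c) = Poly_Mapping.single (map Var w) c" for P Q :: "'m ncpoly" and w :: "'m list" and c
  proof -
    show "to_star_poly 0 = (0 :: 'm var ncpoly)" by (simp add: tsd)
    show "to_star_poly (P + Q) = to_star_poly P + to_star_poly Q" unfolding tsd
      by (rule sum_keys_add) (auto simp: single_add)
    show "to_star_poly (Poly_Mapping.single w c) = Poly_Mapping.single (map Var w) c" unfolding tsd
      by (rule sum_keys_single[where f = "\<lambda>w. Poly_Mapping.single (map Var w)"]) simp
  qed
  have lD: "word_lin f (to_star_poly P) = word_lin (\<lambda>u. f (map Var u)) P" for f and P :: "'m ncpoly"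
    by (induction P rule: ncpoly_induct) (auto simp: ts)
  have lS: "word_lin f (star_poly (to_star_poly P)) = cnj (word_lin (\<lambda>u. cnj (f (rev (map Adj u)))) P)" for f and P :: "'m ncpoly"
    unfolding star_poly_pstar by (induction P rule: ncpoly_induct) (auto simp: ts wstar_def o_def)
  have affine: "word_lin f (cyc_deriv i V) = Poly_Mapping.lookup (cyc_deriv i V) [] * f [] + (\<Sum>j\<in>UNIV. Poly_Mapping.lookup (cyc_deriv i V) [j] * f [j])" for f i
    by (rule word_lin_affine) (rule aff)
  have DV: "word_lin f (D i) = b (Var i) * f [] + (\<Sum>y\<in>UNIV. B (Var i) y * f [y])" for f i
    unfolding D_def lD affine sum_var by (simp add: b_def B_def)
  have DA: "word_lin f (star_poly (D i)) = b (Adj i) * f [] + (\<Sum>y\<in>UNIV. B (Adj i) y * f [y])" for f i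
    unfolding D_def lS affine sum_var by (simp add: b_def B_def)
  define r where "r = (\<lambda>x v. b x * m v + (\<Sum>y\<in>UNIV. B x y * m (y # v)))"
  have Rw: "Rh (Poly_Mapping.single w c) = c * (\<Sum>k<length w. r (w ! k) (rotate_out k w))" for w c
  proof -
    have "Rh (Poly_Mapping.single w c) = (\<Sum>i\<in>UNIV. (\<Sum>k<length w. if w ! k = Var i then c * r (Var i) (rotate_out k w) else 0)
         + (\<Sum>k<length w. if w ! k = Adj i then c * r (Adj i) (rotate_out k w) else 0))"
      unfolding Rh_def cyc_deriv_single sum_distrib_left word_lin_simps wl_sum wl_if word_lin_mult_single DV DA r_def by (simp cong: if_cong)
    also have "\<dots> = (\<Sum>x\<in>UNIV. \<Sum>k<length w. if w ! k = x then c * r x (rotate_out k w) else 0)"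
      unfolding sum_var by (simp add: sum.distrib)
    also have "\<dots> = (\<Sum>k<length w. \<Sum>x\<in>UNIV. if w ! k = x then c * r x (rotate_out k w) else 0)" by (rule sum.swap)
    also have "\<dots> = c * (\<Sum>k<length w. r (w ! k) (rotate_out k w))" by (simp add: sum.delta' sum_distrib_left)
    finally show ?thesis .
  qed
  have Lw: "L (Poly_Mapping.single w c) = c * (\<Sum>k<length w. splits m (\<lambda>y. var_index y = var_index (w ! k)) (rotate_out k w))" for w c
  proof -
    have sp: "splits m (\<lambda>y. y = Var i) v + splits m (\<lambda>y. y = Adj i) v = splits m (\<lambda>y. var_index y = i) v" for i v
      unfolding splits_def sum.distrib[symmetric]
    proof (intro sum.cong refl)
      fix l show "(if v ! l = Var i then m (take l v) * m (drop (Suc l) v) else 0) + (if v ! l = Adj i then m (take l v) * m (drop (Suc l) v) else 0)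
         = (if var_index (v ! l) = i then m (take l v) * m (drop (Suc l) v) else 0)" by (cases "v ! l") auto
    qed
    have q: "cyc_deriv (Var i) (Poly_Mapping.single w c) + cyc_deriv (Adj i) (Poly_Mapping.single w c) =
       (\<Sum>k<length w. if var_index (w ! k) = i then Poly_Mapping.single (rotate_out k w) c else 0)" for i
      unfolding cyc_deriv_single sum.distrib[symmetric]
    proof (intro sum.cong refl)
      fix k show "(if w ! k = Var i then Poly_Mapping.single (rotate_out k w) c else 0) + (if w ! k = Adj i then Poly_Mapping.single (rotate_out k w) c else 0)
         = (if var_index (w ! k) = i then Poly_Mapping.single (rotate_out k w) c else 0)" by (cases "w ! k") auto
    qed
    have t: "tensor_fun (word_lin m) (free_diff x (\<Sum>k<n. if p k then Poly_Mapping.single (u k) c else 0)) = (\<Sum>k<n. if p k then c * splits m (\<lambda>y. y = x) (u k) else 0)" for x n p u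
      unfolding free_diff_sum tensor_fun_sum by (intro sum.cong) (auto simp: tensor_free_diff_single)
    have "L (Poly_Mapping.single w c) = (\<Sum>i\<in>UNIV. \<Sum>k<length w. if var_index (w ! k) = i then c * splits m (\<lambda>y. var_index y = i) (rotate_out k w) else 0)"
      unfolding L_def q tensor_fun_add t sum.distrib[symmetric]
      by (intro sum.cong refl) (simp add: sp[symmetric] distrib_left)
    also have "\<dots> = (\<Sum>k<length w. \<Sum>i\<in>UNIV. if var_index (w ! k) = i then c * splits m (\<lambda>y. var_index y = i) (rotate_out k w) else 0)" by (rule sum.swap)
    finally show ?thesis by (simp add: sum.delta' sum_distrib_left)
  qed
  show ?thesis
  proof
    assume "star_schwinger_dyson V (word_lin m)"
    then have eq: "L (Poly_Mapping.single w 1) = Rh (Poly_Mapping.single w 1)" for w by (simp add: sd)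
    show "\<forall>w. weak_sd var_index b B m w"
    proof
      fix w show "weak_sd var_index b B m w" using eq[of w] unfolding Lw Rw weak_sd_def r_def by simp
    qed
  next
    assume w: "\<forall>w. weak_sd var_index b B m w"
    have "L P = Rh P" for P
      by (induction P rule: ncpoly_induct) (use w in \<open>auto simp: add Lw Rw weak_sd_def r_def\<close>)
    then show "star_schwinger_dyson V (word_lin m)" by (simp add: sd)
  qed
qed

text \<open>The stationary law of the linear stochastic differential equation with drift matrix \<open>- B / 2\<close>: its covariance solves
  the Lyapunov equation.\<close>
lemma star_law_exist:
  fixes b :: "'m::finite \<Rightarrow> complex"
  assumes U: "(UNIV :: real set) \<lesssim> (UNIV :: 'u set)" and acc: "accretive c B" "0 < c"
  shows "\<exists>m. is_law TYPE('u) (word_lin m) \<and> (\<forall>w. weak_sd var_index (star_vec b) (star_mat B) m w)"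
proof -
  define C where "C = star_mat B"
  have acc': "accretive c C" unfolding C_def by (rule accretive_star_mat[OF acc(1)])
  define J where "J = (\<lambda>x y :: 'm var. 2 * (if var_index x = var_index y then 1 else (0::complex)))"
  obtain k where k: "\<And>x y. lyap C k x y = J x y" using lyap_solve[OF acc' acc(2)] by blast
  have J: "psd J" unfolding J_def
    by (intro psd_cmult psd_pull[OF psd_indicator]) (simp add: complex_nonneg_Reals_iff)
  have kpsd: "psd k" by (rule lyap_psd[OF acc' acc(2) k J])
  have Cf: "C (flip_var x) y = cnj (C x (flip_var y))" for x y
    using star_mat_flip[of B x "flip_var y"] by (simp add: C_def)
  have kflip: "k (flip_var y) (flip_var x) = k x y" for x y
  proof -
    have "lyap C (\<lambda>x y. k (flip_var y) (flip_var x)) x y = lyap C k x y" for x y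
    proof -
      have "lyap C (\<lambda>x y. k (flip_var y) (flip_var x)) x y =
         (\<Sum>z\<in>UNIV. cnj (C x (flip_var z)) * k (flip_var y) z) + (\<Sum>z\<in>UNIV. C y (flip_var z) * k z (flip_var x))"
        unfolding lyap_def using sum_flip[of "\<lambda>z. cnj (C x (flip_var z)) * k (flip_var y) z"] sum_flip[of "\<lambda>z. C y (flip_var z) * k z (flip_var x)"]
        by simp
      also have "\<dots> = lyap C k (flip_var y) (flip_var x)" by (simp add: lyap_def Cf add.commute)
      finally show ?thesis unfolding k by (simp add: J_def eq_commute)
    qed
    from lyap_inj[OF acc' acc(2) this] show ?thesis .
  qed
  obtain p where p: "\<And>i. (\<Sum>j\<in>UNIV. B i j * p j) = - b i" using accretive_solve[OF acc, of "\<lambda>i. - b i"] by blast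
  have mean: "(\<Sum>z\<in>UNIV. C x z * star_vec p z) = - star_vec b x" for x
  proof (cases x)
    case (Var i) then show ?thesis by (simp add: C_def sum_var p)
  next
    case (Adj i)
    have "(\<Sum>j\<in>UNIV. cnj (B i j) * cnj (p j)) = cnj (- b i)" unfolding p[symmetric] by simp
    then show ?thesis by (simp add: Adj C_def sum_var)
  qed
  interpret semicircular_family flip_var k "star_vec p"
  proof
    show "k (flip_var x) y = k (flip_var y) x" for x y using kflip[of y "flip_var x"] by simp
  qed (simp_all add: kpsd star_vec_flip)
  have cov: "(\<Sum>z\<in>UNIV. C x z * k (flip_var y) z) + (\<Sum>z\<in>UNIV. C y z * k (flip_var x) z) = (if var_index x = var_index y then 2 else 0)" for x y
  proof -
    have "(\<Sum>z\<in>UNIV. C y z * k (flip_var x) z) = (\<Sum>z\<in>UNIV. cnj (C (flip_var y) z) * k z x)"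
    proof -
      have "(\<Sum>z\<in>UNIV. C y z * k (flip_var x) z) = (\<Sum>z\<in>UNIV. C y (flip_var z) * k (flip_var x) (flip_var z))"
        by (rule sum_flip[symmetric])
      then show ?thesis by (simp add: kflip Cf)
    qed
    then have "(\<Sum>z\<in>UNIV. C x z * k (flip_var y) z) + (\<Sum>z\<in>UNIV. C y z * k (flip_var x) z) = lyap C k (flip_var y) x"
      by (simp add: lyap_def add.commute)
    then show ?thesis unfolding k by (auto simp: J_def)
  qed
  have "weak_sd var_index (star_vec b) C tau w" for w
    by (rule weak_sd_semicircular[OF semicircular_family_axioms cov mean])
  moreover have "is_law TYPE('u) (word_lin tau)"
  proof -
    obtain A :: "'u cstar" and \<phi> X where A: "tracial_cstar_space A \<phi>" "\<And>x. X x \<in> carrier A" "\<And>x. adj A (X x) = X (flip_var x)"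
      "\<And>P. \<phi> (eval_poly A X P) = word_lin tau P"
      using moment_fun_realized[OF U cont_small_finite moment_fun_tau, of] by auto
    have "with_adj A (\<lambda>i. X (Var i)) = X"
    proof
      fix x show "with_adj A (\<lambda>i. X (Var i)) x = X x" using A(3)[of "Var _"] by (cases x) auto
    qed
    then show ?thesis unfolding is_law_def using A by metis
  qed
  ultimately show ?thesis unfolding C_def by blast
qed

theorem theorem1p3:
  fixes M0 B0 :: "real \<Rightarrow> real \<Rightarrow> real" and b :: "real \<Rightarrow> real \<Rightarrow> real \<Rightarrow> real"
    and c M :: real and V :: "'m::finite ncpoly"
  assumes universe: "(UNIV :: real set) \<lesssim> (UNIV :: 'u set)"
    and constants: "sde_constants TYPE('u) TYPE('m) M0 B0 b"
    and "0 < c" and "0 < M"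
    and convex: "cM_convex TYPE('u) c M V"
    and "M0 c (grad_size_at_0 V) \<le> M"
  shows "(self_adjoint_poly TYPE('u) V \<longrightarrow>
            (\<exists>\<mu>. is_sa_law TYPE('u) \<mu> \<and> has_conjugate_variables \<mu> (\<lambda>i. cyc_deriv i V)) \<and>
            (\<exists>\<^sub>\<le>\<^sub>1 \<mu>. is_sa_law_bounded TYPE('u) (b c (grad_size_at_0 V) M) \<mu> \<and>
               has_conjugate_variables \<mu> (\<lambda>i. cyc_deriv i V))) \<and>
         (\<exists>\<mu>. is_law TYPE('u) \<mu> \<and> star_schwinger_dyson V \<mu>) \<and>
         (\<exists>\<^sub>\<le>\<^sub>1 \<mu>. is_law_bounded TYPE('u) (b c (grad_size_at_0 V) M) \<mu> \<and>
            star_schwinger_dyson V \<mu>)"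
proof -
  have aff: "affine_poly (cyc_deriv i V)" for i
    unfolding affine_poly_def using convex_gradient_affine[OF universe convex \<open>0 < c\<close> \<open>0 < M\<close>] by blast
  have acc: "accretive c (\<lambda>i j. Poly_Mapping.lookup (cyc_deriv i V) [j])"
    unfolding accretive_def using convex_gradient_accretive[OF universe convex \<open>0 < c\<close> \<open>0 < M\<close>] by blast
  have sym: "Poly_Mapping.lookup (cyc_deriv i V) [j] = Poly_Mapping.lookup (cyc_deriv j V) [i]" for i j
    by (simp add: cyc_deriv_coeffs)
  have sa_ex: "\<exists>\<mu>. is_sa_law TYPE('u) \<mu> \<and> has_conjugate_variables \<mu> (\<lambda>i. cyc_deriv i V)" if "self_adjoint_poly TYPE('u) V"
    using conjugate_variables_exist[OF universe aff acc \<open>0 < c\<close> sym self_adjoint_gradient_real(2)[OF universe that] self_adjoint_gradient_real(1)[OF universe that]]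
    by blast
  have sa_un: "\<exists>\<^sub>\<le>\<^sub>1 \<mu>. is_sa_law_bounded TYPE('u) (b c (grad_size_at_0 V) M) \<mu> \<and> has_conjugate_variables \<mu> (\<lambda>i. cyc_deriv i V)"
  proof (rule Uniq_I, elim conjE)
    fix \<mu> \<mu>'
    assume l: "is_sa_law_bounded TYPE('u) (b c (grad_size_at_0 V) M) \<mu>" "is_sa_law_bounded TYPE('u) (b c (grad_size_at_0 V) M) \<mu>'"
      and h: "has_conjugate_variables \<mu> (\<lambda>i. cyc_deriv i V)" "has_conjugate_variables \<mu>' (\<lambda>i. cyc_deriv i V)"
    have "is_sa_law TYPE('u) \<mu>" "is_sa_law TYPE('u) \<mu>'" using l unfolding is_sa_law_def is_sa_law_bounded_def by blast+
    then obtain m m' where m: "\<mu> = word_lin m" "m [] = 1" "\<mu>' = word_lin m'" "m' [] = 1" using is_sa_law_moments by metis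
    then show "\<mu> = \<mu>'" using conjugate_variables_unique[OF aff acc \<open>0 < c\<close>] h by metis
  qed
  have ex: "\<exists>\<mu>. is_law TYPE('u) \<mu> \<and> star_schwinger_dyson V \<mu>"
    using star_law_exist[OF universe acc \<open>0 < c\<close>] star_schwinger_dyson_words[OF aff] by metis
  have un: "\<exists>\<^sub>\<le>\<^sub>1 \<mu>. is_law_bounded TYPE('u) (b c (grad_size_at_0 V) M) \<mu> \<and> star_schwinger_dyson V \<mu>"
  proof (rule Uniq_I, elim conjE)
    fix \<mu> \<mu>'
    assume l: "is_law_bounded TYPE('u) (b c (grad_size_at_0 V) M) \<mu>" "is_law_bounded TYPE('u) (b c (grad_size_at_0 V) M) \<mu>'"
      and h: "star_schwinger_dyson V \<mu>" "star_schwinger_dyson V \<mu>'"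
    have "is_law TYPE('u) \<mu>" "is_law TYPE('u) \<mu>'" using l unfolding is_law_def is_law_bounded_def by blast+
    then obtain m m' where m: "\<mu> = word_lin m" "m [] = 1" "\<forall>u v. m (u @ v) = m (v @ u)"
      "\<mu>' = word_lin m'" "m' [] = 1" "\<forall>u v. m' (u @ v) = m' (v @ u)"
      using is_law_moments[of \<mu>] is_law_moments[of \<mu>'] by blast
    have "m = m'"
      by (rule weak_sd_unique[where ix = var_index and b = "star_vec (\<lambda>i. Poly_Mapping.lookup (cyc_deriv i V) [])", OF accretive_star_mat[OF acc] \<open>0 < c\<close>])
        (use h m(2,3,5,6) in \<open>simp_all add: m(1,4) star_schwinger_dyson_words[OF aff]\<close>)
    then show "\<mu> = \<mu>'" by (simp add: m)
  qed
  show ?thesis using sa_ex sa_un ex un by blast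
qed

end
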